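(* There exist absolute constants $C>0$ and $T_0>0$ such that the following holds. For any zero $\beta'+i\gamma'$ of $\zeta'(s)$ (with $\beta',\gamma'$ real) satisfying $\gamma'\ge T_0$, there exists an index $n\ge 1$ such that $\gamma'-1\le \gamma_n\le \gamma_{n+2}\le \gamma'+1$ and $$ \min\{|\gamma_c-\gamma'|\log\gamma', \; |\gamma_{n+2}-\gamma_n|\log\gamma_n\}\le C \left(|\beta'-\tfrac{1}{2}|\log\gamma'\right)^{\frac{1}{2}}. $$
   Context: $\zeta(s)$ is the Riemann zeta-function and $\zeta'(s)$ its derivative. The non-trivial zeros of $\zeta(s)$ are those in the critical strip $0\le \Re s\le 1$. The non-trivial zeros in the upper half-plane are written $\rho_n=\beta_n+i\gamma_n$ and indexed so that $0<\gamma_1\le\gamma_2\le\ldots$, where the ordinate of a zero of multiplicity $m$ appears $m$ times consecutively in the sequence. For a zero $\beta'+i\gamma'$ of $\zeta'(s)$, $\gamma_c$ denotes the one among all ordinates (imaginary parts) of non-trivial zeros of $\zeta(s)$ for which $|\gamma_c-\gamma'|$ is smallest (if there is more than one such zero of $\zeta(s)$, $\gamma_c$ is the imaginary part of any one of them). The Riemann hypothesis is not assumed. *)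

theory Defs
  imports "HOL-Complex_Analysis.Complex_Analysis"
begin

(* The Riemann zeta-function as the analytic continuation of its Dirichlet series to the plane
   punctured at the pole 1.  The continuation is unique by the identity theorem; the dummy value
   at the pole only serves to make the total function on the complex numbers unique as well. *)
definition zeta :: "complex \<Rightarrow> complex" where
  "zeta = (THE f. f holomorphic_on - {1}
                \<and> (\<forall>s. Re s > 1 \<longrightarrow> (\<lambda>n. of_nat (Suc n) powr (- s)) sums f s)
                \<and> f 1 = 0)"

(* s = 1 is excluded explicitly because of the dummy value of zeta there. *)
definition nontrivial_zeros :: "complex set" where
  "nontrivial_zeros = {s. s \<noteq> 1 \<and> zeta s = 0 \<and> 0 \<le> Re s \<and> Re s \<le> 1}"

(* rho 1, rho 2, ... lists the non-trivial zeros in the upper half-plane by increasing ordinate,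
   each zero as often as its multiplicity.  The value rho 0 plays no role.  As zorder is at least 1
   at these zeros, the cardinality condition includes that each zero does occur, and only
   finitely often. *)
definition enumerates_upper_zeros :: "(nat \<Rightarrow> complex) \<Rightarrow> bool" where
  "enumerates_upper_zeros \<rho> \<longleftrightarrow>
     (\<forall>n\<ge>1. \<rho> n \<in> nontrivial_zeros \<and> Im (\<rho> n) > 0) \<and>
     (\<forall>m\<ge>1. \<forall>n\<ge>m. Im (\<rho> m) \<le> Im (\<rho> n)) \<and>
     (\<forall>s\<in>nontrivial_zeros. Im s > 0 \<longrightarrow> int (card {n. n \<ge> 1 \<and> \<rho> n = s}) = zorder zeta s)"

(* Such a listing is unique only up to the order of zeros with equal ordinates, but the sequence
   of ordinates gamma_1, gamma_2, ... does not depend on the choice. *)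
definition upper_zero :: "nat \<Rightarrow> complex" where
  "upper_zero = (SOME \<rho>. enumerates_upper_zeros \<rho>)"

definition upper_ordinate :: "nat \<Rightarrow> real" where
  "upper_ordinate n = Im (upper_zero n)"

(* t is the ordinate of a non-trivial zero (in either half-plane) at minimal distance from y. *)
definition closest_ordinate :: "real \<Rightarrow> real \<Rightarrow> bool" where
  "closest_ordinate y t \<longleftrightarrow> is_arg_min (\<lambda>u. \<bar>u - y\<bar>) (\<lambda>u. u \<in> Im ` nontrivial_zeros) t"

end

theory Submission
  imports Defs "HOL-Real_Asymp.Real_Asymp"
begin

text \<open>
  Let \<open>\<beta>' + \<i>T\<close> be a zero of \<open>\<zeta>'\<close> with large \<open>T\<close>.  The idea is to compare the logarithmic derivative
  \<open>\<zeta>'/\<zeta>\<close> at this point, where it vanishes, with its value at \<open>1/2 + \<i>T\<close>.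

  The functional equation \<open>\<zeta>(s) = \<chi>(s) \<zeta>(1 - s)\<close> forces \<open>Re (\<zeta>'/\<zeta>)(1/2 + \<i>T) \<le> - (ln T) / 4\<close> unless
  \<open>\<zeta>\<close> vanishes there (\<open>Re_zeta_log_deriv_critical_line\<close>).  So \<open>\<zeta>'/\<zeta>\<close> varies by at least \<open>(ln T) / 4\<close> over a
  horizontal segment of length \<open>\<bar>\<beta>' - 1/2\<bar>\<close>.  On the other hand, Landau's local formula writes \<open>\<zeta>'/\<zeta>\<close> as the sum
  of \<open>1 / (s - \<rho>)\<close> over the zeros in a disc plus a function with derivative \<open>O(ln T)\<close>, so the variation is at most
  \<open>\<bar>\<beta>' - 1/2\<bar>\<close> times the sum of \<open>1 / (\<gamma> - T)\<^sup>2\<close> plus \<open>O(ln T)\<close> (\<open>zeta_local_log_deriv\<close>).  If the asserted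
  inequality fails for all triples of consecutive zeros with ordinates in \<open>[T - 1, T + 1]\<close>, then all zeros have
  vertical distance more than \<open>\<eta>\<close> from \<open>T\<close>, and no three consecutive ones lie within \<open>\<eta>\<close>, where \<open>\<eta>\<close> is
  of order \<open>C sqrt (\<bar>\<beta>' - 1/2\<bar> / ln T)\<close>.  The sum is then at most \<open>8 / \<eta>\<^sup>2\<close> (\<open>sum_inverse_squares_le\<close>), and the
  two estimates contradict each other when \<open>C\<close> is large and \<open>\<bar>\<beta>' - 1/2\<bar>\<close> is small.

  When \<open>\<bar>\<beta>' - 1/2\<bar>\<close> is bounded below, the right-hand side of the inequality is large, and it suffices that some
  three consecutive ordinates in the window lie within \<open>O(1 / ln T)\<close>.  By the pigeonhole principle this follows
  from the fact that the window contains at least \<open>c ln T\<close> zeros (\<open>zeta_zeros_near_many\<close>), which also shows that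
  triples exist at all.  That fact is proved by a normal-family argument: if there were few zeros, then after removing them
  suitable powers of \<open>\<zeta>\<close> with exponents \<open>1 / ln T\<close> would converge to a constant of modulus 1, although the functional
  equation makes \<open>\<zeta>\<close> of order at least \<open>T\<close> on the line \<open>Re s = -1/2\<close>.

  The continuation of \<open>\<zeta>\<close> comes from trapezoid corrections to the Dirichlet series, which converge for
  \<open>Re s > -1\<close> and are integrals of a periodic parabola against a power.  For real \<open>s\<close> between \<open>-1\<close> and 0 the
  partial fractions of the hyperbolic cotangent turn them into the Dirichlet series at \<open>1 - s\<close>; all quantities are positive,
  and the identity theorem extends the resulting functional equation (\<open>zeta_entire_functional_equation\<close>).
\<close>

section \<open>Continuation to the half-plane to the right of -1\<close>

text \<open>
  Multiplying the trapezoid correction by \<open>s - 1\<close> clears the pole, so that the continuation can be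
  built from entire terms; the integral form below shows that they decay like \<open>a powr (- Re s - 2)\<close>,
  two orders better than the Dirichlet series.
\<close>
definition em_term :: "nat \<Rightarrow> complex \<Rightarrow> complex" where
  "em_term a s = (s - 1) / 2 * (of_nat a powr (- s) + of_nat (Suc a) powr (- s))
     - (of_nat a powr (1 - s) - of_nat (Suc a) powr (1 - s))"

text \<open>
  Two integrations by parts against the parabola \<open>u - u\<^sup>2\<close>, which vanishes at both ends of the
  unit interval; \<open>K\<close> is the antiderivative that they produce.
\<close>
lemma em_term_has_integral:
  assumes "a \<ge> 1"
  shows "((\<lambda>u::real. (s - 1) * s * (s + 1) / 2 * of_real (u - u\<^sup>2) * (of_nat a + of_real u) powr (- s - 2))
           has_integral em_term a s) {0..1}"
proof -
  define K where "K = (\<lambda>z::complex. (s - 1) * (- (s / 2) * (z - z\<^sup>2) * (of_nat a + z) powr (- s - 1)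
        - (1 - 2 * z) / 2 * (of_nat a + z) powr (- s)) + (of_nat a + z) powr (1 - s))"
  have deriv: "((\<lambda>u. K (of_real u)) has_vector_derivative
      ((s - 1) * s * (s + 1) / 2 * of_real (u - u\<^sup>2) * (of_nat a + of_real u) powr (- s - 2)))
      (at u within {0..1})" if u: "u \<in> {0..1}" for u :: real
  proof (rule has_vector_derivative_real_field)
    define w where "w = of_nat a + complex_of_real u"
    have w_pos: "w = of_real (real a + u)" "real a + u > 0" using u assms by (auto simp: w_def)
    have w: "w \<notin> \<real>\<^sub>\<le>\<^sub>0" using w_pos by (metis complex_nonpos_Reals_iff Re_complex_of_real not_le)
    have w0: "w \<noteq> 0" using w by auto
    \<comment> \<open>Every power of \<open>w\<close> in sight is \<open>P\<close> times a polynomial, which leaves a polynomial identity.\<close>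
    define P where "P = w powr (- s - 2)"
    have step: "w powr (x + 1) = w powr x * w" for x
      using exp_Ln[OF w0] w0 by (simp add: powr_def exp_add distrib_right)
    have e1: "w powr (- s - 1) = P * w"
      unfolding P_def by (rule trans[OF _ step]) (rule arg_cong[of _ _ "\<lambda>x. w powr x"], simp)
    have e2: "w powr (- s) = P * w * w"
      unfolding e1[symmetric] by (rule trans[OF _ step]) (rule arg_cong[of _ _ "\<lambda>x. w powr x"], simp)
    have e3: "w powr (1 - s) = P * w * w * w"
      unfolding e2[symmetric] by (rule trans[OF _ step]) (rule arg_cong[of _ _ "\<lambda>x. w powr x"], simp)
    have e4: "w powr (- s - 1 - 1) = P" "w powr (1 - s - 1) = P * w * w"
    proof -
      have "- s - 1 - 1 = - s - 2" by simp
      then show "w powr (- s - 1 - 1) = P" by (simp only: P_def)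
      show "w powr (1 - s - 1) = P * w * w" using e2 by simp
    qed
    note e = e1 e2 e3 e4 P_def[symmetric]
    have D: "((\<lambda>z. (of_nat a + z) powr c) has_field_derivative c * w powr (c - 1)) (at (of_real u))" for c
      by (rule derivative_eq_intros refl | use w in \<open>simp add: w_def\<close>)+
    note D1 = D[of "- s - 1", unfolded e] and D2 = D[of "- s", unfolded e] and D3 = D[of "1 - s", unfolded e]
    define p where "p c z = (of_nat a + z) powr c" for c z :: complex
    note D' = D1[folded p_def] D2[folded p_def] D3[folded p_def]
    have p: "p (- s - 1) (of_real u) = P * w" "p (- s) (of_real u) = P * w * w"
      using e1 e2 by (simp_all add: w_def p_def)
    define h U where "h = (1 / 2 :: complex)" and "U = complex_of_real u"
    have h: "2 * h = 1" by (simp add: h_def)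
    note D' = D'[folded U_def] and p = p[folded U_def]
    have K_eq: "K = (\<lambda>z. (s - 1) * (- (h * s) * (z - z\<^sup>2) * p (- s - 1) z - (h - z) * p (- s) z) + p (1 - s) z)"
      by (simp add: K_def p_def h_def diff_divide_distrib)
    have A: "((\<lambda>z. - (h * s) * (z - z\<^sup>2)) has_field_derivative - (h * s) * (1 - 2 * U)) (at U)"
      by (auto intro!: derivative_eq_intros)
    have B: "((\<lambda>z. h - z) has_field_derivative - 1) (at U)"
      by (auto intro!: derivative_eq_intros)
    have "(K has_field_derivative
        (s - 1) * ((- (h * s) * (1 - 2 * U) * p (- s - 1) U + (- s - 1) * P * (- (h * s) * (U - U\<^sup>2)))
          - (- 1 * p (- s) U + - s * (P * w) * (h - U))) + (1 - s) * (P * w * w)) (at U)"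
      unfolding K_eq by (intro DERIV_add DERIV_cmult DERIV_diff DERIV_mult A B D')
    also have "(s - 1) * ((- (h * s) * (1 - 2 * U) * p (- s - 1) U + (- s - 1) * P * (- (h * s) * (U - U\<^sup>2)))
          - (- 1 * p (- s) U + - s * (P * w) * (h - U))) + (1 - s) * (P * w * w) = (s - 1) * s * (s + 1) * h * (U - U\<^sup>2) * P"
      unfolding p using h by algebra
    also have "\<dots> = (s - 1) * s * (s + 1) / 2 * of_real (u - u\<^sup>2) * P"
      by (simp add: h_def U_def)
    finally show "(K has_field_derivative (s - 1) * s * (s + 1) / 2 * of_real (u - u\<^sup>2) * (of_nat a + of_real u) powr (- s - 2)) (at (of_real u))"
      by (simp only: w_def P_def U_def)
  qed
  have "((\<lambda>u::real. (s - 1) * s * (s + 1) / 2 * of_real (u - u\<^sup>2) * (of_nat a + of_real u) powr (- s - 2))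
           has_integral (K (of_real 1) - K (of_real 0))) {0..1}"
    by (rule fundamental_theorem_of_calculus) (use deriv in auto)
  also have "K (of_real 1) - K (of_real 0) = em_term a s"
    by (simp add: K_def em_term_def field_simps)
  finally show ?thesis .
qed

lemma norm_em_term_le:
  assumes "a \<ge> 1" "Re s \<ge> -2"
  shows "norm (em_term a s) \<le> norm ((s - 1) * s * (s + 1)) * real a powr (- Re s - 2)"
proof -
  define f where "f u = (s - 1) * s * (s + 1) / 2 * of_real (u - u\<^sup>2) * (of_nat a + of_real u) powr (- s - 2)" for u :: real
  have "norm (f u) \<le> norm ((s - 1) * s * (s + 1)) * real a powr (- Re s - 2)" if u: "u \<in> {0..1}" for u
  proof -
    have eq: "of_nat a + complex_of_real u = of_real (real a + u)" by simp
    have "norm ((of_nat a + complex_of_real u) powr (- s - 2)) = (real a + u) powr (- Re s - 2)"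
      unfolding eq using u assms(1) by (subst norm_powr_real_powr) auto
    also have "\<dots> \<le> real a powr (- Re s - 2)"
      by (rule powr_mono2') (use u assms in auto)
    finally have 1: "norm ((of_nat a + complex_of_real u) powr (- s - 2)) \<le> real a powr (- Re s - 2)" .
    have "u\<^sup>2 \<le> u" using u by (simp add: power2_eq_square mult_left_le)
    moreover have "u - u\<^sup>2 \<le> 1" using zero_le_power2[of u] u unfolding atLeastAtMost_iff by linarith
    ultimately have "\<bar>u - u\<^sup>2\<bar> \<le> 1" by simp
    then have 2: "norm (complex_of_real (u - u\<^sup>2)) \<le> 1" by (simp only: norm_of_real)
    have "norm (f u) = norm ((s - 1) * s * (s + 1)) / 2 * norm (complex_of_real (u - u\<^sup>2)) * norm ((of_nat a + complex_of_real u) powr (- s - 2))"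
      by (simp add: f_def norm_mult norm_divide)
    also have "\<dots> \<le> norm ((s - 1) * s * (s + 1)) * 1 * real a powr (- Re s - 2)"
      by (intro mult_mono 1 2) auto
    finally show ?thesis by simp
  qed
  then have "norm (em_term a s) \<le> norm ((s - 1) * s * (s + 1)) * real a powr (- Re s - 2) * measure lborel {0..1::real}"
    using em_term_has_integral[OF assms(1), of s, folded f_def]
    by (intro has_integral_bound_real[where f = f and S = "{}"]) auto
  then show ?thesis by simp
qed

lemma summable_Suc_powr: "p > 1 \<Longrightarrow> summable (\<lambda>a. real (Suc a) powr (- p))"
  using summable_real_powr_iff[of "-p"] summable_Suc_iff[of "\<lambda>a. real a powr (-p)"] by simp

text \<open>
  The function \<open>(s - 1) \<zeta>(s)\<close>, which is regular at 1.
\<close>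
definition zeta_entire :: "complex \<Rightarrow> complex" where
  "zeta_entire s = (s - 1) / 2 + 1 + (\<Sum>a. em_term (Suc a) s)"

lemma summable_em_term:
  assumes "Re s > -1"
  shows "summable (\<lambda>a. em_term (Suc a) s)"
proof (rule summable_comparison_test')
  show "summable (\<lambda>a. norm ((s - 1) * s * (s + 1)) * real (Suc a) powr - (Re s + 2))"
    by (intro summable_mult summable_Suc_powr) (use assms in auto)
  show "norm (em_term (Suc n) s) \<le> norm ((s - 1) * s * (s + 1)) * real (Suc n) powr - (Re s + 2)" for n
    using norm_em_term_le[of "Suc n" s] assms by (simp add: algebra_simps)
qed

lemma holomorphic_zeta_entire: "zeta_entire holomorphic_on {s. Re s > -1}"
proof -
  have "(\<lambda>s. \<Sum>a. em_term (Suc a) s) holomorphic_on {s. Re s > -1}"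
  proof (rule holomorphic_uniform_sequence)
    show "open {s. Re s > -1}" by (simp add: open_halfspace_Re_gt)
    show "(\<lambda>s. \<Sum>a<n. em_term (Suc a) s) holomorphic_on {s. -1 < Re s}" for n
      unfolding em_term_def by (intro holomorphic_intros) auto
    fix s :: complex assume "s \<in> {s. Re s > -1}"
    then have s: "Re s > -1" by simp
    define d where "d = (Re s + 1) / 2"
    have d: "d > 0" using s by (simp add: d_def)
    have Re_ge: "Re z \<ge> Re s - d" "norm z \<le> norm s + d" if "z \<in> cball s d" for z
    proof -
      show "Re z \<ge> Re s - d" using that abs_Re_le_cmod[of "s - z"] by (auto simp: dist_norm)
      show "norm z \<le> norm s + d" using that norm_triangle_ineq2[of z s] by (auto simp: dist_norm norm_minus_commute)
    qed
    define B where "B = (norm s + d + 1) * (norm s + d) * (norm s + d + 1)"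
    have "uniform_limit (cball s d) (\<lambda>n z. \<Sum>a<n. em_term (Suc a) z) (\<lambda>z. \<Sum>a. em_term (Suc a) z) sequentially"
    proof (rule Weierstrass_m_test)
      show "summable (\<lambda>a. B * real (Suc a) powr - (1 + d))"
        by (intro summable_mult summable_Suc_powr) (use d in auto)
      fix a z assume z: "z \<in> cball s d"
      have "norm (em_term (Suc a) z) \<le> norm ((z - 1) * z * (z + 1)) * real (Suc a) powr (- Re z - 2)"
        by (rule norm_em_term_le) (use Re_ge[OF z] d s in \<open>auto simp: d_def field_simps\<close>)
      also have "\<dots> \<le> B * real (Suc a) powr - (1 + d)"
      proof (rule mult_mono)
        have pos: "0 \<le> norm s + d + 1" "0 \<le> norm s + d" using d norm_ge_zero[of s] by linarith+
        show "norm ((z - 1) * z * (z + 1)) \<le> B" unfolding B_def norm_mult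
          using Re_ge(2)[OF z] d norm_ge_zero[of s] norm_triangle_ineq4[of z 1] norm_triangle_ineq[of z 1]
          unfolding norm_one by (intro mult_mono mult_nonneg_nonneg pos norm_ge_zero) linarith+
        show "real (Suc a) powr (- Re z - 2) \<le> real (Suc a) powr - (1 + d)"
          by (rule powr_mono) (use Re_ge[OF z] d s in \<open>auto simp: d_def field_simps\<close>)
      qed (auto simp: B_def d less_imp_le)
      finally show "norm (em_term (Suc a) z) \<le> B * real (Suc a) powr - (1 + d)" .
    qed
    moreover have "cball s d \<subseteq> {s. Re s > -1}"
      using Re_ge d s by (force simp: d_def field_simps)
    ultimately show "\<exists>d>0. cball s d \<subseteq> {s. -1 < Re s} \<and>
        uniform_limit (cball s d) (\<lambda>n s. \<Sum>a<n. em_term (Suc a) s) (\<lambda>s. \<Sum>a. em_term (Suc a) s) sequentially"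
      using d by blast
  qed
  then show ?thesis unfolding zeta_entire_def [abs_def] by (intro holomorphic_intros) auto
qed

lemma zeta_entire_1: "zeta_entire 1 = 1"
proof -
  have "em_term (Suc a) 1 = 0" for a
    using norm_em_term_le[of "Suc a" 1] by simp
  then show ?thesis by (simp add: zeta_entire_def)
qed

lemma zeta_entire_cnj:
  assumes "Re s > -1"
  shows "zeta_entire (cnj s) = cnj (zeta_entire s)"
proof -
  have 1: "em_term (Suc a) (cnj s) = cnj (em_term (Suc a) s)" for a
    by (simp add: em_term_def cnj_powr Arg_eq_0_pi flip: of_nat_Suc)
  have "(\<lambda>a. em_term (Suc a) (cnj s)) sums cnj (\<Sum>a. em_term (Suc a) s)"
    unfolding 1 sums_cnj by (rule summable_sums[OF summable_em_term[OF assms]])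
  then show ?thesis by (simp add: zeta_entire_def sums_iff)
qed

lemma norm_of_nat_powr: "norm (of_nat n powr s :: complex) = real n powr Re s"
proof -
  have "of_nat n = complex_of_real (real n)" by simp
  then show ?thesis by (simp only: norm_powr_real_powr Reals_of_real Re_complex_of_real of_nat_0_le_iff)
qed

lemma tendsto_Suc_powr_0:
  assumes "Re s > 0"
  shows "(\<lambda>N. of_nat (Suc N) powr (- s)) \<longlonglongrightarrow> (0::complex)"
proof (rule tendsto_norm_zero_cancel)
  have "filterlim (\<lambda>N. real (Suc N)) at_top sequentially"
    by (rule filterlim_compose[OF filterlim_real_sequentially filterlim_Suc])
  from tendsto_neg_powr[OF _ this, of "- Re s"] assms
  have "(\<lambda>N. real (Suc N) powr (- Re s)) \<longlonglongrightarrow> 0" by simp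
  then show "(\<lambda>N. norm (of_nat (Suc N) powr (- s) :: complex)) \<longlonglongrightarrow> 0"
    by (simp only: norm_of_nat_powr uminus_complex.sel)
qed

lemma zeta_entire_sums:
  assumes "Re s > 1"
  shows "(\<lambda>n. of_nat (Suc n) powr (- s)) sums (zeta_entire s / (s - 1))"
proof -
  have s1: "s \<noteq> 1" using assms by auto
  have part: "(\<Sum>a<N. of_nat (Suc a) powr (- s)) =
      ((\<Sum>a<N. em_term (Suc a) s) + (s - 1) / 2 + 1 - (s - 1) / 2 * of_nat (Suc N) powr (- s)
         - of_nat (Suc N) powr (- (s - 1))) / (s - 1)" for N
  proof (induction N)
    case 0 then show ?case by simp
  next
    case (Suc N)
    show ?case unfolding sum.lessThan_Suc Suc.IH using s1
      by (simp add: em_term_def field_simps)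
  qed
  have "(\<lambda>N. (\<Sum>a<N. of_nat (Suc a) powr (- s)))
     \<longlonglongrightarrow> ((\<Sum>a. em_term (Suc a) s) + (s - 1) / 2 + 1 - (s - 1) / 2 * 0 - 0) / (s - 1)"
    unfolding part using assms s1
    by (intro tendsto_intros summable_LIMSEQ summable_em_term tendsto_Suc_powr_0) auto
  then show ?thesis by (simp add: sums_def zeta_entire_def algebra_simps)
qed

text \<open>
  The bound \<open>-3/4\<close> only has to lie strictly between \<open>-1\<close>, where the series of trapezoid corrections
  stops converging, and the left end \<open>-7/10\<close> of the discs used below.
\<close>
lemma norm_zeta_entire_le:
  obtains K where "K > 0" "\<And>s. Re s \<ge> -3/4 \<Longrightarrow> norm (zeta_entire s) \<le> 1 + norm (s - 1) * (1/2 + K * (norm s * norm (s + 1)))"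
proof
  define K where "K = (\<Sum>a. real (Suc a) powr - (5/4))"
  have sm: "summable (\<lambda>a. real (Suc a) powr - (5/4))" by (rule summable_Suc_powr) simp
  show "K > 0" unfolding K_def by (rule suminf_pos[OF sm]) simp
  fix s :: complex assume s: "Re s \<ge> -3/4"
  have "norm (\<Sum>a. em_term (Suc a) s) \<le> (\<Sum>a. norm ((s - 1) * s * (s + 1)) * real (Suc a) powr - (5/4))"
  proof (rule norm_suminf_le)
    show "summable (\<lambda>a. norm ((s - 1) * s * (s + 1)) * real (Suc a) powr - (5/4))"
      by (intro summable_mult sm)
    show "norm (em_term (Suc a) s) \<le> norm ((s - 1) * s * (s + 1)) * real (Suc a) powr - (5/4)" for a
      by (rule order.trans[OF norm_em_term_le]) (use s in \<open>auto intro!: mult_left_mono powr_mono\<close>)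
  qed
  also have "\<dots> = norm ((s - 1) * s * (s + 1)) * K" unfolding K_def by (rule suminf_mult[OF sm])
  finally have 1: "norm (\<Sum>a. em_term (Suc a) s) \<le> norm ((s - 1) * s * (s + 1)) * K" .
  have "norm (zeta_entire s) \<le> norm ((s - 1) / 2) + 1 + norm (\<Sum>a. em_term (Suc a) s)"
    using norm_triangle_ineq[of "(s - 1) / 2 + 1" "\<Sum>a. em_term (Suc a) s"] norm_triangle_ineq[of "(s - 1) / 2" 1]
    unfolding zeta_entire_def norm_one by linarith
  also have "\<dots> \<le> norm (s - 1) / 2 + 1 + norm ((s - 1) * s * (s + 1)) * K"
    using 1 by (simp add: norm_divide)
  finally show "norm (zeta_entire s) \<le> 1 + norm (s - 1) * (1/2 + K * (norm s * norm (s + 1)))"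
    unfolding norm_mult by (simp add: algebra_simps)
qed

section \<open>Mellin integrals around the partial fractions of coth\<close>

text \<open>
  The logarithmic derivative of the reflection formula of the Gamma function.
\<close>
lemma Digamma_reflection:
  fixes z :: complex
  assumes "z \<notin> \<int>"
  shows "Digamma z - Digamma (1 - z) = - of_real pi * cos (of_real pi * z) / sin (of_real pi * z)"
proof -
  have nz: "z \<notin> \<int>\<^sub>\<le>\<^sub>0" "1 - z \<notin> \<int>\<^sub>\<le>\<^sub>0"
    using assms nonpos_Ints_Int by (auto dest!: nonpos_Ints_Int Ints_diff[of 1 "1 - z"])
  have sin0: "sin (of_real pi * z) \<noteq> 0"
    using assms by (auto simp: sin_eq_0 mult_ac)
  have 1: "((\<lambda>z. Gamma z * Gamma (1 - z)) has_field_derivative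
      Gamma z * Gamma (1 - z) * (Digamma z - Digamma (1 - z))) (at z)"
  proof -
    have A: "((\<lambda>z::complex. 1 - z) has_field_derivative - 1) (at z)" by (auto intro!: derivative_eq_intros)
    have "((\<lambda>z. Gamma z * Gamma (1 - z)) has_field_derivative
      Gamma z * Digamma z * Gamma (1 - z) + (Gamma (1 - z) * Digamma (1 - z)) * (- 1) * Gamma z) (at z)"
      by (intro DERIV_mult has_field_derivative_Gamma nz DERIV_chain2[OF _ A])
    then show ?thesis by (simp add: algebra_simps)
  qed
  have 2: "((\<lambda>z. of_real pi / sin (of_real pi * z)) has_field_derivative
      - (of_real pi * (of_real pi * cos (of_real pi * z))) / (sin (of_real pi * z) * sin (of_real pi * z))) (at z)"
    by (rule derivative_eq_intros refl | use sin0 in simp)+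
  have "Gamma z * Gamma (1 - z) * (Digamma z - Digamma (1 - z)) =
      - (of_real pi * (of_real pi * cos (of_real pi * z))) / (sin (of_real pi * z) * sin (of_real pi * z))"
    using DERIV_unique[OF 1] 2 unfolding Gamma_reflection_complex by blast
  then have "(of_real pi / sin (of_real pi * z)) * (Digamma z - Digamma (1 - z)) =
      (of_real pi / sin (of_real pi * z)) * (- of_real pi * cos (of_real pi * z) / sin (of_real pi * z))"
    unfolding Gamma_reflection_complex by simp
  then show ?thesis using sin0 by (subst (asm) mult_cancel_left) auto
qed

text \<open>
  On the imaginary axis the cotangent in the reflection formula becomes a hyperbolic one, and the
  series of the two Digamma values pair up into real fractions.  This identity carries the
  arithmetic of the functional equation: the Laplace transform of the periodic parabola is
  a multiple of the left-hand side, and the Mellin transform of each fraction is a power of \<open>Suc n\<close>.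
\<close>
lemma coth_partial_fractions:
  fixes t :: real
  assumes "t > 0"
  shows "(\<lambda>n. 4 * t / (t\<^sup>2 + 4 * pi\<^sup>2 * real (Suc n) ^ 2)) sums ((1 + exp (- t)) / (1 - exp (- t)) - 2 / t)"
proof -
  let ?a = "\<lambda>n. 4 * t / (t\<^sup>2 + 4 * pi\<^sup>2 * real (Suc n) ^ 2)"
  define y where "y = t / (2 * pi)"
  have y: "y > 0" using assms by (simp add: y_def)
  define z where "z = \<i> * complex_of_real y"
  have zI: "z \<notin> \<int>" using y by (auto simp: z_def complex_is_Int_iff)
  have z0: "z \<noteq> 0" "1 - z \<noteq> 0" using zI by auto
  have n0: "of_nat n + 1 - z \<noteq> 0" "of_nat n + 1 + z \<noteq> 0" "of_nat n + z \<noteq> 0" for n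
    using y by (auto simp: z_def complex_eq_iff)
  define E where "E = (1 + exp (- t)) / (1 - exp (- t))"
  have exp1: "exp (- t) \<noteq> 1" using assms by simp
  have "cos (of_real pi * z) / sin (of_real pi * z) = - \<i> * of_real E"
  proof -
    have e: "exp (\<i> * (of_real pi * z)) = of_real (exp (- (t / 2)))" "exp (- (\<i> * (of_real pi * z))) = of_real (exp (t / 2))"
      by (simp_all add: z_def y_def exp_of_real[symmetric] field_simps)
    have f: "exp (t / 2) = 1 / exp (- (t/2))" "exp (-t) = exp (- (t/2)) * exp (- (t/2))" 
      by (simp_all add: exp_minus field_simps exp_add [symmetric])
    define q where "q = exp (- (t / 2))"
    have q: "q > 0" "q * q \<noteq> 1" using exp1 f by (auto simp: q_def)
    have "E = (1/q + q) / (1/q - q)" unfolding E_def f(2) q_def[symmetric] using q by (simp add: field_simps)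
    then have E: "of_real E = (1/of_real q + of_real q) / (1/of_real q - complex_of_real q)" by simp
    have c: "complex_of_real q \<noteq> 0" "1 / complex_of_real q - complex_of_real q \<noteq> 0"
    proof -
      show "complex_of_real q \<noteq> 0" using q by simp
      have "1 / q - q \<noteq> 0" using q by (simp add: field_simps)
      then have "complex_of_real (1 / q - q) \<noteq> 0" by (simp only: of_real_eq_0_iff not_False_eq_True)
      then show "1 / complex_of_real q - complex_of_real q \<noteq> 0" by simp
    qed
    define Q1 Q2 where "Q1 = complex_of_real q" and "Q2 = 1 / complex_of_real q"
    have "(Q1 + Q2) / 2 / ((Q1 - Q2) / (2 * \<i>)) = - \<i> * ((Q2 + Q1) / (Q2 - Q1))"
      using c by (simp add: Q1_def[symmetric] Q2_def[symmetric] divide_simps) (auto simp: algebra_simps)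
    then show ?thesis unfolding cos_exp_eq sin_exp_eq e f(1) E q_def[symmetric] Q1_def Q2_def
      by simp
  qed
  then have dig: "Digamma z - Digamma (1 - z) = \<i> * of_real (pi * E)"
    using Digamma_reflection[OF zI] by (simp add: mult.assoc times_divide_eq_right[symmetric] del: times_divide_eq_right)
  have "(\<lambda>m. (of_real (ln (real m)) - (\<Sum>n<m. inverse (z + of_nat n))) -
             (of_real (ln (real m)) - (\<Sum>n<m. inverse (1 - z + of_nat n)))) \<longlonglongrightarrow> Digamma z - Digamma (1 - z)"
    by (intro tendsto_diff Digamma_LIMSEQ z0)
  moreover have "(of_real (ln (real m)) - (\<Sum>n<m. inverse (z + of_nat n))) -
             (of_real (ln (real m)) - (\<Sum>n<m. inverse (1 - z + of_nat n))) =
       \<i> * of_real pi * of_real (\<Sum>n<m. ?a n) - inverse z + inverse (z + of_nat m)" for m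
  proof (induction m)
    case (Suc m)
    have "inverse (1 - z + of_nat m) - inverse (z + of_nat (Suc m)) = 2 * z / ((of_nat m + 1)\<^sup>2 - z\<^sup>2)"
      using n0[of m] by (simp add: field_simps power2_eq_square)
    also have "(of_nat m + 1)\<^sup>2 - z\<^sup>2 = of_real (real (Suc m) ^ 2 + y\<^sup>2)"
      by (simp add: z_def power_mult_distrib add.commute)
    also have "2 * z / of_real (real (Suc m) ^ 2 + y\<^sup>2) = \<i> * of_real (2 * y / (real (Suc m) ^ 2 + y\<^sup>2))"
      by (simp add: z_def)
    also have "2 * y / (real (Suc m) ^ 2 + y\<^sup>2) = pi * (?a m)"
    proof -
      have "real (Suc m) ^ 2 + y\<^sup>2 = (t\<^sup>2 + 4 * pi\<^sup>2 * real (Suc m) ^ 2) / (4 * pi\<^sup>2)"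
        by (simp add: y_def field_simps)
      then show ?thesis by (simp add: y_def field_simps power2_eq_square del: of_nat_Suc)
    qed
    finally have *: "inverse (1 - z + of_nat m) - inverse (z + of_nat (Suc m)) = \<i> * of_real pi * of_real (?a m)"
      by (simp add: mult.assoc)
    have gen: "(a - (S1 + i1)) - (a - (S2 + i2)) = P + Q - zi + j"
      if "(b - S1) - (b - S2) = P - zi + i1" "i2 - j = Q" for a b S1 S2 i1 i2 P Q zi j :: complex
      using that by algebra
    show ?case unfolding sum.lessThan_Suc of_real_add distrib_left by (rule gen[OF Suc.IH *])
  qed simp
  ultimately have lim: "(\<lambda>m. \<i> * of_real pi * of_real (\<Sum>n<m. ?a n) - inverse z + inverse (z + of_nat m)) \<longlonglongrightarrow> \<i> * of_real (pi * E)"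
    by (simp only: dig)
  have "(\<lambda>m. inverse (z + of_nat m)) \<longlonglongrightarrow> 0"
    by (intro tendsto_inverse_0_at_top filterlim_compose[OF tendsto_inverse_0] tendsto_add_filterlim_at_infinity[OF tendsto_const] tendsto_of_nat)
  from tendsto_add[OF tendsto_diff[OF lim this] tendsto_const[of "inverse z"]]
  have "(\<lambda>m. \<i> * of_real pi * of_real (\<Sum>n<m. ?a n)) \<longlonglongrightarrow> \<i> * of_real (pi * E) + inverse z"
    by simp
  from tendsto_mult[OF tendsto_const[of "- \<i> / of_real pi"] this]
  have "(\<lambda>m. of_real (\<Sum>n<m. ?a n)) \<longlonglongrightarrow> (- \<i> / of_real pi) * (\<i> * of_real (pi * E) + inverse z)"
    by (simp add: mult.assoc [symmetric])
  also have "(- \<i> / of_real pi) * (\<i> * of_real (pi * E) + inverse z) = complex_of_real (E - 2 / t)"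
    using assms by (simp add: z_def y_def field_simps)
  finally have "(\<lambda>m. \<Sum>n<m. ?a n) \<longlonglongrightarrow> E - 2 / t"
    by (simp only: tendsto_of_real_iff)
  then show ?thesis by (simp add: sums_def E_def)
qed

lemma nn_integral_Gamma_scaled:
  fixes a c :: real
  assumes "a > 0" "c > 0"
  shows "(\<integral>\<^sup>+t. ennreal (t powr (a - 1) * exp (- (c * t))) * indicator {0<..} t \<partial>lborel) = ennreal (Gamma a * c powr (- a))"
proof -
  have "ennreal (Gamma a) = (\<integral>\<^sup>+t. ennreal (indicator {0..} t * t powr (a - 1) / exp t) \<partial>lborel)"
    by (rule Gamma_conv_nn_integral_real) fact
  also have "\<dots> = ennreal \<bar>c\<bar> * (\<integral>\<^sup>+t. ennreal (indicator {0..} (0 + c * t) * (0 + c * t) powr (a - 1) / exp (0 + c * t)) \<partial>lborel)"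
    by (rule nn_integral_real_affine) (use assms in auto)
  also have "(\<integral>\<^sup>+t. ennreal (indicator {0..} (0 + c * t) * (0 + c * t) powr (a - 1) / exp (0 + c * t)) \<partial>lborel)
     = (\<integral>\<^sup>+t. ennreal (c powr (a - 1)) * (ennreal (t powr (a - 1) * exp (- (c * t))) * indicator {0<..} t) \<partial>lborel)"
    using assms by (intro nn_integral_cong)
      (auto simp: indicator_def powr_mult exp_minus field_simps zero_le_mult_iff ennreal_mult' [symmetric])
  also have "\<dots> = ennreal (c powr (a - 1)) * (\<integral>\<^sup>+t. ennreal (t powr (a - 1) * exp (- (c * t))) * indicator {0<..} t \<partial>lborel)"
    by (rule nn_integral_cmult) auto
  finally have "ennreal (Gamma a) = ennreal (c powr a) * (\<integral>\<^sup>+t. ennreal (t powr (a - 1) * exp (- (c * t))) * indicator {0<..} t \<partial>lborel)"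
    using assms by (simp add: mult.assoc [symmetric] ennreal_mult' [symmetric] powr_mult_base)
  then have "ennreal (c powr (- a)) * ennreal (Gamma a) = ennreal (c powr (- a)) * ennreal (c powr a) * (\<integral>\<^sup>+t. ennreal (t powr (a - 1) * exp (- (c * t))) * indicator {0<..} t \<partial>lborel)"
    by (simp add: mult.assoc)
  also have "ennreal (c powr (- a)) * ennreal (c powr a) = 1"
    using assms by (simp add: ennreal_mult' [symmetric] powr_add [symmetric])
  finally show ?thesis using assms by (simp add: ennreal_mult' [symmetric] mult.commute)
qed

text \<open>
  The substitution \<open>x = t\<^sup>2\<close> turns this into the Gamma integral with parameter \<open>(s + 1) / 2\<close>.
\<close>
lemma nn_integral_Gamma_square:
  fixes s w :: real
  assumes "s > -1" "w > 0"
  shows "(\<integral>\<^sup>+t. ennreal (t powr s * exp (- (w * t\<^sup>2))) * indicator {0<..} t \<partial>lborel)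
           = ennreal (Gamma ((s + 1) / 2) * w powr (- ((s + 1) / 2)) / 2)"
proof -
  let ?J = "\<integral>\<^sup>+t. ennreal (t powr s * exp (- (w * t\<^sup>2))) * indicator {0<..} t \<partial>lborel"
  define a where "a = (s + 1) / 2"
  have a: "a > 0" using assms by (simp add: a_def)
  define b where "b = Gamma a * w powr (- a)"
  define f where "f = (\<lambda>x::real. x powr (a - 1) * exp (- (w * x)))"
  have b0: "b \<ge> 0" unfolding b_def using a Gamma_real_pos[of a] by simp
  have fint: "((\<lambda>x. f x * indicator {0<..} x) has_integral b) UNIV"
    using nn_integral_Gamma_scaled[OF a assms(2)] b0
    by (intro nn_integral_has_integral) (auto simp: f_def b_def ennreal_mult' ennreal_indicator)
  then have "((\<lambda>x. if x \<in> {0<..} then f x else 0) has_integral b) UNIV"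
    by (rule has_integral_eq[rotated]) auto
  then have "(f has_integral b) {0<..}"
    by (simp only: has_integral_restrict_UNIV)
  then have "f integrable_on {0<..}" "integral {0<..} f = b" by (auto simp: has_integral_iff)
  then have "f absolutely_integrable_on {0<..} \<and> integral {0<..} f = b"
    using nonnegative_absolutely_integrable_1[of f "{0<..}"] by (auto simp: f_def)
  moreover have img: "(\<lambda>t::real. t\<^sup>2) ` {0<..} = {0<..}"
  proof safe
    fix x :: real assume "x > 0"
    then show "x \<in> (\<lambda>t. t\<^sup>2) ` {0<..}" by (intro image_eqI[of _ _ "sqrt x"]) auto
  qed auto
  moreover have "(\<lambda>x. \<bar>2 * x\<bar> * f (x\<^sup>2)) absolutely_integrable_on {0<..} \<and>
      integral {0<..} (\<lambda>x. \<bar>2 * x\<bar> * f (x\<^sup>2)) = b \<longleftrightarrow>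
      f absolutely_integrable_on ((\<lambda>t::real. t\<^sup>2) ` {0<..}) \<and> integral ((\<lambda>t::real. t\<^sup>2) ` {0<..}) f = b"
    by (rule has_absolute_integral_change_of_variables_1')
       (auto intro!: derivative_eq_intros inj_onI simp: power2_eq_iff)
  ultimately have "(\<lambda>x. \<bar>2 * x\<bar> * f (x\<^sup>2)) absolutely_integrable_on {0<..}"
      "integral {0<..} (\<lambda>x. \<bar>2 * x\<bar> * f (x\<^sup>2)) = b" by auto
  then have "((\<lambda>x. \<bar>2 * x\<bar> * f (x\<^sup>2)) has_integral b) {0<..}"
    by (simp add: has_integral_iff absolutely_integrable_on_def)
  from nn_integral_has_integral_lebesgue[OF _ this]
  have "(\<integral>\<^sup>+x. ennreal (indicator {0<..} x * (\<bar>2 * x\<bar> * f (x\<^sup>2))) \<partial>lborel) = b"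
    by (auto simp: f_def)
  also have "(\<integral>\<^sup>+x. ennreal (indicator {0<..} x * (\<bar>2 * x\<bar> * f (x\<^sup>2))) \<partial>lborel) =
     (\<integral>\<^sup>+t. ennreal 2 * (ennreal (t powr s * exp (- (w * t\<^sup>2))) * indicator {0<..} t) \<partial>lborel)"
  proof (rule nn_integral_cong)
    fix t :: real
    show "ennreal (indicator {0<..} t * (\<bar>2 * t\<bar> * f (t\<^sup>2))) = ennreal 2 * (ennreal (t powr s * exp (- (w * t\<^sup>2))) * indicator {0<..} t)"
    proof (cases "t > 0")
      case True
      have "t * (t\<^sup>2) powr (a - 1) = t powr s"
      proof -
        have "(t\<^sup>2) powr (a - 1) = t powr (2 * (a - 1))"
          using True powr_powr[of t 2 "a - 1"] by (simp add: powr_numeral)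
        then have "t * (t\<^sup>2) powr (a - 1) = t powr 1 * t powr (2 * (a - 1))"
          using True by simp
        also have "\<dots> = t powr (1 + 2 * (a - 1))" by (rule powr_add [symmetric])
        also have "1 + 2 * (a - 1) = s" by (simp add: a_def field_simps)
        finally show ?thesis .
      qed
      then have "\<bar>2 * t\<bar> * f (t\<^sup>2) = 2 * (t powr s * exp (- (w * t\<^sup>2)))"
        using True by (simp add: f_def)
      then show ?thesis using True by (simp only: indicator_simps greaterThan_iff ennreal_mult') simp
    qed auto
  qed
  also have "\<dots> = ennreal 2 * ?J"
    by (rule nn_integral_cmult) auto
  finally have e: "ennreal 2 * ?J = ennreal b" .
  have "ennreal (b / 2) = ennreal (1/2) * (ennreal 2 * ?J)"
    unfolding e using b0 by (subst ennreal_mult [symmetric]) simp_all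
  also have "\<dots> = ennreal (1/2 * 2) * ?J"
    unfolding mult.assoc [symmetric] by (subst ennreal_mult) auto
  finally show ?thesis by (simp add: b_def a_def)
qed

text \<open>
  Write \<open>1 / (t\<^sup>2 + c\<^sup>2)\<close> as a Laplace integral in \<open>w\<close> and integrate over \<open>t\<close> first.
\<close>
lemma nn_integral_Mellin_quadratic:
  fixes s c :: real
  assumes "s > -1" "s < 1" "c > 0"
  shows "(\<integral>\<^sup>+t. ennreal (t powr s / (t\<^sup>2 + c\<^sup>2)) * indicator {0<..} t \<partial>lborel)
           = ennreal (Gamma ((1 + s) / 2) * Gamma ((1 - s) / 2) * c powr (s - 1) / 2)"
proof -
  let ?e = "\<lambda>t w. ennreal (t powr s * exp (- ((t\<^sup>2 + c\<^sup>2) * w)))"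
  have inner: "ennreal (t powr s / (t\<^sup>2 + c\<^sup>2)) = (\<integral>\<^sup>+w. ?e t w * indicator {0<..} w \<partial>lborel)" for t
  proof -
    have "t\<^sup>2 + c\<^sup>2 > 0" using assms by (simp add: add_nonneg_pos)
    have "(\<integral>\<^sup>+w. ?e t w * indicator {0<..} w \<partial>lborel) =
       (\<integral>\<^sup>+w. ennreal (t powr s) * (ennreal (w powr (1 - 1) * exp (- ((t\<^sup>2 + c\<^sup>2) * w))) * indicator {0<..} w) \<partial>lborel)"
      by (intro nn_integral_cong) (auto simp: indicator_def ennreal_mult')
    also have "\<dots> = ennreal (t powr s) * (\<integral>\<^sup>+w. (ennreal (w powr (1 - 1) * exp (- ((t\<^sup>2 + c\<^sup>2) * w))) * indicator {0<..} w) \<partial>lborel)"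
      by (rule nn_integral_cmult) auto
    also have "\<dots> = ennreal (t powr s) * ennreal (Gamma 1 * (t\<^sup>2 + c\<^sup>2) powr (- 1))"
      by (subst nn_integral_Gamma_scaled) (use \<open>t\<^sup>2 + c\<^sup>2 > 0\<close> in auto)
    also have "\<dots> = ennreal (t powr s / (t\<^sup>2 + c\<^sup>2))"
      using \<open>t\<^sup>2 + c\<^sup>2 > 0\<close> by (simp add: ennreal_mult' [symmetric] powr_minus divide_inverse)
    finally show ?thesis ..
  qed
  have "(\<integral>\<^sup>+t. ennreal (t powr s / (t\<^sup>2 + c\<^sup>2)) * indicator {0<..} t \<partial>lborel) =
    (\<integral>\<^sup>+t. (\<integral>\<^sup>+w. ?e t w * indicator {0<..} w * indicator {0<..} t \<partial>lborel) \<partial>lborel)"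
    unfolding inner by (intro nn_integral_cong nn_integral_multc [symmetric]) auto
  also have "\<dots> = (\<integral>\<^sup>+w. (\<integral>\<^sup>+t. ?e t w * indicator {0<..} w * indicator {0<..} t \<partial>lborel) \<partial>lborel)"
    by (rule lborel_pair.Fubini') simp
  also have "\<dots> = (\<integral>\<^sup>+w. ennreal (Gamma ((s + 1) / 2) / 2) * (ennreal (w powr ((1 - s) / 2 - 1) * exp (- (c\<^sup>2 * w))) * indicator {0<..} w) \<partial>lborel)"
  proof (rule nn_integral_cong)
    fix w :: real
    show "(\<integral>\<^sup>+t. ?e t w * indicator {0<..} w * indicator {0<..} t \<partial>lborel) =
      ennreal (Gamma ((s + 1) / 2) / 2) * (ennreal (w powr ((1 - s) / 2 - 1) * exp (- (c\<^sup>2 * w))) * indicator {0<..} w)"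
    proof (cases "w > 0")
      case True
      have "(\<integral>\<^sup>+t. ?e t w * indicator {0<..} w * indicator {0<..} t \<partial>lborel) =
        (\<integral>\<^sup>+t. ennreal (exp (- (c\<^sup>2 * w))) * (ennreal (t powr s * exp (- (w * t\<^sup>2))) * indicator {0<..} t) \<partial>lborel)"
        using True by (intro nn_integral_cong)
          (auto simp: indicator_def ennreal_mult' [symmetric] exp_add [symmetric] exp_diff [symmetric] exp_minus [symmetric] algebra_simps
              simp flip: exp_add)
      also have "\<dots> = ennreal (exp (- (c\<^sup>2 * w))) * ennreal (Gamma ((s + 1) / 2) * w powr (- ((s + 1) / 2)) / 2)"
        by (subst nn_integral_cmult) (use True assms in \<open>auto simp: nn_integral_Gamma_square\<close>)
      also have "- ((s + 1) / 2) = (1 - s) / 2 - 1" by (simp add: field_simps)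
      finally show ?thesis using True Gamma_real_pos[of "(s + 1) / 2"] assms
        by (simp add: ennreal_mult' [symmetric] mult_ac)
    qed auto
  qed
  also have "\<dots> = ennreal (Gamma ((s + 1) / 2) / 2) * (\<integral>\<^sup>+w. (ennreal (w powr ((1 - s) / 2 - 1) * exp (- (c\<^sup>2 * w))) * indicator {0<..} w) \<partial>lborel)"
    by (rule nn_integral_cmult) auto
  also have "\<dots> = ennreal (Gamma ((s + 1) / 2) / 2) * ennreal (Gamma ((1 - s) / 2) * (c\<^sup>2) powr (- ((1 - s) / 2)))"
    by (subst nn_integral_Gamma_scaled) (use assms in auto)
  also have "(c\<^sup>2) powr (- ((1 - s) / 2)) = c powr (s - 1)"
  proof -
    have "2 * - ((1 - s) / 2) = s - 1" by (simp add: field_simps)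
    then show ?thesis using assms powr_powr[of c 2 "- ((1 - s) / 2)"] by (simp add: powr_numeral)
  qed
  finally show ?thesis
    using Gamma_real_pos[of "(s + 1) / 2"] assms by (simp add: ennreal_mult' [symmetric] add.commute)
qed

lemma nn_integral_parabola_exp:
  fixes t :: real
  assumes "t > 0"
  shows "(\<integral>\<^sup>+u. ennreal ((u - u\<^sup>2) * exp (- (t * u))) * indicator {0..1} u \<partial>lborel)
     = ennreal ((1 + exp (- t)) / t\<^sup>2 - 2 * (1 - exp (- t)) / t ^ 3)"
proof -
  define F where "F = (\<lambda>u. - exp (- (t * u)) * ((u - u\<^sup>2) / t + (1 - 2 * u) / t\<^sup>2 - 2 / t ^ 3))"
  have deriv: "(F has_real_derivative (u - u\<^sup>2) * exp (- (t * u))) (at u)" for u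
  proof -
    have "(F has_real_derivative
       - (exp (- (t * u)) * (- t)) * ((u - u\<^sup>2) / t + (1 - 2 * u) / t\<^sup>2 - 2 / t ^ 3) + (- exp (- (t * u))) * ((1 - 2 * u) / t + (- 2) / t\<^sup>2)) (at u)"
      unfolding F_def using assms by (auto intro!: derivative_eq_intros simp: power2_eq_square power4_eq_xxxx)
    also have "- (exp (- (t * u)) * (- t)) * ((u - u\<^sup>2) / t + (1 - 2 * u) / t\<^sup>2 - 2 / t ^ 3) + (- exp (- (t * u))) * ((1 - 2 * u) / t + (- 2) / t\<^sup>2) = (u - u\<^sup>2) * exp (- (t * u))"
      using assms by (simp add: field_simps power2_eq_square power3_eq_cube)
    finally show ?thesis .
  qed
  have nonneg: "0 \<le> (u - u\<^sup>2) * exp (- (t * u))" if "0 \<le> u" "u \<le> 1" for u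
    using that by (auto simp: power2_eq_square mult_left_le)
  have "(\<integral>\<^sup>+u. ennreal ((u - u\<^sup>2) * exp (- (t * u))) * indicator {0..1} u \<partial>lborel) = ennreal (F 1 - F 0)"
    by (rule nn_integral_FTC_Icc) (use deriv nonneg in \<open>auto intro: DERIV_subset has_field_derivative_at_within\<close>)
  also have "F 1 - F 0 = (1 + exp (- t)) / t\<^sup>2 - 2 * (1 - exp (- t)) / t ^ 3"
    using assms by (simp add: F_def field_simps power2_eq_square power3_eq_cube power4_eq_xxxx)
  finally show ?thesis .
qed

section \<open>The functional equation\<close>

abbreviation parabola_powr_integral :: "real \<Rightarrow> nat \<Rightarrow> ennreal" where
  "parabola_powr_integral s a \<equiv>
     (\<integral>\<^sup>+u. ennreal ((u - u\<^sup>2) * (real a + u) powr (- s - 2)) * indicator {0..1} u \<partial>lborel)"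

text \<open>
  Expanding \<open>(a + u) powr (- s - 2)\<close> as a Gamma integral exchanges the shift \<open>a\<close> for a power of
  \<open>exp (- t)\<close>, so that the sum over \<open>a\<close> becomes a geometric series.
\<close>
lemma nn_integral_parabola_powr_Gamma:
  fixes s :: real
  assumes "s > -1"
  shows "ennreal (Gamma (s + 2)) * parabola_powr_integral s a
     = (\<integral>\<^sup>+t. ennreal (t powr (s + 1) * exp (- t) ^ a * ((1 + exp (- t)) / t\<^sup>2 - 2 * (1 - exp (- t)) / t ^ 3)) * indicator {0<..} t \<partial>lborel)"
proof -
  let ?e = "\<lambda>u t. ennreal ((u - u\<^sup>2) * (t powr (s + 1) * exp (- ((real a + u) * t)))) * indicator {0<..} t * indicator {0..1} u"
  have G: "Gamma (s + 2) > 0" using assms by (intro Gamma_real_pos) auto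
  have inner: "ennreal (Gamma (s + 2)) * (ennreal ((u - u\<^sup>2) * (real a + u) powr (- s - 2)) * indicator {0..1} u) =
     (\<integral>\<^sup>+t. ?e u t \<partial>lborel)" for u
  proof (cases "0 < u \<and> u \<le> 1")
    case True
    then have u: "u - u\<^sup>2 \<ge> 0" "real a + u > 0" by (auto simp: power2_eq_square mult_left_le)
    have "(\<integral>\<^sup>+t. ?e u t \<partial>lborel)
        = (\<integral>\<^sup>+t. ennreal (u - u\<^sup>2) * (ennreal (t powr ((s + 2) - 1) * exp (- ((real a + u) * t))) * indicator {0<..} t) \<partial>lborel)"
      using True u by (intro nn_integral_cong) (auto simp: indicator_def ennreal_mult' add.commute[of 1 s])
    also have "\<dots> = ennreal (u - u\<^sup>2) * ennreal (Gamma (s + 2) * (real a + u) powr (- (s + 2)))"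
      using assms u by (subst nn_integral_cmult) (insert assms u, use nn_integral_Gamma_scaled[of "s + 2" "real a + u"] in auto)
    also have "\<dots> = ennreal (Gamma (s + 2)) * (ennreal ((u - u\<^sup>2) * (real a + u) powr (- s - 2)) * indicator {0..1} u)"
      using True u G by (simp add: ennreal_mult' [symmetric] mult_ac)
    finally show ?thesis ..
  next
    case False
    then show ?thesis by (cases "u = 0") (auto simp: indicator_def)
  qed
  have "ennreal (Gamma (s + 2)) * parabola_powr_integral s a
     = (\<integral>\<^sup>+u. ennreal (Gamma (s + 2)) * (ennreal ((u - u\<^sup>2) * (real a + u) powr (- s - 2)) * indicator {0..1} u) \<partial>lborel)"
    by (rule nn_integral_cmult [symmetric]) auto
  also have "\<dots> = (\<integral>\<^sup>+t. (\<integral>\<^sup>+u. ?e u t \<partial>lborel) \<partial>lborel)"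
    unfolding inner by (rule lborel_pair.Fubini') simp
  also have "\<dots> = (\<integral>\<^sup>+t. ennreal (t powr (s + 1) * exp (- t) ^ a * ((1 + exp (- t)) / t\<^sup>2 - 2 * (1 - exp (- t)) / t ^ 3)) * indicator {0<..} t \<partial>lborel)"
  proof (rule nn_integral_cong)
    fix t :: real
    show "(\<integral>\<^sup>+u. ?e u t \<partial>lborel) =
      ennreal (t powr (s + 1) * exp (- t) ^ a * ((1 + exp (- t)) / t\<^sup>2 - 2 * (1 - exp (- t)) / t ^ 3)) * indicator {0<..} t"
    proof (cases "t > 0")
      case True
      have "exp (- ((real a + u) * t)) = exp (- t) ^ a * exp (- (t * u))" for u
        by (simp add: exp_of_nat_mult [symmetric] exp_add [symmetric] algebra_simps)
      then have "(\<integral>\<^sup>+u. ?e u t \<partial>lborel)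
        = (\<integral>\<^sup>+u. ennreal (t powr (s + 1) * exp (- t) ^ a) * (ennreal ((u - u\<^sup>2) * exp (- (t * u))) * indicator {0..1} u) \<partial>lborel)"
        using True by (intro nn_integral_cong) (auto simp: indicator_def ennreal_mult' [symmetric] mult_ac)
      also have "\<dots> = ennreal (t powr (s + 1) * exp (- t) ^ a) * ennreal ((1 + exp (- t)) / t\<^sup>2 - 2 * (1 - exp (- t)) / t ^ 3)"
        by (subst nn_integral_cmult) (use True in \<open>auto simp: nn_integral_parabola_exp\<close>)
      finally show ?thesis using True by (simp add: ennreal_mult' [symmetric])
    qed auto
  qed
  finally show ?thesis .
qed

text \<open>
  The real form of the functional equation: the left side is the zeta-function at \<open>s\<close> and the right side
  the one at \<open>1 - s\<close>, up to elementary factors.  For real \<open>s\<close> in \<open>(-1, 0)\<close> every integrand is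
  nonnegative, so all exchanges of sums and integrals are free.
\<close>
lemma suminf_parabola_powr_ennreal:
  fixes s :: real
  assumes "s > -1" "s < 0"
  shows "(\<Sum>a. ennreal (Gamma (s + 2)) * parabola_powr_integral s a)
     = (\<Sum>n. ennreal (2 * Gamma ((1 + s) / 2) * Gamma ((1 - s) / 2) * (2 * pi * real (Suc n)) powr (s - 1)))"
proof -
  define k where "k = (\<lambda>t::real. (1 + exp (- t)) / t\<^sup>2 - 2 * (1 - exp (- t)) / t ^ 3)"
  define c where "c = (\<lambda>n. 2 * pi * real (Suc n))"
  have c: "c n > 0" for n by (simp add: c_def)
  have "(\<Sum>a. ennreal (Gamma (s + 2)) * parabola_powr_integral s a)
     = (\<Sum>a. \<integral>\<^sup>+t. ennreal (t powr (s + 1) * exp (- t) ^ a * k t) * indicator {0<..} t \<partial>lborel)"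
    unfolding k_def by (simp only: nn_integral_parabola_powr_Gamma[OF assms(1)])
  also have "\<dots> = (\<integral>\<^sup>+t. (\<Sum>a. ennreal (t powr (s + 1) * exp (- t) ^ a * k t) * indicator {0<..} t) \<partial>lborel)"
    by (rule nn_integral_suminf [symmetric]) (simp add: k_def)
  also have "\<dots> = (\<integral>\<^sup>+t. (\<Sum>n. ennreal 4 * (ennreal (t powr s / (t\<^sup>2 + (c n)\<^sup>2)) * indicator {0<..} t)) \<partial>lborel)"
  proof (rule nn_integral_cong)
    fix t :: real
    show "(\<Sum>a. ennreal (t powr (s + 1) * exp (- t) ^ a * k t) * indicator {0<..} t) =
       (\<Sum>n. ennreal 4 * (ennreal (t powr s / (t\<^sup>2 + (c n)\<^sup>2)) * indicator {0<..} t))"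
    proof (cases "t > 0")
      case True
      have e: "exp (- t) < 1" "1 - exp (- t) > 0" using True by auto
      have pf: "(\<lambda>n. t powr s / (4 * t) * 4 * (4 * t / (t\<^sup>2 + 4 * pi\<^sup>2 * real (Suc n) ^ 2))) sums (t powr s / (4 * t) * 4 * ((1 + exp (- t)) / (1 - exp (- t)) - 2 / t))"
        by (intro sums_mult coth_partial_fractions True)
      have "t powr s / (4 * t) * 4 * (4 * t / (t\<^sup>2 + 4 * pi\<^sup>2 * real (Suc n) ^ 2)) = 4 * (t powr s / (t\<^sup>2 + (c n)\<^sup>2))" for n
        using True by (simp add: c_def power_mult_distrib)
      moreover have "t powr s / (4 * t) * 4 * ((1 + exp (- t)) / (1 - exp (- t)) - 2 / t) = t powr (s + 1) * k t * (1 / (1 - exp (- t)))"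
      proof -
        have "t powr (s + 1) = t powr s * t" using True by (simp add: powr_add)
        moreover have "1 / t * (A / B - 2 / t) = t * (A / t\<^sup>2 - 2 * B / t ^ 3) * (1 / B)" if "B > 0" for A B
          using True that by (simp add: field_simps power2_eq_square power3_eq_cube)
        from this[OF e(2), of "1 + exp (- t)"] have "1 / t * ((1 + exp (- t)) / (1 - exp (- t)) - 2 / t) = t * k t * (1 / (1 - exp (- t)))"
          by (simp only: k_def)
        moreover have "t powr s / (4 * t) * 4 * D = t powr s * (1 / t * D)" for D
          using True by simp
        ultimately show ?thesis by (simp only: mult.assoc)
      qed
      ultimately have s1: "(\<lambda>n. 4 * (t powr s / (t\<^sup>2 + (c n)\<^sup>2))) sums (t powr (s + 1) * k t * (1 / (1 - exp (- t))))"
        using pf by (simp only:)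
      have "(\<lambda>a. t powr (s + 1) * k t * exp (- t) ^ a) sums (t powr (s + 1) * k t * (1 / (1 - exp (- t))))"
        by (intro sums_mult geometric_sums) (use e in auto)
      then have s2: "(\<lambda>a. t powr (s + 1) * exp (- t) ^ a * k t) sums (t powr (s + 1) * k t * (1 / (1 - exp (- t))))"
        by (simp add: mult_ac)
      have "t powr (s + 1) * k t * (1 / (1 - exp (- t))) \<ge> 0"
        by (rule sums_le[OF _ sums_zero s1]) simp
      then have k0: "k t \<ge> 0" using True e by (simp add: zero_le_divide_iff zero_le_mult_iff)
      have "(\<Sum>a. ennreal (t powr (s + 1) * exp (- t) ^ a * k t)) = ennreal (t powr (s + 1) * k t * (1 / (1 - exp (- t))))"
        using s2 k0 by (intro suminf_ennreal_eq) auto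
      also have "\<dots> = (\<Sum>n. ennreal (4 * (t powr s / (t\<^sup>2 + (c n)\<^sup>2))))"
        using s1 by (intro suminf_ennreal_eq [symmetric]) auto
      finally have sums_eq: "(\<Sum>a. ennreal (t powr (s + 1) * exp (- t) ^ a * k t)) = (\<Sum>n. ennreal (4 * (t powr s / (t\<^sup>2 + (c n)\<^sup>2))))" .
      have l: "ennreal (t powr (s + 1) * exp (- t) ^ a * k t) * indicator {0<..} t = ennreal (t powr (s + 1) * exp (- t) ^ a * k t)" for a
        using True by simp
      have r: "ennreal 4 * (ennreal (t powr s / (t\<^sup>2 + (c n)\<^sup>2)) * indicator {0<..} t) = ennreal (4 * (t powr s / (t\<^sup>2 + (c n)\<^sup>2)))" for n
        using True by (subst ennreal_mult) auto
      show ?thesis unfolding l r by (rule sums_eq)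
    qed auto
  qed
  also have "\<dots> = (\<Sum>n. \<integral>\<^sup>+t. ennreal 4 * (ennreal (t powr s / (t\<^sup>2 + (c n)\<^sup>2)) * indicator {0<..} t) \<partial>lborel)"
    by (rule nn_integral_suminf) simp
  also have "\<dots> = (\<Sum>n. ennreal 4 * ennreal (Gamma ((1 + s) / 2) * Gamma ((1 - s) / 2) * c n powr (s - 1) / 2))"
    by (subst nn_integral_cmult) (use assms c in \<open>auto simp: nn_integral_Mellin_quadratic\<close>)
  also have "\<dots> = (\<Sum>n. ennreal (2 * Gamma ((1 + s) / 2) * Gamma ((1 - s) / 2) * c n powr (s - 1)))"
    by (simp add: ennreal_mult' [symmetric] mult_ac flip: ennreal_numeral)
  finally show ?thesis by (simp only: c_def)
qed


text \<open>
  For \<open>a \<ge> 1\<close> these are the trapezoid corrections up to a factor; the value at \<open>a = 0\<close> is exactly what absorbs the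
  elementary part \<open>(s - 1) / 2 + 1\<close> of \<^const>\<open>zeta_entire\<close> when \<open>-1 < s < 0\<close>.
\<close>
lemma parabola_powr_has_integral:
  fixes s :: real
  assumes "s > -1" "s < 0"
  shows "((\<lambda>u. (u - u\<^sup>2) * (real a + u) powr (- s - 2)) has_integral
     (if a = 0 then - 1 / (s * (1 - s)) else 2 * Re (em_term a (of_real s)) / ((s - 1) * s * (s + 1)))) {0..1}"
proof (cases "a = 0")
  case True
  have "((\<lambda>u. u powr (- s - 1) - u powr (- s)) has_integral (1 powr (- s - 1 + 1) / (- s - 1 + 1) - 1 powr (- s + 1) / (- s + 1))) {0..1::real}"
    by (intro has_integral_diff has_integral_powr_from_0) (use assms in auto)
  also have "1 powr (- s - 1 + 1) / (- s - 1 + 1) - 1 powr (- s + 1) / (- s + 1) = - 1 / (s * (1 - s))"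
    using assms by (simp add: field_simps)
  finally have I: "((\<lambda>u. u powr (- s - 1) - u powr (- s)) has_integral - 1 / (s * (1 - s))) {0..1}" .
  have eq: "u powr (- s - 1) - u powr (- s) = (u - u\<^sup>2) * (real a + u) powr (- s - 2)" if "u \<in> {0..1}" for u
  proof (cases "u = 0")
    case False
    then have u: "u > 0" using that by auto
    have "u powr (- s - 1) = u powr 1 * u powr (- s - 2)" "u powr (- s) = u powr 2 * u powr (- s - 2)"
      unfolding powr_add [symmetric] by (rule arg_cong[of _ _ "\<lambda>x. u powr x"], simp)+
    then show ?thesis using u True by (simp add: powr_numeral algebra_simps)
  qed simp
  from has_integral_eq[OF eq I] show ?thesis using True by simp
next
  case False
  define c where "c = (s - 1) * s * (s + 1) / 2"
  have c: "c \<noteq> 0" using assms by (auto simp: c_def)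
  have "((\<lambda>u. Re ((of_real s - 1) * of_real s * (of_real s + 1) / 2 * of_real (u - u\<^sup>2) * (of_nat a + of_real u) powr (- of_real s - 2)))
           has_integral Re (em_term a (of_real s))) {0..1}"
    using has_integral_linear[OF em_term_has_integral[of a "of_real s"] bounded_linear_Re] False by (simp add: o_def)
  moreover have "Re ((of_real s - 1) * of_real s * (of_real s + 1) / 2 * of_real (u - u\<^sup>2) * (of_nat a + of_real u) powr (- of_real s - 2))
     = c * ((u - u\<^sup>2) * (real a + u) powr (- s - 2))" if "u \<in> {0..1}" for u
  proof -
    have "(of_nat a + of_real u) powr (- of_real s - 2) = complex_of_real ((real a + u) powr (- s - 2))"
      using that by (subst powr_of_real [symmetric]) auto
    then have "(of_real s - 1) * of_real s * (of_real s + 1) / 2 * of_real (u - u\<^sup>2) * (of_nat a + of_real u) powr (- of_real s - 2)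
      = complex_of_real (c * ((u - u\<^sup>2) * (real a + u) powr (- s - 2)))"
      by (simp add: c_def)
    then show ?thesis by (simp only: Re_complex_of_real)
  qed
  ultimately have "((\<lambda>u. c * ((u - u\<^sup>2) * (real a + u) powr (- s - 2))) has_integral Re (em_term a (of_real s))) {0..1}"
    by (subst (asm) has_integral_cong) auto
  from has_integral_mult_right[OF this, of "1 / c"] c
  show ?thesis using False by (simp add: c_def)
qed

lemma Im_em_term_of_real: "Im (em_term a (of_real s)) = 0"
proof -
  have "em_term a (of_real s) \<in> \<real>"
    unfolding em_term_def by (intro Reals_diff Reals_mult Reals_divide Reals_add Reals_powr) auto
  then show ?thesis by (simp add: complex_is_Real_iff)
qed

lemma zeta_entire_reflection_real:
  fixes s :: real
  assumes s: "s > -1" "s < 0"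
  shows "zeta_entire (of_real s) * of_real (Gamma (s + 2)) =
    of_real ((1 - s) * (s + 1) * Gamma ((1 + s) / 2) * Gamma ((1 - s) / 2) * (2 * pi) powr (s - 1)) * zeta_entire (1 - of_real s)"
proof -
  define c where "c = (s - 1) * s * (s + 1) / 2"
  have c: "c \<noteq> 0" using s by (auto simp: c_def)
  define r where "r = (\<lambda>a. if a = 0 then - 1 / (s * (1 - s)) else 2 * Re (em_term a (of_real s)) / ((s - 1) * s * (s + 1)))"
  define G where "G = Gamma (s + 2)"
  have G: "G > 0" unfolding G_def using s by (intro Gamma_real_pos) auto
  have r_int: "((\<lambda>u. (u - u\<^sup>2) * (real a + u) powr (- s - 2)) has_integral r a) {0..1}" for a
    unfolding r_def by (rule parabola_powr_has_integral[OF s])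
  have nonneg: "0 \<le> (u - u\<^sup>2) * (real a + u) powr (- s - 2)" if "u \<in> {0..1}" for u a
    using that by (auto simp: power2_eq_square mult_left_le)
  have r0: "r a \<ge> 0" for a by (rule has_integral_nonneg[OF r_int nonneg])
  have r_nn: "parabola_powr_integral s a = ennreal (r a)" for a
  proof -
    have "(\<integral>\<^sup>+u. ennreal (indicator {0..1} u * ((u - u\<^sup>2) * (real a + u) powr (- s - 2))) \<partial>lborel) = ennreal (r a)"
      by (rule nn_integral_has_integral_lebesgue[OF nonneg r_int])
    moreover have "ennreal (indicator {0..1} u * ((u - u\<^sup>2) * (real a + u) powr (- s - 2))) = ennreal ((u - u\<^sup>2) * (real a + u) powr (- s - 2)) * indicator {0..1} u" for u
      by (auto simp: indicator_def)
    ultimately show ?thesis by simp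
  qed
  define A where "A = 2 * Gamma ((1 + s) / 2) * Gamma ((1 - s) / 2) * (2 * pi) powr (s - 1)"
  have "Gamma ((1 + s) / 2) > 0" "Gamma ((1 - s) / 2) > 0" using s by (auto intro!: Gamma_real_pos)
  then have A: "A \<ge> 0" by (simp add: A_def)
  define q where "q = (\<lambda>n. A * real (Suc n) powr (- (1 - s)))"
  have q: "summable q" unfolding q_def by (intro summable_mult summable_Suc_powr) (use s in auto)
  have q0: "q n \<ge> 0" for n using A by (simp add: q_def)
  have "(\<Sum>a. ennreal (G * r a)) = (\<Sum>n. ennreal (q n))"
  proof -
    have "2 * Gamma ((1 + s) / 2) * Gamma ((1 - s) / 2) * (2 * pi * real (Suc n)) powr (s - 1) = q n" for n
      by (simp add: q_def A_def powr_mult)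
    then show ?thesis
      using suminf_parabola_powr_ennreal[OF s] G r0 unfolding r_nn G_def by (simp add: ennreal_mult')
  qed
  also have "\<dots> = ennreal (\<Sum>n. q n)" using q q0 by (intro suminf_ennreal2) auto
  finally have e: "(\<Sum>a. ennreal (G * r a)) = ennreal (\<Sum>n. q n)" .
  have sm: "summable (\<lambda>a. G * r a)"
    using e G r0 by (intro summable_suminf_not_top) auto
  then have smr: "summable r" using G by (subst (asm) summable_cmult_iff) auto
  have "ennreal (\<Sum>a. G * r a) = ennreal (\<Sum>n. q n)"
    using e G r0 sm by (subst (asm) suminf_ennreal2) auto
  then have e2: "G * (\<Sum>a. r a) = (\<Sum>n. q n)"
    using G r0 q0 q smr sm suminf_nonneg[OF smr r0] by (subst (asm) ennreal_inj) (auto intro!: suminf_nonneg simp: suminf_mult)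
  have em: "em_term (Suc a) (of_real s) = of_real (c * r (Suc a))" for a
    using c Im_em_term_of_real[of "Suc a" s] by (simp add: r_def c_def complex_eq_iff)
  have "zeta_entire (of_real s) = of_real ((s - 1) / 2 + 1 + c * (\<Sum>a. r (Suc a)))"
    unfolding zeta_entire_def em using smr
    by (subst suminf_of_real [symmetric]) (auto simp: suminf_mult summable_Suc_iff)
  also have "(\<Sum>a. r (Suc a)) = (\<Sum>a. r a) + 1 / (s * (1 - s))"
    using suminf_split_head[OF smr] by (simp add: r_def)
  also have "(s - 1) / 2 + 1 + c * ((\<Sum>a. r a) + 1 / (s * (1 - s))) = c * (\<Sum>a. r a)"
  proof -
    have "c * (1 / (s * (1 - s))) = - ((s + 1) / 2)" using s by (simp add: c_def field_simps)
    then show ?thesis by (simp add: distrib_left add_divide_distrib diff_divide_distrib)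
  qed
  finally have z1: "zeta_entire (of_real s) * of_real G = of_real (c * (\<Sum>n. q n))"
    unfolding e2 [symmetric] by (simp add: mult_ac)
  have "(\<lambda>n. of_nat (Suc n) powr (- (1 - of_real s))) sums (zeta_entire (1 - of_real s) / (1 - of_real s - 1))"
    by (rule zeta_entire_sums) (use s in auto)
  moreover have "of_nat (Suc n) powr (- (1 - of_real s)) = complex_of_real (real (Suc n) powr (- (1 - s)))" for n
    by (subst powr_of_real [symmetric]) auto
  ultimately have "(\<lambda>n. complex_of_real (real (Suc n) powr (- (1 - s)))) sums (zeta_entire (1 - of_real s) / - of_real s)"
    by simp
  from sums_mult[OF this, of "of_real A"]
  have "(\<lambda>n. complex_of_real (q n)) sums (of_real A * (zeta_entire (1 - of_real s) / - of_real s))"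
    by (simp add: q_def)
  moreover have "(\<lambda>n. complex_of_real (q n)) sums of_real (\<Sum>n. q n)"
    using q by (intro sums_of_real summable_sums)
  ultimately have z2: "complex_of_real (\<Sum>n. q n) = of_real A * (zeta_entire (1 - of_real s) / - of_real s)"
    using sums_unique2 by blast
  have "zeta_entire (of_real s) * of_real G = of_real c * (of_real A * (zeta_entire (1 - of_real s) / - of_real s))"
    using z1 z2 by simp
  also have "\<dots> = of_real (c * A / (- s)) * zeta_entire (1 - of_real s)" by simp
  also have "c * A / (- s) = (1 - s) * (s + 1) * Gamma ((1 + s) / 2) * Gamma ((1 - s) / 2) * (2 * pi) powr (s - 1)"
    using s by (simp add: c_def A_def divide_simps) algebra
  finally show ?thesis by (simp only: G_def)
qed

text \<open>
  Using \<^const>\<open>rGamma\<close> keeps the factor holomorphic where the Gamma function in the denominator has poles;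
  among its zeros there are the trivial zeros of the zeta-function.
\<close>
definition zeta_chi :: "complex \<Rightarrow> complex" where
  "zeta_chi s = of_real pi powr (s - 1 / 2) * Gamma ((1 - s) / 2) * rGamma (s / 2)"

lemma Re_pos_imp_notin_nonpos_Ints:
  fixes z :: complex
  assumes "Re z > 0"
  shows "z \<notin> \<int>\<^sub>\<le>\<^sub>0"
proof
  assume "z \<in> \<int>\<^sub>\<le>\<^sub>0"
  then obtain n where "z = - of_nat n" by (auto elim!: nonpos_Ints_cases')
  then show False using assms by simp
qed

lemma Gamma_duplication_real:
  fixes s :: real
  assumes "s > -1" "s < 0"
  shows "Gamma (s / 2) * Gamma ((s + 1) / 2) = 2 powr (1 - s) * sqrt pi * Gamma s"
proof -
  have n: "complex_of_real (s / 2) \<notin> \<int>\<^sub>\<le>\<^sub>0" "complex_of_real (s / 2) + 1 / 2 \<notin> \<int>\<^sub>\<le>\<^sub>0"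
  proof -
    show "complex_of_real (s / 2) \<notin> \<int>\<^sub>\<le>\<^sub>0"
    proof
      assume "complex_of_real (s / 2) \<in> \<int>\<^sub>\<le>\<^sub>0"
      then obtain m where "complex_of_real (s / 2) = - of_nat m" by (auto elim!: nonpos_Ints_cases')
      then have "s / 2 = - real m" by (metis of_real_eq_iff of_real_minus of_real_of_nat_eq)
      then show False using assms by (cases m) auto
    qed
    show "complex_of_real (s / 2) + 1 / 2 \<notin> \<int>\<^sub>\<le>\<^sub>0"
      by (rule Re_pos_imp_notin_nonpos_Ints) (use assms in simp)
  qed
  from Gamma_legendre_duplication[OF n]
  have "complex_of_real (Gamma (s / 2) * Gamma ((s + 1) / 2)) = complex_of_real (exp ((1 - s) * ln 2) * sqrt pi * Gamma s)"
    by (simp add: Gamma_complex_of_real [symmetric] add_divide_distrib exp_of_real [symmetric])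
  then show ?thesis by (simp only: of_real_eq_iff) (simp add: powr_def)
qed

text \<open>
  The real segment \<open>(-1, 0)\<close>, where Legendre duplication turns the identity into this symmetric shape,
  has accumulation points in the strip, so the identity spreads to the whole strip.
\<close>
lemma zeta_entire_functional_equation:
  assumes "-1 < Re s" "Re s < 1"
  shows "s * zeta_entire s = (1 - s) * zeta_chi s * zeta_entire (1 - s)"
proof -
  define S where "S = {s. -1 < Re s \<and> Re s < 1}"
  define f where "f = (\<lambda>s. s * zeta_entire s - (1 - s) * zeta_chi s * zeta_entire (1 - s))"
  have S_eq: "S = {s. -1 < Re s} \<inter> {s. Re s < 1}" by (auto simp: S_def)
  have real: "f (of_real x) = 0" if x: "x \<in> {-1<..<0}" for x
  proof -
    have x': "-1 < x" "x < 0" using x by auto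
    have G0: "Gamma ((x + 1) / 2) > 0" using x' by (intro Gamma_real_pos) auto
    have "x \<notin> \<int>\<^sub>\<le>\<^sub>0" "x / 2 \<notin> \<int>\<^sub>\<le>\<^sub>0"
    proof -
      show "x \<notin> \<int>\<^sub>\<le>\<^sub>0"
      proof
        assume "x \<in> \<int>\<^sub>\<le>\<^sub>0"
        then obtain m where "x = - real m" by (auto elim!: nonpos_Ints_cases')
        then show False using x' by (cases m) auto
      qed
      show "x / 2 \<notin> \<int>\<^sub>\<le>\<^sub>0"
      proof
        assume "x / 2 \<in> \<int>\<^sub>\<le>\<^sub>0"
        then obtain m where "x / 2 = - real m" by (auto elim!: nonpos_Ints_cases')
        then show False using x' by (cases m) auto
      qed
    qed
    then have xn: "x \<notin> \<int>\<^sub>\<le>\<^sub>0" "x / 2 \<notin> \<int>\<^sub>\<le>\<^sub>0" by auto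
    then have "Gamma (x / 2) \<noteq> 0" by (simp add: Gamma_eq_zero_iff)
    then have rG: "rGamma (x / 2) * Gamma (x / 2) = 1" by (simp add: rGamma_inverse_Gamma)
    have "x + 1 \<notin> \<int>\<^sub>\<le>\<^sub>0" using x' by (auto elim!: nonpos_Ints_cases')
    from Gamma_plus1[OF this] Gamma_plus1[OF xn(1)]
    have G2: "Gamma (x + 2) = (x + 1) * x * Gamma x" by (simp add: add.assoc)
    have p: "(2 * pi) powr (x - 1) * 2 powr (1 - x) * sqrt pi = pi powr (x - 1 / 2)"
    proof -
      have "(2 * pi) powr (x - 1) = 2 powr (x - 1) * pi powr (x - 1)" by (simp add: powr_mult)
      moreover have "2 powr (x - 1) * 2 powr (1 - x) = (1::real)" by (simp add: powr_add [symmetric])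
      moreover have "pi powr (x - 1) * sqrt pi = pi powr (x - 1 / 2)"
        by (simp add: powr_half_sqrt [symmetric] powr_add [symmetric])
      ultimately show ?thesis by (metis (no_types, opaque_lifting) mult.assoc mult.commute mult_1)
    qed
    define Z1 Z2 where "Z1 = zeta_entire (of_real x)" and "Z2 = zeta_entire (1 - of_real x)"
    define g where "g = Gamma ((x + 1) / 2)"
    define H where "H = Gamma ((1 - x) / 2)"
    define e where "e = rGamma (x / 2)"
    have dup: "e * (2 powr (1 - x) * sqrt pi * Gamma x) = g"
      unfolding Gamma_duplication_real[OF x', symmetric] mult.assoc [symmetric] e_def rG g_def by simp
    have "Z1 * of_real (Gamma (x + 2)) = of_real ((1 - x) * (x + 1) * g * H * (2 * pi) powr (x - 1)) * Z2"
      using zeta_entire_reflection_real[OF x'] by (simp only: Z1_def Z2_def g_def H_def add.commute)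
    also have "(1 - x) * (x + 1) * g * H * (2 * pi) powr (x - 1) = (1 - x) * (x + 1) * H * e * Gamma x * pi powr (x - 1 / 2)"
      unfolding dup [symmetric] p [symmetric] by (simp add: mult_ac)
    finally have "Z1 * of_real ((x + 1) * x * Gamma x) = of_real ((x + 1) * Gamma x) * of_real ((1 - x) * H * e * pi powr (x - 1 / 2)) * Z2"
      unfolding G2 by (simp add: mult_ac)
    moreover have "complex_of_real ((x + 1) * Gamma x) \<noteq> 0"
    proof -
      have "Gamma x \<noteq> 0" using dup G0 by (auto simp: g_def)
      then show ?thesis using x' by (simp only: of_real_eq_0_iff) simp
    qed
    ultimately have "of_real ((x + 1) * Gamma x) * (Z1 * of_real x) = of_real ((x + 1) * Gamma x) * (of_real ((1 - x) * H * e * pi powr (x - 1 / 2)) * Z2)"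
      by (simp add: mult_ac)
    then have "Z1 * of_real x = of_real ((1 - x) * H * e * pi powr (x - 1 / 2)) * Z2"
      using \<open>complex_of_real ((x + 1) * Gamma x) \<noteq> 0\<close> by (subst (asm) mult_cancel_left) auto
    moreover have "zeta_chi (of_real x) = of_real (pi powr (x - 1 / 2) * H * e)"
    proof -
      have "of_real pi powr (of_real x - 1 / 2) = complex_of_real (pi powr (x - 1 / 2))"
        by (subst powr_of_real [symmetric]) auto
      moreover have "Gamma ((1 - of_real x) / 2) = complex_of_real H"
        unfolding H_def Gamma_complex_of_real [symmetric] by simp
      moreover have "rGamma (of_real x / 2) = complex_of_real e"
        unfolding e_def rGamma_complex_of_real [symmetric] by simp
      ultimately show ?thesis by (simp add: zeta_chi_def)
    qed
    ultimately show ?thesis by (simp add: f_def Z1_def Z2_def mult_ac)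
  qed
  have holo: "f holomorphic_on S"
  proof -
    have "zeta_entire holomorphic_on S"
      by (rule holomorphic_on_subset[OF holomorphic_zeta_entire]) (auto simp: S_def)
    moreover have "(zeta_entire \<circ> (\<lambda>s. 1 - s)) holomorphic_on S"
      by (rule holomorphic_on_compose_gen[OF _ holomorphic_zeta_entire]) (auto simp: S_def intro!: holomorphic_intros)
    moreover have "zeta_chi holomorphic_on S"
      unfolding zeta_chi_def [abs_def]
      by (intro holomorphic_intros) (auto simp: S_def intro!: Re_pos_imp_notin_nonpos_Ints)
    ultimately show ?thesis unfolding f_def o_def by (intro holomorphic_intros)
  qed
  have "f s = 0"
  proof (rule analytic_continuation[OF holo])
    show "open S" unfolding S_eq by (intro open_Int open_halfspace_Re_gt open_halfspace_Re_lt)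
    have "convex S" unfolding S_eq by (intro convex_Int convex_halfspace_Re_gt convex_halfspace_Re_lt)
    then show "connected S" by (rule convex_connected)
    show "of_real ` {-1<..<0::real} \<subseteq> S" by (auto simp: S_def)
    show "of_real (- 1 / 2) \<in> S" by (simp add: S_def)
    have "(- 1 / 2 :: real) islimpt {-1<..<0}" by (intro open_imp_islimpt) auto
    then show "complex_of_real (- 1 / 2) islimpt of_real ` {-1<..<0}"
      by (rule islimpt_isCont_image) (auto intro!: continuous_intros always_eventually simp: eventually_at_filter complex_eq_iff)
    show "f z = 0" if "z \<in> of_real ` {-1<..<0::real}" for z using real that by auto
    show "s \<in> S" using assms by (simp add: S_def)
  qed
  then show ?thesis by (simp add: f_def)
qed

section \<open>The zeta-function on the punctured plane\<close>

lemma zeta_conditions_unique: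
  assumes f: "f holomorphic_on - {1}" "\<And>s. Re s > 1 \<Longrightarrow> (\<lambda>n. of_nat (Suc n) powr (- s)) sums f s" "f 1 = 0"
      and g: "g holomorphic_on - {1}" "\<And>s. Re s > 1 \<Longrightarrow> (\<lambda>n. of_nat (Suc n) powr (- s)) sums g s" "g 1 = (0::complex)"
  shows "f = g"
proof
  fix s
  show "f s = g s"
  proof (cases "s = 1")
    case False
    have "f s - g s = 0"
    proof (rule analytic_continuation[where f = "\<lambda>s. f s - g s" and S = "- {1}" and U = "{s. Re s > 1}" and \<xi> = 2])
      show "(\<lambda>s. f s - g s) holomorphic_on - {1}" by (intro holomorphic_intros f g)
      show "connected (- {1::complex})" by (rule connected_punctured_universe) simp
      show "{s. Re s > 1} \<subseteq> - {1}" by auto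
      show "2 \<in> - {1::complex}" by simp
      show "2 islimpt {s. Re s > 1}"
        by (rule open_imp_islimpt) (auto simp: open_halfspace_Re_gt)
      show "f z - g z = 0" if "z \<in> {s. Re s > 1}" for z
        using that sums_unique2[OF f(2) g(2), of z] by simp
    qed (use False in auto)
    then show ?thesis by simp
  qed (use f g in simp)
qed

text \<open>
  The half-plane \<open>Re s > -1\<close> is covered by the trapezoid series; the functional equation serves as
  the definition further left, and both descriptions agree on the strip \<open>-1 < Re s < 0\<close>.
\<close>
definition zeta_glued :: "complex \<Rightarrow> complex" where
  "zeta_glued s = (if s = 1 then 0 else if Re s > -1 then zeta_entire s / (s - 1)
     else zeta_chi s * zeta_entire (1 - s) / (- s))"

lemma zeta_glued_left:
  assumes "Re s < 0"
  shows "zeta_glued s = zeta_chi s * zeta_entire (1 - s) / (- s)"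
proof (cases "Re s > -1")
  case True
  have "s \<noteq> 0" "s - 1 \<noteq> 0" "s \<noteq> 1" using assms by auto
  moreover have "s * zeta_entire s = (1 - s) * zeta_chi s * zeta_entire (1 - s)"
    by (rule zeta_entire_functional_equation) (use assms True in auto)
  ultimately show ?thesis using True by (simp add: zeta_glued_def divide_simps) algebra
next
  case False
  then show ?thesis using assms by (auto simp: zeta_glued_def)
qed

lemma holomorphic_zeta_glued: "zeta_glued holomorphic_on - {1}"
proof -
  define A where "A = {s. Re s > -1} - {1}"
  define B where "B = {s. Re s < 0}"
  have "(\<lambda>s. zeta_entire s / (s - 1)) holomorphic_on A"
    by (intro holomorphic_intros holomorphic_on_subset[OF holomorphic_zeta_entire]) (auto simp: A_def)
  then have A: "zeta_glued holomorphic_on A"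
    by (rule holomorphic_transform) (auto simp: A_def zeta_glued_def)
  have "(zeta_entire \<circ> (\<lambda>s. 1 - s)) holomorphic_on B"
    by (rule holomorphic_on_compose_gen[OF _ holomorphic_zeta_entire]) (auto simp: B_def intro!: holomorphic_intros)
  moreover have "zeta_chi holomorphic_on B"
    unfolding zeta_chi_def [abs_def]
    by (intro holomorphic_intros) (auto simp: B_def intro!: Re_pos_imp_notin_nonpos_Ints)
  ultimately have "(\<lambda>s. zeta_chi s * zeta_entire (1 - s) / (- s)) holomorphic_on B"
    unfolding o_def by (intro holomorphic_intros) (auto simp: B_def)
  then have B: "zeta_glued holomorphic_on B"
    by (rule holomorphic_transform) (auto simp: B_def zeta_glued_left)
  have "open A" "open B"
    unfolding A_def B_def by (intro open_Diff open_halfspace_Re_gt open_halfspace_Re_lt closed_singleton)+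
  from holomorphic_on_Un[OF A B this] have "zeta_glued holomorphic_on A \<union> B" .
  moreover have "A \<union> B = - {1}" by (auto simp: A_def B_def)
  ultimately show ?thesis by simp
qed

lemma zeta_eq_glued: "zeta = zeta_glued"
proof -
  have g: "zeta_glued holomorphic_on - {1} \<and> (\<forall>s. Re s > 1 \<longrightarrow> (\<lambda>n. of_nat (Suc n) powr (- s)) sums zeta_glued s) \<and> zeta_glued 1 = 0"
    using holomorphic_zeta_glued zeta_entire_sums by (auto simp: zeta_glued_def)
  show ?thesis
    unfolding zeta_def
  proof (rule the_equality)
    show "zeta_glued holomorphic_on - {1} \<and> (\<forall>s. Re s > 1 \<longrightarrow> (\<lambda>n. of_nat (Suc n) powr (- s)) sums zeta_glued s) \<and> zeta_glued 1 = 0"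
      by (rule g)
  qed (use g in \<open>intro zeta_conditions_unique; blast\<close>)
qed

lemma zeta_eq_entire: "Re s > -1 \<Longrightarrow> s \<noteq> 1 \<Longrightarrow> zeta s = zeta_entire s / (s - 1)"
  by (simp add: zeta_eq_glued zeta_glued_def)

lemma holomorphic_zeta: "zeta holomorphic_on - {1}"
  by (simp add: zeta_eq_glued holomorphic_zeta_glued)

lemma zeta_sums: "Re s > 1 \<Longrightarrow> (\<lambda>n. of_nat (Suc n) powr (- s)) sums zeta s"
  using zeta_entire_sums[of s] zeta_eq_entire[of s] by (cases "s = 1") (auto simp del: of_nat_Suc)

lemma zeta_functional_equation:
  assumes "-1 < Re s" "Re s < 1" "s \<noteq> 0"
  shows "zeta s = zeta_chi s * zeta (1 - s)"
proof -
  have "zeta s = zeta_entire s / (s - 1)" "zeta (1 - s) = zeta_entire (1 - s) / (- s)"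
    using assms zeta_eq_entire[of s] zeta_eq_entire[of "1 - s"] by (cases "s = 1"; simp)+
  moreover have "s - 1 \<noteq> 0" using assms by auto
  ultimately show ?thesis
  proof -
    assume z: "zeta s = zeta_entire s / (s - 1)" "zeta (1 - s) = zeta_entire (1 - s) / (- s)" and s1: "s - 1 \<noteq> 0"
    have e: "zeta_entire s = zeta s * (s - 1)" "zeta_entire (1 - s) = zeta (1 - s) * (- s)"
      using z s1 assms(3) by simp_all
    have "(s * (s - 1)) * zeta s = (s * (s - 1)) * (zeta_chi s * zeta (1 - s))"
      using zeta_entire_functional_equation[OF assms(1,2)] unfolding e by algebra
    then show ?thesis using s1 assms(3) by (subst (asm) mult_cancel_left) auto
  qed
qed

lemma zeta_cnj:
  assumes "Re s > -1"
  shows "zeta (cnj s) = cnj (zeta s)"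
proof (cases "s = 1")
  case True
  then show ?thesis by (simp add: zeta_eq_glued zeta_glued_def)
next
  case False
  then have "cnj s \<noteq> 1" by (metis complex_cnj_cnj complex_cnj_one)
  then show ?thesis using assms False by (simp add: zeta_eq_entire zeta_entire_cnj)
qed

text \<open>
  The disc reaches down to \<open>Re s = -7/10\<close>, and it contains \<open>-1/2 + \<i>T\<close>, where the zeta-function is
  known to be large.
\<close>
lemma zeta_growth:
  obtains T0 where "T0 \<ge> 10" "\<And>T s. T \<ge> T0 \<Longrightarrow> s \<in> cball (Complex 2 T) (27 / 10) \<Longrightarrow> norm (zeta s) \<le> T ^ 4"
proof -
  obtain K where K: "K > 0" "\<And>s. Re s \<ge> -3/4 \<Longrightarrow> norm (zeta_entire s) \<le> 1 + norm (s - 1) * (1/2 + K * (norm s * norm (s + 1)))"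
    using norm_zeta_entire_le by blast
  define T0 where "T0 = 10 + 3 + 9 * K"
  have "norm (zeta s) \<le> T ^ 4" if T: "T \<ge> T0" and s: "s \<in> cball (Complex 2 T) (27 / 10)" for T s
  proof -
    have T10: "T \<ge> 10" "T \<ge> 1" using T K by (auto simp: T0_def)
    have d: "norm (Complex 2 T - s) \<le> 27 / 10" using s by (simp add: dist_norm)
    have Re: "Re s \<ge> -3/4" using abs_Re_le_cmod[of "Complex 2 T - s"] d by auto
    have Im: "\<bar>T - Im s\<bar> \<le> 27 / 10" using abs_Im_le_cmod[of "Complex 2 T - s"] d by auto
    have "Im s \<ge> 7" using Im T10 by linarith
    then have n1: "norm (s - 1) \<ge> 1" using abs_Im_le_cmod[of "s - 1"] by simp
    then have s1: "s \<noteq> 1" by auto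
    have "norm (Complex 2 T) \<le> 2 + T" using cmod_le[of "Complex 2 T"] T10 by simp
    then have ns: "norm s \<le> T + 5" using norm_triangle_ineq4[of "Complex 2 T" "Complex 2 T - s"] d by simp
    have ns': "norm s \<le> 3 * T" "norm (s + 1) \<le> 3 * T" using ns norm_triangle_ineq[of s 1] T10 by auto
    have "norm (zeta s) = norm (zeta_entire s) / norm (s - 1)"
      using zeta_eq_entire[OF _ s1] Re by (simp add: norm_divide)
    also have "\<dots> \<le> (1 + norm (s - 1) * (1/2 + K * (norm s * norm (s + 1)))) / norm (s - 1)"
      using K(2)[OF Re] by (intro divide_right_mono) auto
    also have "\<dots> = 1 / norm (s - 1) + 1/2 + K * (norm s * norm (s + 1))"
      using s1 by (simp add: add_divide_distrib)
    also have "\<dots> \<le> 1 + 1/2 + K * ((3 * T) * (3 * T))"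
      using n1 ns' K(1) T10 by (intro add_mono mult_left_mono mult_mono) (auto simp: divide_simps)
    also have "\<dots> = 3/2 + 9 * K * T ^ 2" by (simp add: power2_eq_square)
    also have "\<dots> \<le> 3 * T ^ 2 + 9 * K * T ^ 2"
    proof -
      have "T ^ 2 \<ge> 1" using T10 by simp
      then show ?thesis by simp
    qed
    also have "\<dots> = (3 + 9 * K) * T ^ 2" by (simp add: algebra_simps)
    also have "\<dots> \<le> T ^ 2 * T ^ 2"
    proof (rule mult_right_mono)
      have "3 + 9 * K \<le> T" using T by (simp add: T0_def)
      also have "T \<le> T ^ 2" using T10 by (simp add: power2_eq_square)
      finally show "3 + 9 * K \<le> T ^ 2" .
    qed simp
    finally show ?thesis by simp
  qed
  moreover have "T0 \<ge> 10" using K by (simp add: T0_def)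
  ultimately show ?thesis using that by blast
qed

section \<open>The half-plane of absolute convergence\<close>

text \<open>
  The integers that survive the sieve of Eratosthenes by the primes up to \<open>N\<close>.  Their Dirichlet series
  is the zeta-function without the Euler factors of these primes.
\<close>
definition rough_numbers :: "nat \<Rightarrow> nat set" where
  "rough_numbers N = {n. n \<ge> 1 \<and> (\<forall>p. prime p \<and> p \<le> N \<longrightarrow> \<not> p dvd n)}"

lemma rough_numbers_split:
  assumes "prime (Suc N)"
  shows "rough_numbers N = rough_numbers (Suc N) \<union> (*) (Suc N) ` rough_numbers N"
    and "rough_numbers (Suc N) \<inter> (*) (Suc N) ` rough_numbers N = {}"
proof -
  show "rough_numbers N = rough_numbers (Suc N) \<union> (*) (Suc N) ` rough_numbers N"
  proof (intro equalityI subsetI)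
    fix n assume n: "n \<in> rough_numbers N"
    show "n \<in> rough_numbers (Suc N) \<union> (*) (Suc N) ` rough_numbers N"
    proof (cases "Suc N dvd n")
      case True
      then obtain m where m: "n = Suc N * m" by auto
      have "m \<in> rough_numbers N" using n unfolding m rough_numbers_def by (auto simp del: mult_Suc)
      then show ?thesis using m by blast
    next
      case False
      then show ?thesis using n by (auto simp: rough_numbers_def le_Suc_eq)
    qed
  next
    fix n assume n: "n \<in> rough_numbers (Suc N) \<union> (*) (Suc N) ` rough_numbers N"
    show "n \<in> rough_numbers N"
    proof (cases "n \<in> rough_numbers (Suc N)")
      case True then show ?thesis by (auto simp: rough_numbers_def)
    next
      case False
      then obtain m where m: "n = Suc N * m" "m \<in> rough_numbers N" using n by blast
      have "\<not> p dvd Suc N * m" if "prime p" "p \<le> N" for p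
        using that m(2) assms primes_dvd_imp_eq[of p "Suc N"] prime_dvd_mult_iff[of p "Suc N" m]
        by (auto simp: rough_numbers_def simp del: mult_Suc)
      then show ?thesis using m by (auto simp: rough_numbers_def simp del: mult_Suc)
    qed
  qed
  show "rough_numbers (Suc N) \<inter> (*) (Suc N) ` rough_numbers N = {}"
    using assms by (auto simp: rough_numbers_def simp del: mult_Suc)
qed

lemma zeta_norm_summable:
  assumes "Re s > 1"
  shows "(\<lambda>n. norm (of_nat n powr (- s) :: complex)) summable_on {1..}"
proof -
  have "(\<lambda>n. norm (of_nat (Suc n) powr (- s) :: complex)) summable_on UNIV"
  proof (rule summable_nonneg_imp_summable_on)
    show "summable (\<lambda>n. norm (of_nat (Suc n) powr (- s) :: complex))"
      using summable_Suc_powr[OF assms] by (simp only: norm_of_nat_powr uminus_complex.sel)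
  qed auto
  then have "((\<lambda>n. norm (of_nat n powr (- s) :: complex)) \<circ> Suc) summable_on UNIV" by (simp add: o_def)
  then have "(\<lambda>n. norm (of_nat n powr (- s) :: complex)) summable_on Suc ` UNIV"
    by (subst summable_on_reindex) auto
  also have "Suc ` UNIV = {1..}" by (auto simp: image_iff) (metis Suc_le_D One_nat_def)
  finally show ?thesis .
qed

lemma zeta_eq_infsum:
  assumes "Re s > 1"
  shows "zeta s = infsum (\<lambda>n. of_nat n powr (- s)) {1..}"
proof -
  have r: "{1..} = Suc ` UNIV" by (auto simp: image_iff) (metis Suc_le_D One_nat_def)
  have "(\<lambda>n. of_nat (Suc n) powr (- s)) summable_on (UNIV :: nat set)"
    using abs_summable_summable[OF zeta_norm_summable[OF assms]] unfolding r
    by (subst (asm) summable_on_reindex) (auto simp: o_def)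
  then have "((\<lambda>n. of_nat (Suc n) powr (- s)) has_sum infsum (\<lambda>n. of_nat (Suc n) powr (- s)) UNIV) (UNIV :: nat set)"
    by (rule has_sum_infsum)
  then have "zeta s = infsum (\<lambda>n. of_nat (Suc n) powr (- s)) (UNIV :: nat set)"
    using has_sum_imp_sums zeta_sums[OF assms] sums_unique2 by blast
  also have "\<dots> = infsum (\<lambda>n. of_nat n powr (- s)) {1..}"
    unfolding r by (subst infsum_reindex) (auto simp: o_def)
  finally show ?thesis .
qed

text \<open>
  Each prime contributes one Euler factor \<open>1 - p powr (- s)\<close>, which has norm at most 2.
\<close>
lemma infsum_rough_numbers:
  assumes "Re s > 1"
  shows "\<exists>P. infsum (\<lambda>n. of_nat n powr (- s)) (rough_numbers N) = P * zeta s \<and> norm P \<le> 2 ^ N"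
proof (induction N)
  case 0
  have "rough_numbers 0 = {1..}" by (auto simp: rough_numbers_def)
  then show ?case using zeta_eq_infsum[OF assms] by (intro exI[of _ 1]) simp
next
  case (Suc N)
  define f where "f = (\<lambda>n::nat. of_nat n powr (- s))"
  obtain P where P: "infsum f (rough_numbers N) = P * zeta s" "norm P \<le> 2 ^ N"
    using Suc.IH by (auto simp: f_def)
  have sm: "f summable_on A" if "A \<subseteq> {1..}" for A
    using abs_summable_summable[OF zeta_norm_summable[OF assms]] that unfolding f_def
    by (rule summable_on_subset_banach)
  have sub: "rough_numbers M \<subseteq> {1..}" for M by (auto simp: rough_numbers_def)
  show ?case
  proof (cases "prime (Suc N)")
    case True
    have sub2: "(*) (Suc N) ` rough_numbers N \<subseteq> {1..}" using rough_numbers_split(1)[OF True] sub by blast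
    have "infsum f (rough_numbers N) = infsum f (rough_numbers (Suc N)) + infsum f ((*) (Suc N) ` rough_numbers N)"
      by (subst rough_numbers_split(1)[OF True], rule infsum_Un_disjoint[OF sm[OF sub] sm[OF sub2] rough_numbers_split(2)[OF True]])
    also have "infsum f ((*) (Suc N) ` rough_numbers N) = infsum (\<lambda>n. f (Suc N) * f n) (rough_numbers N)"
    proof (subst infsum_reindex)
      show "inj_on ((*) (Suc N)) (rough_numbers N)" by (auto simp: inj_on_def simp del: mult_Suc)
      have "f (Suc N * n) = f (Suc N) * f n" for n
        unfolding f_def of_nat_mult by (rule powr_times_real) (auto simp del: of_nat_Suc)
      then show "infsum (f \<circ> (*) (Suc N)) (rough_numbers N) = infsum (\<lambda>n. f (Suc N) * f n) (rough_numbers N)"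
        by (simp only: o_def)
    qed
    also have "\<dots> = f (Suc N) * infsum f (rough_numbers N)"
      by (rule infsum_cmult_right, rule sm, rule sub)
    finally have "infsum f (rough_numbers (Suc N)) = (1 - f (Suc N)) * P * zeta s"
      unfolding P(1) by (simp add: algebra_simps)
    moreover have "norm ((1 - f (Suc N)) * P) \<le> 2 * 2 ^ N"
    proof -
      have "norm (f (Suc N)) = real (Suc N) powr (- Re s)"
        unfolding f_def norm_of_nat_powr by simp
      also have "\<dots> \<le> 1" using assms powr_mono[of "- Re s" 0 "real (Suc N)"] by simp
      finally have "norm (1 - f (Suc N)) \<le> 2" using norm_triangle_ineq4[of 1 "f (Suc N)"] by simp
      then show ?thesis unfolding norm_mult using P(2) by (intro mult_mono) auto
    qed
    ultimately show ?thesis unfolding f_def by (intro exI[of _ "(1 - f (Suc N)) * P"]) (auto simp: f_def)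
  next
    case False
    then have "rough_numbers (Suc N) = rough_numbers N" by (auto simp: rough_numbers_def le_Suc_eq)
    then show ?thesis using P order.trans[OF P(2), of "2 * 2 ^ N"] unfolding f_def by (intro exI[of _ P]) auto
  qed
qed

text \<open>
  Apart from 1, all numbers surviving the sieve exceed \<open>N\<close>, so for large \<open>N\<close> the sieved series is close to 1,
  uniformly in the half-plane; dividing by the finitely many Euler factors bounds the zeta-function below.
\<close>
lemma zeta_lower_bound:
  assumes "\<sigma> > (1::real)"
  obtains c where "c > 0" "\<And>s. Re s \<ge> \<sigma> \<Longrightarrow> norm (zeta s) \<ge> c"
proof -
  define g where "g = (\<lambda>n. real n powr (- \<sigma>))"
  have gs: "g summable_on {1..}"
    using zeta_norm_summable[of "of_real \<sigma>"] assms by (simp add: norm_of_nat_powr g_def)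
  have "summable g" using summable_real_powr_iff[of "- \<sigma>"] assms by (simp add: g_def)
  then obtain N where N: "\<And>m. m \<ge> N \<Longrightarrow> norm (\<Sum>i. g (i + m)) < 1/2"
    using suminf_exist_split[of "1/2" g] by auto
  have tail: "infsum g {Suc N..} \<le> 1/2"
  proof -
    have "{Suc N..} = (\<lambda>i. i + Suc N) ` UNIV"
    proof (intro equalityI subsetI)
      fix n assume "n \<in> {Suc N..}"
      then show "n \<in> (\<lambda>i. i + Suc N) ` UNIV" by (intro image_eqI[of _ _ "n - Suc N"]) auto
    qed auto
    then have "infsum g {Suc N..} = infsum (\<lambda>i. g (i + Suc N)) UNIV"
      by (simp only:) (subst infsum_reindex, auto simp: o_def inj_def)
    also have "\<dots> = (\<Sum>i. g (i + Suc N))"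
    proof (rule sums_unique, rule has_sum_imp_sums, rule has_sum_infsum)
      show "(\<lambda>i. g (i + Suc N)) summable_on UNIV"
        by (rule summable_nonneg_imp_summable_on[OF summable_ignore_initial_segment[OF \<open>summable g\<close>]]) (simp add: g_def)
    qed
    finally show ?thesis using N[of "Suc N"] by simp
  qed
  have "norm (zeta s) \<ge> 1 / 2 / 2 ^ N" if s: "Re s \<ge> \<sigma>" for s
  proof -
    have s1: "Re s > 1" using s assms by simp
    define f where "f = (\<lambda>n::nat. of_nat n powr (- s))"
    obtain P where P: "infsum f (rough_numbers N) = P * zeta s" "norm P \<le> 2 ^ N"
      using infsum_rough_numbers[OF s1, of N] by (auto simp: f_def)
    have sub: "rough_numbers N - {1} \<subseteq> {Suc N..}"
    proof
      fix n assume n: "n \<in> rough_numbers N - {1}"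
      then obtain p where p: "prime p" "p dvd n" using prime_factor_nat[of n] by auto
      then have "p > N" using n by (auto simp: rough_numbers_def)
      moreover have "p \<le> n" using p n by (auto simp: rough_numbers_def dvd_imp_le)
      ultimately show "n \<in> {Suc N..}" by auto
    qed
    have ab: "(\<lambda>n. norm (f n)) summable_on {1..}" unfolding f_def by (rule zeta_norm_summable[OF s1])
    have abs1: "(\<lambda>n. norm (f n)) summable_on A" if "A \<subseteq> {1..}" for A
      using ab that by (rule summable_on_subset_banach)
    have fs: "f summable_on A" if "A \<subseteq> {1..}" for A using abs_summable_summable[OF abs1[OF that]] .
    have R1: "rough_numbers N = insert 1 (rough_numbers N - {1})"
      by (auto simp: rough_numbers_def dest: prime_gt_1_nat)
    have "infsum f (rough_numbers N) = f 1 + infsum f (rough_numbers N - {1})"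
      by (subst R1, rule infsum_insert) (auto intro!: fs simp: rough_numbers_def)
    moreover have "f 1 = 1" by (simp add: f_def)
    moreover have "norm (infsum f (rough_numbers N - {1})) \<le> 1/2"
    proof -
      have "norm (infsum f (rough_numbers N - {1})) \<le> infsum (\<lambda>n. norm (f n)) (rough_numbers N - {1})"
        by (rule norm_infsum_bound) (rule abs1, auto simp: rough_numbers_def)
      also have "\<dots> \<le> infsum g {Suc N..}"
      proof (rule infsum_mono_neutral)
        show "(\<lambda>n. norm (f n)) summable_on rough_numbers N - {1}" by (rule abs1) (auto simp: rough_numbers_def)
        show "g summable_on {Suc N..}" by (rule summable_on_subset_banach[OF gs]) auto
        fix n assume "n \<in> (rough_numbers N - {1}) \<inter> {Suc N..}"
        then have n: "n \<ge> 1" by auto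
        have "norm (f n) = real n powr (- Re s)" unfolding f_def norm_of_nat_powr by simp
        also have "\<dots> \<le> g n" unfolding g_def using n s by (intro powr_mono) auto
        finally show "norm (f n) \<le> g n" .
      qed (use sub in \<open>auto simp: g_def\<close>)
      also have "\<dots> \<le> 1/2" by (rule tail)
      finally show ?thesis .
    qed
    ultimately have "norm (P * zeta s) \<ge> 1/2"
      using P(1) norm_triangle_ineq4[of "P * zeta s" "infsum f (rough_numbers N - {1})"] by simp
    also have "norm (P * zeta s) \<le> 2 ^ N * norm (zeta s)"
      unfolding norm_mult using P(2) by (rule mult_right_mono) simp
    finally show ?thesis by (simp add: field_simps)
  qed
  then show ?thesis by (intro that[of "1 / 2 / 2 ^ N"]) auto
qed

section \<open>The functional equation on and to the left of the critical line\<close>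

text \<open>
  In the limit formula \<open>ln m - (\<Sum>n<m. 1 / (z + n))\<close> the real parts of the terms with \<open>n < \<bar>Im z\<bar>\<close> are so
  small that they add up to \<open>O(1)\<close>, and the others are at most \<open>1 / n\<close>.
\<close>
lemma Re_Digamma_ge:
  fixes z :: complex
  assumes "Re z = 1/4" "\<bar>Im z\<bar> \<ge> 1"
  shows "Re (Digamma z) \<ge> ln \<bar>Im z\<bar> - 3"
proof -
  define y where "y = \<bar>Im z\<bar>"
  have y: "y \<ge> 1" "y\<^sup>2 = (Im z)\<^sup>2" using assms by (simp_all add: y_def)
  have z0: "z \<noteq> 0" using assms by auto
  define N where "N = nat \<lfloor>y\<rfloor>"
  have N': "N \<ge> 1" "real N \<le> y" "y < real N + 1" using y unfolding N_def by linarith+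
  then have N: "N \<ge> 1" "real N \<le> y" "y \<le> 2 * real N" by linarith+
  define a where "a = (\<lambda>n. Re (inverse (z + of_nat n)))"
  have a_eq: "a n = (1/4 + real n) / ((1/4 + real n)\<^sup>2 + y\<^sup>2)" for n
    by (simp only: a_def inverse_complex.sel plus_complex.sel complex_Re_of_nat complex_Im_of_nat assms(1) y(2) add_0_right)
  have a1: "a n \<le> 1 / real N" if "n < N" for n
  proof -
    have n1: "1/4 + real n \<le> real N" using that by linarith
    have "real N * (1/4 + real n) \<le> real N * real N" using n1 N by (intro mult_left_mono) auto
    also have "\<dots> \<le> y * y" using N by (intro mult_mono) auto
    also have "\<dots> \<le> (1/4 + real n)\<^sup>2 + y\<^sup>2" by (simp add: power2_eq_square)
    finally show ?thesis unfolding a_eq using N y by (simp add: divide_simps add_pos_nonneg mult_ac)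
  qed
  have a2: "a n \<le> 1 / real n" if "n \<ge> 1" for n
  proof -
    have "real n * (1/4 + real n) \<le> (1/4 + real n) * (1/4 + real n)" by (intro mult_right_mono) auto
    also have "\<dots> \<le> (1/4 + real n)\<^sup>2 + y\<^sup>2" by (simp add: power2_eq_square)
    finally show ?thesis unfolding a_eq using that y by (simp add: divide_simps add_pos_nonneg mult_ac)
  qed
  have bound: "(\<Sum>n<Suc m. a n) \<le> 2 + ln (real m) - ln (real N)" if "m \<ge> N" for m
    using that
  proof (induction m rule: dec_induct)
    case base
    have "(\<Sum>n<N. a n) \<le> (\<Sum>n<N. 1 / real N)" by (intro sum_mono a1) auto
    also have "\<dots> = 1" using N by simp
    finally have "(\<Sum>n<N. a n) \<le> 1" .
    moreover have "a N \<le> 1" using a2[of N] N by (simp add: order.trans[OF a2])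
    ultimately show ?case by simp
  next
    case (step m)
    have m: "m \<ge> 1" using step N by auto
    have "ln (real m / real (Suc m)) \<le> real m / real (Suc m) - 1"
      using m by (intro ln_le_minus_one) auto
    also have "\<dots> = - (1 / real (Suc m))" by (simp add: field_simps)
    finally have "1 / real (Suc m) \<le> ln (real (Suc m)) - ln (real m)"
      using m by (simp add: ln_div del: of_nat_Suc)
    then show ?case using step.IH a2[of "Suc m"] by (simp del: of_nat_Suc)
  qed
  have lim: "(\<lambda>m. Re (of_real (ln (real m)) - (\<Sum>n<m. inverse (z + of_nat n)))) \<longlonglongrightarrow> Re (Digamma z)"
    by (intro tendsto_Re Digamma_LIMSEQ z0)
  show ?thesis
  proof (rule tendsto_lowerbound[OF lim])
    have "ln y - 3 \<le> Re (of_real (ln (real m)) - (\<Sum>n<m. inverse (z + of_nat n)))" if "m \<ge> Suc N" for m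
    proof -
      define k where "k = m - 1"
      have k: "m = Suc k" "k \<ge> N" using that by (simp_all add: k_def)
      have "Re (of_real (ln (real m)) - (\<Sum>n<m. inverse (z + of_nat n))) = ln (real m) - (\<Sum>n<m. a n)"
        by (simp add: a_def)
      moreover have "ln (real k) \<le> ln (real m)" using k N by (intro ln_mono) auto
      moreover have "ln y \<le> ln (2 * real N)" using N y by (intro ln_mono) auto
      moreover have "ln (2 * real N) = ln 2 + ln (real N)" using N by (subst ln_mult) auto
      moreover have "ln 2 \<le> (1::real)" using ln_le_minus_one[of "2::real"] by simp
      ultimately show ?thesis using bound[OF k(2), folded k(1)] by linarith
    qed
    then show "\<forall>\<^sub>F m in sequentially. ln \<bar>Im z\<bar> - 3 \<le> Re (of_real (ln (real m)) - (\<Sum>n<m. inverse (z + of_nat n)))"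
      unfolding y_def by (rule eventually_sequentiallyI)
  qed auto
qed

text \<open>
  On the critical line \<open>1 - s\<close> is the conjugate of \<open>s\<close>, so the logarithmic derivative of the functional
  equation reads \<open>2 Re (\<zeta>'/\<zeta>)(s) = Re (\<chi>'/\<chi>)(s)\<close>, and the right-hand side is at most \<open>- ln T + O(1)\<close>
  by the bound for the Digamma function.
\<close>
lemma Re_zeta_log_deriv_critical_line:
  obtains T0 where "T0 \<ge> 10" "\<And>T. T \<ge> T0 \<Longrightarrow> zeta (Complex (1/2) T) \<noteq> 0 \<Longrightarrow>
     Re (deriv zeta (Complex (1/2) T) / zeta (Complex (1/2) T)) \<le> - (ln T / 4)"
proof -
  have "eventually (\<lambda>T::real. ln pi - ln (T / 2) + 3 \<le> - (ln T / 2)) at_top" by real_asymp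
  then obtain T1 where T1: "\<And>T. T \<ge> T1 \<Longrightarrow> ln pi - ln (T / 2) + 3 \<le> - (ln T / 2)"
    by (auto simp: eventually_at_top_linorder)
  show ?thesis
  proof (rule that[of "max 10 T1"])
    fix T assume T: "T \<ge> max 10 T1" and nz: "zeta (Complex (1/2) T) \<noteq> 0"
    define s where "s = Complex (1/2) T"
    have s: "Re s = 1/2" "Im s = T" by (simp_all add: s_def)
    have s0: "s \<noteq> 0" using s(1) by auto
    have cs: "1 - s = cnj s" by (simp add: s_def complex_eq_iff)
    define L where "L = of_real (ln pi) - Digamma ((1 - s) / 2) / 2 - Digamma (s / 2) / 2"
    have n: "(1 - s) / 2 \<notin> \<int>\<^sub>\<le>\<^sub>0" "s / 2 \<notin> \<int>\<^sub>\<le>\<^sub>0"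
      by (auto intro!: Re_pos_imp_notin_nonpos_Ints simp: s)
    have dchi: "(zeta_chi has_field_derivative zeta_chi s * L) (at s)"
    proof -
      have 1: "((\<lambda>s. of_real pi powr (s - 1 / 2)) has_field_derivative of_real pi powr (s - 1/2) * of_real (ln pi)) (at s)"
      proof -
        have "((\<lambda>s. s - 1 / 2) has_field_derivative 1) (at s)" by (auto intro!: derivative_eq_intros)
        from DERIV_chain2[OF has_field_derivative_powr_right[of "of_real pi :: complex"] this]
        show ?thesis by (simp add: Ln_of_real mult.commute)
      qed
      have h1: "((\<lambda>s::complex. (1 - s) / 2) has_field_derivative - (1/2)) (at s)"
        by (auto intro!: derivative_eq_intros)
      have h2: "((\<lambda>s::complex. s / 2) has_field_derivative 1/2) (at s)"
        by (auto intro!: derivative_eq_intros)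
      have 2: "((\<lambda>s. Gamma ((1 - s) / 2)) has_field_derivative (Gamma ((1 - s) / 2) * Digamma ((1 - s) / 2)) * - (1/2)) (at s)"
        by (rule DERIV_chain2[OF has_field_derivative_Gamma[OF n(1)] h1])
      have 3: "((\<lambda>s. rGamma (s / 2)) has_field_derivative (- rGamma (s / 2) * Digamma (s / 2)) * (1/2)) (at s)"
        by (rule DERIV_chain2[OF has_field_derivative_rGamma_no_nonpos_int[OF n(2)] h2])
      from DERIV_mult[OF DERIV_mult[OF 1 2] 3]
      show ?thesis unfolding zeta_chi_def [abs_def] L_def
        by (rule DERIV_cong) (simp add: algebra_simps)
    qed
    define D where "D = deriv zeta s"
    have op: "open (- {1::complex})" by auto
    have dz: "(zeta has_field_derivative D) (at s)"
      unfolding D_def by (rule holomorphic_derivI[OF holomorphic_zeta op]) (auto simp: s_def complex_eq_iff)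
    have dz': "(zeta has_field_derivative deriv zeta (1 - s)) (at (1 - s))"
      by (rule holomorphic_derivI[OF holomorphic_zeta op]) (use T in \<open>auto simp: s_def complex_eq_iff\<close>)
    have ev: "eventually (\<lambda>w. -1 < Re w \<and> Re w < 1 \<and> w \<noteq> 0) (nhds s)"
    proof (rule eventually_nhds_in_open[of "{w. -1 < Re w} \<inter> {w. Re w < 1} - {0}" s, THEN eventually_mono])
      show "open ({w. -1 < Re w} \<inter> {w. Re w < 1} - {0})"
        by (intro open_Diff open_Int open_halfspace_Re_gt open_halfspace_Re_lt closed_singleton)
    qed (auto simp: s s0)
    have h: "((\<lambda>s::complex. 1 - s) has_field_derivative - 1) (at s)"
      by (auto intro!: derivative_eq_intros)
    have cnj_deriv: "deriv zeta (1 - s) = cnj D"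
    proof -
      have "((cnj \<circ> zeta \<circ> cnj) has_field_derivative cnj D) (at (cnj s))"
        using dz by (simp add: has_field_derivative_cnj_cnj)
      moreover have "eventually (\<lambda>w. (cnj \<circ> zeta \<circ> cnj) w = zeta w) (nhds (cnj s))"
      proof (rule eventually_nhds_in_open[of "{w. -1 < Re w}", THEN eventually_mono])
        show "(cnj \<circ> zeta \<circ> cnj) w = zeta w" if "w \<in> {w. -1 < Re w}" for w
          using that zeta_cnj[of w] by simp
      qed (auto simp: s open_halfspace_Re_gt)
      ultimately have "(zeta has_field_derivative cnj D) (at (cnj s))"
        by (subst (asm) DERIV_cong_ev[OF refl _ refl]) auto
      then show ?thesis using DERIV_unique[OF dz'] cs by metis
    qed
    have "((\<lambda>s. zeta_chi s * zeta (1 - s)) has_field_derivative zeta_chi s * L * zeta (1 - s) + (cnj D * (- 1)) * zeta_chi s) (at s)"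
      using DERIV_mult[OF dchi DERIV_chain2[OF dz' h]] by (simp only: cnj_deriv)
    moreover have "eventually (\<lambda>w. zeta_chi w * zeta (1 - w) = zeta w) (nhds s)"
      using ev by eventually_elim (use zeta_functional_equation in auto)
    ultimately have "(zeta has_field_derivative zeta_chi s * L * zeta (1 - s) + (cnj D * (- 1)) * zeta_chi s) (at s)"
      by (subst (asm) DERIV_cong_ev[OF refl _ refl]) auto
    then have D_eq: "D = zeta_chi s * L * zeta (1 - s) + (cnj D * (- 1)) * zeta_chi s"
      using DERIV_unique[OF dz] by blast
    have fe: "zeta s = zeta_chi s * zeta (1 - s)"
      by (rule zeta_functional_equation) (use s s0 in auto)
    have zc: "zeta (1 - s) = cnj (zeta s)" unfolding cs by (rule zeta_cnj) (simp add: s)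
    have nz': "zeta s \<noteq> 0" using nz by (simp add: s_def)
    then have chi0: "zeta_chi s \<noteq> 0" "cnj (zeta s) \<noteq> 0" using fe by auto
    have "D / zeta s = L - cnj (D / zeta s)"
    proof -
      have "D / zeta s = (zeta_chi s * L * zeta (1 - s) + (cnj D * (- 1)) * zeta_chi s) / (zeta_chi s * zeta (1 - s))"
        using D_eq fe by metis
      also have "\<dots> = L - cnj D / zeta (1 - s)"
        using chi0 zc by (simp add: field_simps)
      finally show ?thesis unfolding zc complex_cnj_divide .
    qed
    then have "Re (D / zeta s) = Re L - Re (D / zeta s)" by (metis cnj.simps(1) minus_complex.simps(1))
    moreover have "Re L = ln pi - Re (Digamma ((1 - s) / 2)) / 2 - Re (Digamma (s / 2)) / 2"
      by (simp add: L_def)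
    moreover have "Re (Digamma ((1 - s) / 2)) \<ge> ln (T / 2) - 3" "Re (Digamma (s / 2)) \<ge> ln (T / 2) - 3"
      using Re_Digamma_ge[of "(1 - s) / 2"] Re_Digamma_ge[of "s / 2"] T by (auto simp: s)
    moreover have "ln pi - ln (T / 2) + 3 \<le> - (ln T / 2)" using T1 T by simp
    ultimately show "Re (deriv zeta (Complex (1/2) T) / zeta (Complex (1/2) T)) \<le> - (ln T / 4)"
      unfolding D_def [symmetric] s_def [symmetric] by (simp add: D_def)
  qed auto
qed

text \<open>
  The abscissa \<open>-1/2\<close> is chosen because there the two Gamma factors have, up to conjugation, arguments
  that differ by 1, so that their quotient is a linear function.
\<close>
lemma zeta_left_lower_bound:
  obtains c where "c > 0" "\<And>T. T \<ge> 1 \<Longrightarrow> norm (zeta (Complex (-1/2) T)) \<ge> c * T"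
proof -
  obtain c where c: "c > 0" "\<And>s. Re s \<ge> 3/2 \<Longrightarrow> norm (zeta s) \<ge> c"
    using zeta_lower_bound[of "3/2"] by auto
  have "norm (zeta (Complex (-1/2) T)) \<ge> (c / (2 * pi)) * T" if T: "T \<ge> 1" for T
  proof -
    define s where "s = Complex (-1/2) T"
    have s: "Re s = -1/2" "Im s = T" by (simp_all add: s_def)
    have n: "s / 2 \<notin> \<int>\<^sub>\<le>\<^sub>0"
    proof
      assume "s / 2 \<in> \<int>\<^sub>\<le>\<^sub>0"
      then obtain n where "s / 2 = - of_nat n" by (auto elim!: nonpos_Ints_cases')
      then have "Im (s / 2) = Im (- of_nat n)" by (simp only:)
      then show False using s T by simp
    qed
    have "Gamma (cnj ((1 - s) / 2)) = s / 2 * Gamma (s / 2)"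
    proof -
      have "cnj ((1 - s) / 2) = s / 2 + 1" by (simp add: complex_eq_iff s)
      then have "Gamma (cnj ((1 - s) / 2)) = Gamma (s / 2 + 1)" by (simp only:)
      then show ?thesis using Gamma_plus1[OF n] by (simp only:)
    qed
    then have G: "norm (Gamma ((1 - s) / 2)) = norm (s / 2) * norm (Gamma (s / 2))"
      unfolding cnj_Gamma [symmetric] by (metis complex_mod_cnj norm_mult)
    have "norm (Gamma (s / 2)) * norm (rGamma (s / 2)) = 1"
      using n by (simp add: rGamma_inverse_Gamma Gamma_eq_zero_iff norm_inverse)
    then have "norm (Gamma ((1 - s) / 2)) * norm (rGamma (s / 2)) = norm (s / 2)"
      unfolding G by (simp add: mult.assoc)
    moreover have pw: "norm (of_real pi powr (s - 1/2)) = 1 / pi"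
    proof -
      have "norm (of_real pi powr (s - 1/2)) = pi powr (- 1)"
        by (subst norm_powr_real_powr) (auto simp: s)
      then show ?thesis by (simp add: powr_minus_divide)
    qed
    ultimately have "norm (zeta_chi s) = norm (s / 2) / pi"
    proof -
      assume "norm (Gamma ((1 - s) / 2)) * norm (rGamma (s / 2)) = norm (s / 2)"
      then show ?thesis unfolding zeta_chi_def norm_mult pw mult.assoc by (simp only:) simp
    qed
    moreover have "norm (s / 2) \<ge> T / 2" using abs_Im_le_cmod[of "s / 2"] T by (simp add: s)
    ultimately have chi: "norm (zeta_chi s) \<ge> T / 2 / pi" by (simp add: divide_right_mono)
    have "zeta s = zeta_chi s * zeta (1 - s)"
      by (rule zeta_functional_equation) (use s T in auto)
    then have "norm (zeta s) = norm (zeta_chi s) * norm (zeta (1 - s))" by (simp add: norm_mult)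
    also have "\<dots> \<ge> T / 2 / pi * c"
      using chi c(1) c(2)[of "1 - s"] T by (intro mult_mono) (auto simp: s)
    finally show ?thesis by (simp add: s_def field_simps)
  qed
  then show ?thesis using c by (intro that[of "c / (2 * pi)"]) auto
qed

lemma zeta_upper_bound_right:
  assumes "\<sigma> > (1::real)"
  obtains C where "C > 0" "\<And>s. Re s \<ge> \<sigma> \<Longrightarrow> norm (zeta s) \<le> C"
proof -
  have sm: "summable (\<lambda>n. real (Suc n) powr (- \<sigma>))" by (rule summable_Suc_powr) fact
  have "norm (zeta s) \<le> (\<Sum>n. real (Suc n) powr (- \<sigma>))" if s: "Re s \<ge> \<sigma>" for s
  proof -
    have "zeta s = (\<Sum>n. of_nat (Suc n) powr (- s))"
      by (rule sums_unique[OF zeta_sums]) (use s assms in auto)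
    also have "norm \<dots> \<le> (\<Sum>n. real (Suc n) powr (- \<sigma>))"
    proof (rule norm_suminf_le[OF _ sm])
      fix n
      have "norm (of_nat (Suc n) powr (- s) :: complex) = real (Suc n) powr (- Re s)"
        by (simp only: norm_of_nat_powr uminus_complex.sel)
      also have "\<dots> \<le> real (Suc n) powr (- \<sigma>)" using s by (intro powr_mono) auto
      finally show "norm (of_nat (Suc n) powr (- s) :: complex) \<le> real (Suc n) powr (- \<sigma>)" .
    qed
    finally show ?thesis .
  qed
  moreover have "(\<Sum>n. real (Suc n) powr (- \<sigma>)) > 0" by (rule suminf_pos[OF sm]) simp
  ultimately show ?thesis using that by blast
qed

lemma zeta_nonzero_right: "Re s > 1 \<Longrightarrow> zeta s \<noteq> 0"
  using zeta_lower_bound[of "Re s"] by (metis less_le_not_le norm_zero order.refl)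

text \<open>
  The functional equation excludes zeros with \<open>-1 < Re s < 0\<close>; the only zeros of its Gamma factors are real.
\<close>
lemma zeta_zeros_nontrivial:
  assumes "zeta s = 0" "Re s > -1" "Im s \<noteq> 0"
  shows "s \<in> nontrivial_zeros"
proof -
  have "Re s \<le> 1" using zeta_nonzero_right[of s] assms by force
  moreover have "Re s \<ge> 0"
  proof (rule ccontr)
    assume neg: "\<not> Re s \<ge> 0"
    have "zeta s = zeta_chi s * zeta (1 - s)"
      by (rule zeta_functional_equation) (use assms neg in auto)
    moreover have "zeta (1 - s) \<noteq> 0" by (rule zeta_nonzero_right) (use neg in auto)
    moreover have "Gamma ((1 - s) / 2) \<noteq> 0"
      by (subst Gamma_eq_zero_iff) (rule Re_pos_imp_notin_nonpos_Ints, use neg in auto)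
    moreover have "rGamma (s / 2) \<noteq> 0"
    proof -
      have "s / 2 \<notin> \<int>\<^sub>\<le>\<^sub>0"
      proof
        assume "s / 2 \<in> \<int>\<^sub>\<le>\<^sub>0"
        then obtain n where "s / 2 = - of_nat n" by (auto elim!: nonpos_Ints_cases')
        then have "Im (s / 2) = Im (- of_nat n)" by (simp only:)
        then show False using assms by simp
      qed
      then show ?thesis by (simp add: rGamma_eq_zero_iff)
    qed
    ultimately show False using assms by (simp add: zeta_chi_def)
  qed
  ultimately show ?thesis using assms by (auto simp: nontrivial_zeros_def)
qed

section \<open>Zeros of holomorphic functions in a disc\<close>

text \<open>
  The zeros are divided out one at a time.  The quotient by a power of \<open>z - w\<close> is extended to \<open>w\<close> by the value that
  the local factorization of \<open>f\<close> at \<open>w\<close> prescribes, and near \<open>w\<close> it coincides with that factorization.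
\<close>
lemma holomorphic_factor_zeros:
  assumes f: "f holomorphic_on A" and A: "open A" "connected A" and nz: "\<exists>z\<in>A. f z \<noteq> 0"
    and W: "finite W" "W \<subseteq> A"
  shows "\<exists>h. h holomorphic_on A \<and> (\<forall>w\<in>W. h w \<noteq> 0) \<and>
           (\<forall>z\<in>A. f z = h z * (\<Prod>w\<in>W. (z - w) ^ nat (zorder f w)))"
  using W
proof (induction W rule: finite_induct)
  case empty
  then show ?case using f by (intro exI[of _ f]) auto
next
  case (insert w W)
  define P where "P = (\<lambda>z. \<Prod>w\<in>W. (z - w) ^ nat (zorder f w))"
  define n where "n = nat (zorder f w)"
  obtain h where h: "h holomorphic_on A" "\<forall>w\<in>W. h w \<noteq> 0" "\<And>z. z \<in> A \<Longrightarrow> f z = h z * P z"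
    using insert.IH insert.prems by (auto simp: P_def)
  have P_nz: "P z \<noteq> 0" if "z \<notin> W" for z
    using that insert.hyps(1) by (auto simp: P_def)
  have P_holo: "P holomorphic_on B" for B unfolding P_def by (intro holomorphic_intros)
  obtain r g where r: "r > 0" "cball w r \<subseteq> A" "g holomorphic_on cball w r"
    and g: "\<And>z. z \<in> cball w r \<Longrightarrow> f z = g z * (z - w) ^ n \<and> g z \<noteq> 0"
    using zorder_exist_zero[OF f A, of w] nz insert.prems unfolding n_def by blast
  have "open (- W)" using insert.hyps(1) by (simp add: finite_imp_closed open_Compl)
  then obtain e where e: "e > 0" "ball w e \<subseteq> - W"
    using insert.hyps(2) by (meson ComplI open_contains_ball)
  define B where "B = ball w (min r e)"
  have B: "open B" "w \<in> B" "B \<subseteq> cball w r" "B \<subseteq> - W" using r e by (auto simp: B_def)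
  define k where "k = (\<lambda>z. if z = w then g w / P w else h z / (z - w) ^ n)"
  have kB: "k z = g z / P z" if "z \<in> B" for z
  proof (cases "z = w")
    case False
    have "z \<in> cball w r" "z \<in> A" using that B r by blast+
    then have "h z * P z = g z * (z - w) ^ n" using g[of z] h(3)[of z] by auto
    moreover have "P z \<noteq> 0" by (rule P_nz) (use that B in auto)
    ultimately show ?thesis using False by (simp add: k_def field_simps)
  qed (simp add: k_def)
  have "(\<lambda>z. h z / (z - w) ^ n) holomorphic_on (A - {w})"
    by (intro holomorphic_intros holomorphic_on_subset[OF h(1)]) auto
  then have 1: "k holomorphic_on (A - {w})"
    by (rule holomorphic_transform) (auto simp: k_def)
  have "(\<lambda>z. g z / P z) holomorphic_on B"
    by (intro holomorphic_intros holomorphic_on_subset[OF r(3)] P_holo) (use B P_nz in auto)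
  then have 2: "k holomorphic_on B" by (rule holomorphic_transform) (auto simp: kB)
  have "k holomorphic_on ((A - {w}) \<union> B)"
    by (rule holomorphic_on_Un[OF 1 2]) (use A B in \<open>auto intro: open_delete\<close>)
  then have "k holomorphic_on A" by (rule holomorphic_on_subset) (use B in auto)
  moreover have "\<forall>v\<in>insert w W. k v \<noteq> 0"
  proof
    fix v assume v: "v \<in> insert w W"
    show "k v \<noteq> 0"
    proof (cases "v = w")
      case True
      then show ?thesis using g[of w] r P_nz[OF insert.hyps(2)] by (simp add: k_def)
    next
      case False
      then show ?thesis using v h(2) by (auto simp: k_def)
    qed
  qed
  moreover have "f z = k z * (\<Prod>w\<in>insert w W. (z - w) ^ nat (zorder f w))" if z: "z \<in> A" for z
  proof (cases "z = w")
    case True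
    have "f w = k w * P w * (w - w) ^ n" using g[of w] r P_nz[OF insert.hyps(2)] by (simp add: k_def)
    then show ?thesis using True insert.hyps by (simp add: P_def n_def mult_ac)
  next
    case False
    then show ?thesis using h(3)[OF z] insert.hyps by (simp add: k_def P_def n_def)
  qed
  ultimately show ?case by blast
qed

text \<open>
  The quotient \<open>(s - w) / blaschke_denom c R w s\<close> is the Blaschke factor of the disc of radius \<open>R\<close> about \<open>c\<close>
  with zero \<open>w\<close>: it has modulus 1 on the boundary circle.
\<close>
definition blaschke_denom :: "complex \<Rightarrow> real \<Rightarrow> complex \<Rightarrow> complex \<Rightarrow> complex" where
  "blaschke_denom c R w s = (of_real (R\<^sup>2) - cnj (w - c) * (s - c)) / of_real R"

lemma norm_blaschke_denom_sphere:
  assumes "R > 0" "norm (s - c) = R"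
  shows "norm (blaschke_denom c R w s) = norm (s - w)"
proof -
  define z a where "z = s - c" and "a = w - c"
  have "of_real (R\<^sup>2) = z * cnj z"
    using assms complex_norm_square[of z] by (simp add: z_def)
  then have "of_real (R\<^sup>2) - cnj a * z = z * cnj (z - a)" by (simp add: algebra_simps)
  then have "norm (of_real (R\<^sup>2) - cnj a * z) = R * norm (z - a)"
    using assms by (simp add: norm_mult z_def flip: complex_cnj_diff)
  then have "norm (blaschke_denom c R w s) = norm (z - a)"
    using assms by (simp add: blaschke_denom_def norm_divide a_def z_def)
  then show ?thesis by (simp add: z_def a_def)
qed

text \<open>
  The difference of the squares of both sides, times \<open>R\<^sup>2\<close>, is the product of \<open>R\<^sup>2 - \<bar>s - c\<bar>\<^sup>2\<close> and
  \<open>R\<^sup>2 - \<bar>w - c\<bar>\<^sup>2\<close>.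
\<close>
lemma norm_diff_le_blaschke_denom:
  assumes "R > 0" "norm (s - c) \<le> R" "norm (w - c) \<le> R"
  shows "norm (s - w) \<le> norm (blaschke_denom c R w s)"
proof -
  define z a where "z = s - c" and "a = w - c"
  have "(norm (of_real (R\<^sup>2) - cnj a * z))\<^sup>2 - (R * norm (z - a))\<^sup>2 = (R\<^sup>2 - (norm z)\<^sup>2) * (R\<^sup>2 - (norm a)\<^sup>2)"
    unfolding power_mult_distrib cmod_power2 by (simp add: algebra_simps power2_eq_square)
  also have "\<dots> \<ge> 0"
    using assms by (intro mult_nonneg_nonneg) (auto simp: z_def a_def intro!: power_mono)
  finally have "R * norm (z - a) \<le> norm (of_real (R\<^sup>2) - cnj a * z)"
    using power2_le_imp_le[of "R * norm (z - a)" "norm (of_real (R\<^sup>2) - cnj a * z)"] by simp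
  then have "norm (z - a) \<le> norm (blaschke_denom c R w s)"
    using assms(1) by (simp add: blaschke_denom_def norm_divide a_def z_def field_simps)
  then show ?thesis by (simp add: z_def a_def)
qed

lemma norm_blaschke_denom_ge:
  assumes "R > 0" "norm (w - c) \<le> r" "norm (s - c) \<le> r'"
  shows "norm (of_real (R\<^sup>2) - cnj (w - c) * (s - c)) \<ge> R\<^sup>2 - r * r'"
proof -
  have "norm (cnj (w - c) * (s - c)) \<le> r * r'"
    unfolding norm_mult complex_mod_cnj using assms order.trans[OF norm_ge_zero assms(2)] by (intro mult_mono) auto
  moreover have "norm (complex_of_real (R\<^sup>2)) = R\<^sup>2" by (simp only: norm_of_real) simp
  ultimately show ?thesis
    using norm_triangle_ineq2[of "complex_of_real (R\<^sup>2)" "cnj (w - c) * (s - c)"] by linarith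
qed

lemma blaschke_denom_nonzero:
  assumes "R > 0" "norm (w - c) < R" "norm (s - c) \<le> R"
  shows "blaschke_denom c R w s \<noteq> 0"
proof -
  have "norm (of_real (R\<^sup>2) - cnj (w - c) * (s - c)) \<ge> R\<^sup>2 - norm (w - c) * R"
    by (rule norm_blaschke_denom_ge) (use assms in auto)
  moreover have "norm (w - c) * R < R\<^sup>2" using assms by (simp add: power2_eq_square)
  ultimately show ?thesis using assms by (auto simp: blaschke_denom_def)
qed

text \<open>
  Replacing a factor \<open>s - w\<close> by the denominator of its Blaschke factor does not change moduli on the boundary
  circle, so the maximum principle carries the bound for \<open>F\<close> over to the quotient.
\<close>
lemma zero_free_quotient_bound:
  assumes R: "R > 0" and h: "h holomorphic_on A" "open A" "cball c R \<subseteq> A"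
    and W: "finite W" "W \<subseteq> ball c R"
    and F: "\<And>s. s \<in> A \<Longrightarrow> F s = h s * (\<Prod>w\<in>W. (s - w) ^ n w)"
    and M: "\<And>s. s \<in> cball c R \<Longrightarrow> norm (F s) \<le> M"
    and s: "s \<in> cball c R"
  shows "norm (h s * (\<Prod>w\<in>W. blaschke_denom c R w s ^ n w)) \<le> M"
    and "norm (F s) \<le> norm (h s * (\<Prod>w\<in>W. blaschke_denom c R w s ^ n w))"
proof -
  let ?f = "\<lambda>s. h s * (\<Prod>w\<in>W. blaschke_denom c R w s ^ n w)"
  have hc: "h holomorphic_on cball c R" using h by (auto intro: holomorphic_on_subset)
  show "norm (?f s) \<le> M"
  proof (rule maximum_modulus_frontier[of ?f "cball c R"])
    have holo: "?f holomorphic_on cball c R"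
      unfolding blaschke_denom_def using R by (intro holomorphic_intros hc) auto
    show "?f holomorphic_on interior (cball c R)"
      by (rule holomorphic_on_subset[OF holo interior_subset])
    show "continuous_on (closure (cball c R)) ?f"
      using holomorphic_on_imp_continuous_on[OF holo] by simp
    fix z assume "z \<in> frontier (cball c R)"
    then have z: "norm (z - c) = R" "z \<in> cball c R" using R by (auto simp: dist_norm norm_minus_commute frontier_cball)
    have "norm (?f z) = norm (F z)"
      using F[of z] z h by (auto simp: norm_mult norm_power prod_norm [symmetric] norm_blaschke_denom_sphere[OF R z(1)])
    then show "norm (?f z) \<le> M" using M z by simp
  qed (use s in auto)
  have "norm (s - w) ^ n w \<le> norm (blaschke_denom c R w s) ^ n w" if "w \<in> W" for w
    using that s W by (intro power_mono norm_diff_le_blaschke_denom R) (auto simp: dist_norm norm_minus_commute subset_iff less_imp_le)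
  then show "norm (F s) \<le> norm (?f s)"
    using F[of s] subsetD[OF h(3) s] by (auto simp: norm_mult norm_power prod_norm [symmetric] intro!: mult_left_mono prod_mono)
qed

text \<open>
  The function \<open>\<phi> / (2 L - \<phi>)\<close> maps the disc into the unit disc because \<open>\<phi>\<close> is closer to 0 than to \<open>2 L\<close>;
  apply the Schwarz lemma to it.
\<close>
lemma Borel_Caratheodory:
  assumes \<phi>: "\<phi> holomorphic_on ball c r" "\<phi> c = 0" and r: "0 < r'" "r' < r"
    and L: "\<And>z. z \<in> ball c r \<Longrightarrow> Re (\<phi> z) < L" and z: "z \<in> cball c r'"
  shows "norm (\<phi> z) \<le> 2 * L * r' / (r - r')"
proof -
  have L0: "L > 0" using L[of c] \<phi>(2) r by simp
  define \<psi> where "\<psi> = (\<lambda>x. \<phi> (c + of_real r * x) / (of_real (2 * L) - \<phi> (c + of_real r * x)))"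
  have in_ball: "c + of_real r * x \<in> ball c r" if "norm x < 1" for x :: complex
    using that r by (simp add: dist_norm norm_mult)
  have den: "of_real (2 * L) - \<phi> (c + of_real r * x) \<noteq> 0" if "norm x < 1" for x
  proof
    assume "of_real (2 * L) - \<phi> (c + of_real r * x) = 0"
    then have "Re (\<phi> (c + of_real r * x)) = 2 * L" by (metis Re_complex_of_real eq_iff_diff_eq_0)
    then show False using L[OF in_ball[OF that]] L0 by simp
  qed
  have lt: "norm (\<phi> y) < norm (of_real (2 * L) - \<phi> y)" if "y \<in> ball c r" for y
  proof -
    have "(Re (\<phi> y))\<^sup>2 < (2 * L - Re (\<phi> y))\<^sup>2"
      using L[OF that] L0 by (simp add: power2_eq_square algebra_simps)
    then show ?thesis unfolding cmod_def by simp
  qed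
  have "norm (\<psi> x) \<le> norm x" if "norm x < 1" for x
  proof (rule Schwarz_Lemma(1)[OF _ _ _ that])
    have "(\<phi> \<circ> (\<lambda>x. c + of_real r * x)) holomorphic_on ball 0 1"
      by (rule holomorphic_on_compose_gen[OF _ \<phi>(1)]) (auto intro!: holomorphic_intros simp: in_ball[unfolded mem_ball])
    then show "\<psi> holomorphic_on ball 0 1"
      unfolding \<psi>_def o_def using den by (intro holomorphic_intros) auto
    show "\<psi> 0 = 0" by (simp add: \<psi>_def \<phi>)
    show "norm (\<psi> x) < 1" if "norm x < 1" for x
      using lt[OF in_ball[OF that]] den[OF that] by (simp add: \<psi>_def norm_divide divide_simps)
  qed
  note sw = this
  define x where "x = (z - c) / of_real r"
  have x: "norm x \<le> r' / r" using z r by (simp add: x_def norm_divide divide_right_mono dist_norm norm_minus_commute)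
  have x1: "norm x < 1" using x r by (simp add: order.strict_trans1)
  have zx: "c + of_real r * x = z" using r by (simp add: x_def)
  have "norm (\<phi> z) \<le> norm x * norm (of_real (2 * L) - \<phi> z)"
    using sw[OF x1] den[OF x1] by (simp add: \<psi>_def zx norm_divide divide_simps)
  also have "\<dots> \<le> r' / r * (2 * L + norm (\<phi> z))"
    using x L0 r norm_triangle_ineq4[of "of_real (2 * L)" "\<phi> z"] by (intro mult_mono) auto
  finally have "norm (\<phi> z) * (r - r') \<le> 2 * L * r'" using r by (simp add: field_simps)
  then show ?thesis using r by (simp add: field_simps)
qed

text \<open>
  A zero-free function has a holomorphic logarithm.  The Borel--Caratheodory inequality bounds it on a
  smaller disc and Cauchy's inequality bounds its second derivative on a still smaller one.
\<close>
lemma log_deriv_Lipschitz_zero_free: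
  assumes f: "f holomorphic_on ball c r1" "\<And>z. z \<in> ball c r1 \<Longrightarrow> f z \<noteq> 0"
    and M: "\<And>z. z \<in> ball c r1 \<Longrightarrow> norm (f z) \<le> M" and m: "0 < m" "m \<le> norm (f c)"
    and r: "0 < r3" "r3 < r2" "r2 < r1"
    and s: "s1 \<in> ball c r3" "s2 \<in> ball c r3"
  shows "norm (deriv f s1 / f s1 - deriv f s2 / f s2) \<le>
     4 * r2 / ((r1 - r2) * (r2 - r3)\<^sup>2) * (ln (M / m) + 1) * norm (s1 - s2)"
proof -
  have "contractible (ball c r1)" by (simp add: convex_imp_contractible)
  from contractible_imp_holomorphic_log[OF f(1) this f(2)]
  obtain g where g: "g holomorphic_on ball c r1" "\<And>z. z \<in> ball c r1 \<Longrightarrow> f z = exp (g z)" by auto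
  define \<phi> where "\<phi> = (\<lambda>z. g z - g c)"
  define L where "L = ln (M / m) + 1"
  have \<phi>: "\<phi> holomorphic_on ball c r1" unfolding \<phi>_def by (intro holomorphic_intros g)
  have cb: "c \<in> ball c r1" using r by simp
  have Re_lt: "Re (\<phi> z) < L" if "z \<in> ball c r1" for z
  proof -
    have "exp (Re (g z)) \<le> M" using M[OF that] g(2)[OF that] by simp
    moreover have "m \<le> exp (Re (g c))" using m g(2)[OF cb] by simp
    ultimately have "Re (g z) \<le> ln M" "ln m \<le> Re (g c)" and M0: "M > 0"
      using m by (auto simp: ln_ge_iff ln_le_cancel_iff intro: less_le_trans[OF exp_gt_zero])
        (metis exp_gt_zero less_le_trans ln_exp ln_le_cancel_iff)+
    then show ?thesis using m by (simp add: \<phi>_def L_def ln_div)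
  qed
  define B where "B = 2 * L * r2 / (r1 - r2)"
  have bound: "norm (\<phi> z) \<le> B" if "z \<in> cball c r2" for z
    unfolding B_def by (rule Borel_Caratheodory[OF \<phi> _ _ _ Re_lt that]) (use r in \<open>auto simp: \<phi>_def\<close>)
  define D where "D = 2 * B / (r2 - r3)\<^sup>2"
  have sub: "cball z (r2 - r3) \<subseteq> cball c r2" if "z \<in> ball c r3" for z
  proof
    fix y assume "y \<in> cball z (r2 - r3)"
    then show "y \<in> cball c r2" using that dist_triangle[of c y z] by auto
  qed
  have sub': "cball c r2 \<subseteq> ball c r1" "ball c r3 \<subseteq> ball c r1" using r by auto
  have d2: "norm ((deriv ^^ 2) \<phi> z) \<le> D" if z: "z \<in> ball c r3" for z
  proof -
    have "norm ((deriv ^^ 2) \<phi> z) \<le> fact 2 * B / (r2 - r3) ^ 2"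
    proof (rule Cauchy_inequality)
      show "\<phi> holomorphic_on ball z (r2 - r3)"
        by (rule holomorphic_on_subset[OF \<phi>]) (use sub[OF z] sub' ball_subset_cball in blast)
      show "continuous_on (cball z (r2 - r3)) \<phi>"
        by (rule continuous_on_subset[OF holomorphic_on_imp_continuous_on[OF \<phi>]]) (use sub[OF z] sub' in blast)
      show "norm (\<phi> x) \<le> B" if "norm (z - x) = r2 - r3" for x
      proof (rule bound)
        have "x \<in> cball z (r2 - r3)" using that by (simp add: dist_norm)
        then show "x \<in> cball c r2" using sub[OF z] by blast
      qed
    qed (use r in auto)
    then show ?thesis by (simp add: D_def)
  qed
  have dd: "(deriv \<phi> has_field_derivative (deriv ^^ 2) \<phi> z) (at z within ball c r3)" if "z \<in> ball c r3" for z
  proof -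
    have "deriv \<phi> holomorphic_on ball c r1" by (rule holomorphic_deriv[OF \<phi>]) simp
    from holomorphic_derivI[OF this _ , of z] show ?thesis
      using that sub' by (auto simp: numeral_2_eq_2)
  qed
  have "norm (deriv \<phi> s1 - deriv \<phi> s2) \<le> D * norm (s1 - s2)"
    by (rule field_differentiable_bound[of "ball c r3" "deriv \<phi>" "(deriv ^^ 2) \<phi>"]) (use dd d2 s in auto)
  moreover have "deriv f z / f z = deriv \<phi> z" if z: "z \<in> ball c r3" for z
  proof -
    have z1: "z \<in> ball c r1" using z sub' by auto
    have dg: "(g has_field_derivative deriv g z) (at z)"
      by (rule holomorphic_derivI[OF g(1)]) (use z1 in auto)
    have "((\<lambda>z. exp (g z)) has_field_derivative exp (g z) * deriv g z) (at z)"
      by (rule DERIV_fun_exp[OF dg])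
    moreover have "eventually (\<lambda>w. exp (g w) = f w) (nhds z)"
      by (rule eventually_nhds_in_open[of "ball c r1", THEN eventually_mono]) (use z1 g(2) in auto)
    ultimately have "(f has_field_derivative exp (g z) * deriv g z) (at z)"
      by (subst (asm) DERIV_cong_ev[OF refl _ refl]) auto
    then have "deriv f z = f z * deriv g z" using g(2)[OF z1] by (simp add: DERIV_imp_deriv)
    moreover have "deriv \<phi> z = deriv g z"
      unfolding \<phi>_def by (rule DERIV_imp_deriv) (auto intro!: derivative_eq_intros dg)
    ultimately show ?thesis using f(2)[OF z1] by simp
  qed
  ultimately have "norm (deriv f s1 / f s1 - deriv f s2 / f s2) \<le> D * norm (s1 - s2)" using s by simp
  also have "D = 4 * r2 / ((r1 - r2) * (r2 - r3)\<^sup>2) * (ln (M / m) + 1)"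
    unfolding D_def B_def L_def by simp
  finally show ?thesis .
qed

lemma has_field_derivative_prod_power:
  fixes u :: "'b \<Rightarrow> complex \<Rightarrow> complex"
  assumes "finite W" "\<And>w. w \<in> W \<Longrightarrow> (u w has_field_derivative u' w) (at s)" "\<And>w. w \<in> W \<Longrightarrow> u w s \<noteq> 0"
  shows "((\<lambda>s. \<Prod>w\<in>W. u w s ^ n w) has_field_derivative
     (\<Prod>w\<in>W. u w s ^ n w) * (\<Sum>w\<in>W. of_nat (n w) * (u' w / u w s))) (at s)"
  using assms
proof (induction W rule: finite_induct)
  case (insert w W)
  have p: "((\<lambda>s. u w s ^ n w) has_field_derivative u w s ^ n w * (of_nat (n w) * (u' w / u w s))) (at s)"
  proof (cases "n w")
    case (Suc k)
    have "((\<lambda>s. u w s ^ n w) has_field_derivative of_nat (n w) * (u w s ^ (n w - 1) * u' w)) (at s)"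
      using DERIV_power[OF insert.prems(1)[of w], of "n w"] by (simp add: mult_ac)
    also have "of_nat (n w) * (u w s ^ (n w - 1) * u' w) = u w s ^ n w * (of_nat (n w) * (u' w / u w s))"
      using Suc insert.prems(2)[of w] by (simp add: field_simps)
    finally show ?thesis .
  qed simp
  have "((\<lambda>s. u w s ^ n w * (\<Prod>w\<in>W. u w s ^ n w)) has_field_derivative
     u w s ^ n w * (of_nat (n w) * (u' w / u w s)) * (\<Prod>w\<in>W. u w s ^ n w)
      + (\<Prod>w\<in>W. u w s ^ n w) * (\<Sum>w\<in>W. of_nat (n w) * (u' w / u w s)) * u w s ^ n w) (at s)"
    by (rule DERIV_mult[OF p insert.IH]) (use insert.prems in auto)
  then show ?case using insert.hyps by (simp add: algebra_simps)
qed simp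



lemma finite_zeros_in_compact:
  assumes "f holomorphic_on A" "open A" "connected A" "\<exists>z\<in>A. f z \<noteq> 0" "compact K" "K \<subseteq> A"
  shows "finite {z\<in>K. f z = 0}"
proof (cases "\<exists>z\<in>A. f z = 0")
  case True
  then have "\<not> f constant_on A" using assms(4) unfolding constant_on_def by metis
  then show ?thesis using holomorphic_compact_finite_zeros assms by blast
next
  case False
  then have "{z\<in>K. f z = 0} = {}" using assms(6) by auto
  then show ?thesis by (simp only: finite.emptyI)
qed

text \<open>
  Landau's setting: a bounded holomorphic function on a disc together with a finite set \<open>W\<close> of points, usually
  some of its zeros, that is to be divided out.
\<close>
locale disc_zeros =
  fixes F :: "complex \<Rightarrow> complex" and A :: "complex set" and c :: complex and R M :: real and W :: "complex set"
  assumes F: "F holomorphic_on A" "open A" "connected A" and cball: "cball c R \<subseteq> A" and R: "R > 0"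
    and M: "\<And>s. s \<in> cball c R \<Longrightarrow> norm (F s) \<le> M" and Fc: "F c \<noteq> 0"
    and W: "finite W" "W \<subseteq> ball c R"
begin

definition n :: "complex \<Rightarrow> nat" where "n w = nat (zorder F w)"

text \<open>
  The function that remains when the zeros in \<open>W\<close> are divided out by linear factors.
\<close>
definition h :: "complex \<Rightarrow> complex" where
  "h = (SOME h. h holomorphic_on A \<and> (\<forall>w\<in>W. h w \<noteq> 0) \<and>
           (\<forall>z\<in>A. F z = h z * (\<Prod>w\<in>W. (z - w) ^ nat (zorder F w))))"

text \<open>
  The function that remains when the zeros in \<open>W\<close> are divided out by Blaschke factors; it has no zero in \<open>W\<close>
  and obeys the same bound as \<open>F\<close>.
\<close>
definition f :: "complex \<Rightarrow> complex" where
  "f s = h s * (\<Prod>w\<in>W. blaschke_denom c R w s ^ n w)"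

lemma h: "h holomorphic_on A" "\<And>w. w \<in> W \<Longrightarrow> h w \<noteq> 0"
    "\<And>z. z \<in> A \<Longrightarrow> F z = h z * (\<Prod>w\<in>W. (z - w) ^ n w)"
proof -
  have "c \<in> A" using cball R by auto
  then have "\<exists>h. h holomorphic_on A \<and> (\<forall>w\<in>W. h w \<noteq> 0) \<and>
           (\<forall>z\<in>A. F z = h z * (\<Prod>w\<in>W. (z - w) ^ nat (zorder F w)))"
    using Fc W cball by (intro holomorphic_factor_zeros F) (auto simp: subset_iff intro: less_imp_le)
  from someI_ex[OF this, folded h_def]
  show "h holomorphic_on A" "\<And>w. w \<in> W \<Longrightarrow> h w \<noteq> 0"
    "\<And>z. z \<in> A \<Longrightarrow> F z = h z * (\<Prod>w\<in>W. (z - w) ^ n w)"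
    by (auto simp: n_def)
qed

lemma f_bounds:
  assumes "s \<in> cball c R"
  shows "norm (f s) \<le> M" "norm (F s) \<le> norm (f s)"
  unfolding f_def
  using zero_free_quotient_bound[OF R h(1) F(2) cball W h(3) M assms] by auto

lemma f_holomorphic: "f holomorphic_on A"
  unfolding f_def [abs_def] blaschke_denom_def using R by (intro holomorphic_intros h) auto

lemma f_nonzero:
  assumes "s \<in> cball c R" "F s \<noteq> 0 \<or> s \<in> W"
  shows "f s \<noteq> 0"
proof -
  have "h s \<noteq> 0" using h(2)[of s] h(3)[of s] assms cball by auto
  moreover have "blaschke_denom c R w s \<noteq> 0" if "w \<in> W" for w
    using that W R assms by (intro blaschke_denom_nonzero) (auto simp: dist_norm norm_minus_commute subset_iff)
  ultimately show ?thesis using W by (simp add: f_def)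
qed

text \<open>
  Jensen's inequality: at the centre each Blaschke factor has modulus at most \<open>r / R\<close>.
\<close>
lemma zero_count:
  assumes "0 < r" "r < R" "W \<subseteq> ball c r"
  shows "real (\<Sum>w\<in>W. n w) * ln (R / r) \<le> ln (M / norm (F c))"
proof -
  have cA: "c \<in> A" "c \<in> cball c R" using cball R by auto
  define N where "N = (\<Sum>w\<in>W. n w)"
  have "norm (F c) = norm (h c) * (\<Prod>w\<in>W. norm (c - w) ^ n w)"
    by (simp add: h(3)[OF cA(1)] norm_mult norm_power prod_norm [symmetric])
  also have "\<dots> \<le> norm (h c) * (\<Prod>w\<in>W. r ^ n w)"
    using assms by (intro mult_left_mono prod_mono conjI power_mono) (auto simp: dist_norm subset_iff less_imp_le)
  also have "(\<Prod>w\<in>W. r ^ n w) = r ^ N" by (simp add: power_sum N_def)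
  finally have 1: "norm (F c) \<le> norm (h c) * r ^ N" .
  have "norm (f c) = norm (h c) * R ^ N"
    using R by (simp add: f_def norm_mult norm_power prod_norm [symmetric] blaschke_denom_def power_sum N_def norm_divide power2_eq_square)
  then have 2: "norm (h c) * R ^ N \<le> M" using f_bounds(1)[OF cA(2)] by simp
  have "norm (F c) * (R / r) ^ N \<le> norm (h c) * r ^ N * (R / r) ^ N"
    using 1 assms by (intro mult_right_mono) auto
  also have "\<dots> = norm (h c) * R ^ N" using assms by (simp add: power_divide)
  finally have "norm (F c) * (R / r) ^ N \<le> M" using 2 by linarith
  then have "(R / r) ^ N \<le> M / norm (F c)" using Fc by (simp add: field_simps)
  then have "ln ((R / r) ^ N) \<le> ln (M / norm (F c))"
    using assms by (intro ln_mono) auto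
  then show ?thesis using assms by (simp add: ln_realpow N_def)
qed

lemma log_deriv_eq:
  assumes s: "s \<in> ball c R" "F s \<noteq> 0"
  shows "deriv F s / F s = deriv f s / f s
     + (\<Sum>w\<in>W. of_nat (n w) * (1 / (s - w) + cnj (w - c) / (of_real (R\<^sup>2) - cnj (w - c) * (s - c))))"
proof -
  have sA: "s \<in> A" "s \<in> cball c R" using s cball by auto
  define P where "P = (\<lambda>s. \<Prod>w\<in>W. (s - w) ^ n w)"
  define Q where "Q = (\<lambda>s. \<Prod>w\<in>W. blaschke_denom c R w s ^ n w)"
  have P_ev: "eventually (\<lambda>z. h z * P z = F z) (nhds s)"
    by (rule eventually_nhds_in_open[OF F(2) sA(1), THEN eventually_mono]) (simp add: h(3) P_def)
  have FP: "F s = h s * P s" using h(3)[OF sA(1)] by (simp add: P_def)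
  have nz: "h s \<noteq> 0" "P s \<noteq> 0" using FP s(2) by auto
  have bn: "blaschke_denom c R w s \<noteq> 0" if "w \<in> W" for w
    using that W R sA by (intro blaschke_denom_nonzero) (auto simp: dist_norm norm_minus_commute subset_iff)
  then have Qn: "Q s \<noteq> 0" using W by (simp add: Q_def)
  define SP where "SP = (\<Sum>w\<in>W. of_nat (n w) * (1 / (s - w)))"
  define SQ where "SQ = (\<Sum>w\<in>W. of_nat (n w) * ((- cnj (w - c) / of_real R) / blaschke_denom c R w s))"
  have dh: "(h has_field_derivative deriv h s) (at s)"
    by (rule holomorphic_derivI[OF h(1) F(2) sA(1)])
  define W' where "W' = {w \<in> W. n w \<noteq> 0}"
  have W': "finite W'" "W' \<subseteq> W" using W by (auto simp: W'_def)
  have P': "P z = (\<Prod>w\<in>W'. (z - w) ^ n w)" for z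
    unfolding P_def by (rule prod.mono_neutral_right) (use W in \<open>auto simp: W'_def\<close>)
  have SP': "SP = (\<Sum>w\<in>W'. of_nat (n w) * (1 / (s - w)))"
    unfolding SP_def by (rule sum.mono_neutral_right) (use W in \<open>auto simp: W'_def\<close>)
  have sW': "s - w \<noteq> 0" if "w \<in> W'" for w
    using that nz(2) W'(1) by (auto simp: P' W'_def)
  have dP: "(P has_field_derivative P s * SP) (at s)"
    unfolding P' [abs_def] SP' using sW'
    by (intro has_field_derivative_prod_power W') (auto intro!: derivative_eq_intros)
  have dQ: "(Q has_field_derivative Q s * SQ) (at s)"
    unfolding Q_def SQ_def
  proof (rule has_field_derivative_prod_power[where u = "blaschke_denom c R" and u' = "\<lambda>w. - cnj (w - c) / of_real R", OF W(1) _ bn])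
    show "(blaschke_denom c R w has_field_derivative - cnj (w - c) / of_real R) (at s)" for w
      unfolding blaschke_denom_def [abs_def] using R by (auto intro!: derivative_eq_intros)
  qed
  have "((\<lambda>z. h z * P z) has_field_derivative deriv h s * P s + P s * SP * h s) (at s)"
    by (rule DERIV_mult[OF dh dP])
  then have "(F has_field_derivative deriv h s * P s + P s * SP * h s) (at s)"
    using P_ev by (subst (asm) DERIV_cong_ev[OF refl _ refl]) auto
  then have "deriv F s = deriv h s * P s + P s * SP * h s" by (rule DERIV_imp_deriv)
  then have 1: "deriv F s / F s = deriv h s / h s + SP"
    unfolding FP using nz by (simp add: field_simps)
  have "(f has_field_derivative deriv h s * Q s + Q s * SQ * h s) (at s)"
    using DERIV_mult[OF dh dQ] by (simp add: f_def [abs_def] Q_def)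
  then have "deriv f s = deriv h s * Q s + Q s * SQ * h s" by (rule DERIV_imp_deriv)
  moreover have "f s = h s * Q s" by (simp add: f_def Q_def)
  ultimately have 2: "deriv f s / f s = deriv h s / h s + SQ"
    using nz Qn by (simp add: field_simps)
  have "SP - SQ = (\<Sum>w\<in>W. of_nat (n w) * (1 / (s - w) + cnj (w - c) / (of_real (R\<^sup>2) - cnj (w - c) * (s - c))))"
    unfolding SP_def SQ_def sum_subtractf [symmetric] right_diff_distrib [symmetric]
    using R by (intro sum.cong refl) (simp add: blaschke_denom_def del: complex_cnj_diff)
  then show ?thesis using 1 2 by (simp add: algebra_simps)
qed

text \<open>
  Landau's local formula for the logarithmic derivative, in the form of a difference along a horizontal
  segment.  At points of the same height the poles \<open>1 / (s - w)\<close> differ by at most the distance of the points over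
  the square of the vertical distance to \<open>w\<close>; everything else is smooth.
\<close>
lemma log_deriv_difference:
  assumes r: "0 < r3" "r3 < r2" "r2 < r1" "r1 < R"
    and W_eq: "W = {w \<in> ball c r1. F w = 0}"
    and s: "s1 \<in> ball c r3" "s2 \<in> ball c r3" "Im s1 = t" "Im s2 = t" "F s1 \<noteq> 0" "F s2 \<noteq> 0"
    and Im_W: "\<And>w. w \<in> W \<Longrightarrow> Im w \<noteq> t"
  shows "norm (deriv F s1 / F s1 - deriv F s2 / F s2) \<le>
     norm (s1 - s2) * ((\<Sum>w\<in>W. real (n w) / (Im w - t)\<^sup>2)
       + (4 * r2 / ((r1 - r2) * (r2 - r3)\<^sup>2) * (ln (M / norm (F c)) + 1)
       + (r1 / (R\<^sup>2 - r1 * r3))\<^sup>2 * real (\<Sum>w\<in>W. n w)))"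
proof -
  let ?S = "\<Sum>w\<in>W. real (n w) / (Im w - t)\<^sup>2"
  let ?A = "4 * r2 / ((r1 - r2) * (r2 - r3)\<^sup>2) * (ln (M / norm (F c)) + 1)"
  have sR: "s1 \<in> ball c R" "s2 \<in> ball c R" using s r by auto
  define q where "q w s = cnj (w - c) / (of_real (R\<^sup>2) - cnj (w - c) * (s - c))" for w s
  define d where "d = R\<^sup>2 - r1 * r3"
  have "r1 * r3 < R * R" using r by (intro mult_strict_mono) auto
  then have d: "d > 0" by (simp add: d_def power2_eq_square)
  have ball_sub: "ball c r1 \<subseteq> cball c R" "ball c r1 \<subseteq> A" using r cball by auto
  have f_part: "norm (deriv f s1 / f s1 - deriv f s2 / f s2)
      \<le> ?A * norm (s1 - s2)"
  proof (rule log_deriv_Lipschitz_zero_free)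
    show "f holomorphic_on ball c r1" by (rule holomorphic_on_subset[OF f_holomorphic ball_sub(2)])
    show "f z \<noteq> 0" if "z \<in> ball c r1" for z
      using that ball_sub by (intro f_nonzero) (auto simp: W_eq)
    show "norm (f z) \<le> M" if "z \<in> ball c r1" for z using that ball_sub by (intro f_bounds) auto
    show "norm (F c) \<le> norm (f c)" using R by (intro f_bounds) auto
  qed (use r s Fc in auto)
  have pole: "norm (1 / (s1 - w) - 1 / (s2 - w)) \<le> norm (s1 - s2) * (1 / (Im w - t)\<^sup>2)" if w: "w \<in> W" for w
  proof -
    define y where "y = \<bar>Im w - t\<bar>"
    have y: "y > 0" using Im_W[OF w] by (simp add: y_def)
    have n1: "norm (s1 - w) \<ge> y" "norm (s2 - w) \<ge> y"
      using abs_Im_le_cmod[of "s1 - w"] abs_Im_le_cmod[of "s2 - w"] s by (auto simp: y_def abs_minus_commute)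
    then have nz: "s1 - w \<noteq> 0" "s2 - w \<noteq> 0" using y by auto
    have "1 / (s1 - w) - 1 / (s2 - w) = (s2 - s1) / ((s1 - w) * (s2 - w))" using nz by (simp add: field_simps)
    then have "norm (1 / (s1 - w) - 1 / (s2 - w)) = norm (s1 - s2) / (norm (s1 - w) * norm (s2 - w))"
      by (simp add: norm_divide norm_mult norm_minus_commute)
    also have "\<dots> \<le> norm (s1 - s2) / (y * y)"
      using n1 y by (intro divide_left_mono mult_mono mult_pos_pos) auto
    finally show ?thesis by (simp add: y_def power2_eq_square)
  qed
  have smooth: "norm (q w s1 - q w s2) \<le> norm (s1 - s2) * (r1 / d)\<^sup>2" if w: "w \<in> W" for w
  proof -
    define a where "a = cnj (w - c)"
    define d1 d2 where "d1 = of_real (R\<^sup>2) - a * (s1 - c)" and "d2 = of_real (R\<^sup>2) - a * (s2 - c)"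
    have wr: "norm (w - c) \<le> r1" using w by (auto simp: W_eq dist_norm norm_minus_commute)
    have "norm (s1 - c) \<le> r3" "norm (s2 - c) \<le> r3"
      using s by (auto simp: dist_norm norm_minus_commute)
    then have n: "norm d1 \<ge> d" "norm d2 \<ge> d" unfolding d1_def d2_def a_def d_def
      by - (rule norm_blaschke_denom_ge[OF R wr], assumption)+
    then have nz: "d1 \<noteq> 0" "d2 \<noteq> 0" using d by auto
    have "q w s1 - q w s2 = a / d1 - a / d2" by (simp add: q_def d1_def d2_def a_def)
    also have "\<dots> = a * (d2 - d1) / (d1 * d2)" using nz by (simp add: field_simps)
    also have "d2 - d1 = a * (s1 - s2)" by (simp add: d1_def d2_def algebra_simps)
    finally have "norm (q w s1 - q w s2) = norm a * (norm a * norm (s1 - s2)) / (norm d1 * norm d2)"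
      by (simp add: norm_divide norm_mult)
    also have "\<dots> \<le> r1 * (r1 * norm (s1 - s2)) / (d * d)"
      using n d wr r by (intro frac_le mult_mono mult_pos_pos mult_nonneg_nonneg) (auto simp: a_def simp del: complex_cnj_diff)
    finally show ?thesis by (simp add: power2_eq_square mult_ac)
  qed
  have eq: "deriv F s1 / F s1 - deriv F s2 / F s2 = (deriv f s1 / f s1 - deriv f s2 / f s2)
     + (\<Sum>w\<in>W. of_nat (n w) * ((1 / (s1 - w) - 1 / (s2 - w)) + (q w s1 - q w s2)))"
  proof -
    have e: "deriv F s / F s = deriv f s / f s + (\<Sum>w\<in>W. of_nat (n w) * (1 / (s - w) + q w s))"
      if "s \<in> ball c R" "F s \<noteq> 0" for s
      unfolding q_def by (rule log_deriv_eq[OF that])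
    have "(\<Sum>w\<in>W. of_nat (n w) * (1 / (s1 - w) + q w s1)) - (\<Sum>w\<in>W. of_nat (n w) * (1 / (s2 - w) + q w s2))
        = (\<Sum>w\<in>W. of_nat (n w) * (1 / (s1 - w) + q w s1) - of_nat (n w) * (1 / (s2 - w) + q w s2))"
      by (rule sum_subtractf [symmetric])
    also have "\<dots> = (\<Sum>w\<in>W. of_nat (n w) * ((1 / (s1 - w) - 1 / (s2 - w)) + (q w s1 - q w s2)))"
    proof (rule sum.cong[OF refl])
      have gen: "k * (a + b) - k * (a' + b') = k * ((a - a') + (b - b'))" for k a b a' b' :: complex
        by (simp add: algebra_simps)
      show "of_nat (n w) * (1 / (s1 - w) + q w s1) - of_nat (n w) * (1 / (s2 - w) + q w s2)
          = of_nat (n w) * ((1 / (s1 - w) - 1 / (s2 - w)) + (q w s1 - q w s2))" for w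
        by (rule gen)
    qed
    finally show ?thesis
      unfolding e[OF sR(1) s(5)] e[OF sR(2) s(6)] by (simp only: add_diff_add)
  qed
  have "norm (deriv F s1 / F s1 - deriv F s2 / F s2) \<le> norm (deriv f s1 / f s1 - deriv f s2 / f s2)
     + (\<Sum>w\<in>W. real (n w) * (norm (1 / (s1 - w) - 1 / (s2 - w)) + norm (q w s1 - q w s2)))"
    unfolding eq
  proof (rule norm_triangle_le, rule add_left_mono, rule sum_norm_le)
    show "norm (of_nat (n w) * ((1 / (s1 - w) - 1 / (s2 - w)) + (q w s1 - q w s2)))
       \<le> real (n w) * (norm (1 / (s1 - w) - 1 / (s2 - w)) + norm (q w s1 - q w s2))" for w
      unfolding norm_mult norm_of_nat by (rule mult_left_mono[OF norm_triangle_ineq]) simp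
  qed
  also have "\<dots> \<le> ?A * norm (s1 - s2)
     + (\<Sum>w\<in>W. real (n w) * (norm (s1 - s2) * (1 / (Im w - t)\<^sup>2) + norm (s1 - s2) * (r1 / d)\<^sup>2))"
  proof (rule add_mono[OF f_part sum_mono])
    fix w assume w: "w \<in> W"
    show "real (n w) * (norm (1 / (s1 - w) - 1 / (s2 - w)) + norm (q w s1 - q w s2))
       \<le> real (n w) * (norm (s1 - s2) * (1 / (Im w - t)\<^sup>2) + norm (s1 - s2) * (r1 / d)\<^sup>2)"
      by (rule mult_left_mono[OF add_mono[OF pole[OF w] smooth[OF w]]]) simp
  qed
  also have "(\<Sum>w\<in>W. real (n w) * (norm (s1 - s2) * (1 / (Im w - t)\<^sup>2) + norm (s1 - s2) * (r1 / d)\<^sup>2))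
     = norm (s1 - s2) * (?S + (r1 / d)\<^sup>2 * real (\<Sum>w\<in>W. n w))"
    unfolding distrib_left sum.distrib of_nat_sum sum_distrib_left
    by (intro arg_cong2[of _ _ _ _ "(+)"] sum.cong refl) (simp_all only: times_divide_eq_right mult_1_right mult.commute mult.left_commute)
  finally have "norm (deriv F s1 / F s1 - deriv F s2 / F s2)
     \<le> ?A * norm (s1 - s2)
       + norm (s1 - s2) * (?S + (r1 / d)\<^sup>2 * real (\<Sum>w\<in>W. n w))" .
  also have "\<dots> = norm (s1 - s2) * (?S
       + (?A + (r1 / d)\<^sup>2 * real (\<Sum>w\<in>W. n w)))"
  proof -
    have gen: "x * N + N * (y + z) = N * (y + (x + z))" for x y z N :: real by (simp add: algebra_simps)
    show ?thesis by (rule gen)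
  qed
  finally show ?thesis unfolding d_def .
qed

end

section \<open>Zeros of the zeta-function near a given height\<close>

text \<open>
  The multiplicity of a zero as a natural number, for use as an exponent and as a weight.
\<close>
definition zmult :: "complex \<Rightarrow> nat" where "zmult w = nat (zorder zeta w)"

lemma open_connected_minus_1: "open (- {1::complex})" "connected (- {1::complex})"
  by (auto intro: connected_punctured_universe)

lemma zeta_nonzero_somewhere: "\<exists>z\<in>- {1}. zeta z \<noteq> 0"
  by (rule bexI[of _ 2]) (auto simp: zeta_nonzero_right)

lemma finite_zeta_zeros: "compact K \<Longrightarrow> 1 \<notin> K \<Longrightarrow> finite {z\<in>K. zeta z = 0}"
  by (rule finite_zeros_in_compact[OF holomorphic_zeta open_connected_minus_1 zeta_nonzero_somewhere]) auto

lemma zeta_bounds_right: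
  obtains c C where "0 < c" "c \<le> 1" "C \<ge> 1" "\<And>s. Re s \<ge> 3/2 \<Longrightarrow> c \<le> norm (zeta s) \<and> norm (zeta s) \<le> C"
proof -
  obtain c where c: "c > 0" "\<And>s. Re s \<ge> 3/2 \<Longrightarrow> norm (zeta s) \<ge> c" using zeta_lower_bound[of "3/2"] by auto
  obtain C where C: "C > 0" "\<And>s. Re s \<ge> 3/2 \<Longrightarrow> norm (zeta s) \<le> C" using zeta_upper_bound_right[of "3/2"] by auto
  show ?thesis
    by (rule that[of "min c 1" "max C 1"]) (use c C in \<open>auto simp: min_le_iff_disj le_max_iff_disj\<close>)
qed

lemma one_notin_cball: "T \<ge> 10 \<Longrightarrow> 1 \<notin> cball (Complex 2 T) (27 / 10)"
  using abs_Im_le_cmod[of "Complex 2 T - 1"] by (auto simp: dist_norm)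

text \<open>
  The disc avoids the real axis and reaches to the left only as far as \<open>Re w = -7/10\<close>.
\<close>
lemma zeta_zeros_near_height:
  assumes "T \<ge> 10" "w \<in> cball (Complex 2 T) (27 / 10)" "zeta w = 0"
  shows "w \<in> nontrivial_zeros" "Im w > 0"
proof -
  have "\<bar>T - Im w\<bar> \<le> 27 / 10" "\<bar>2 - Re w\<bar> \<le> 27 / 10"
    using assms(2) abs_Im_le_cmod[of "Complex 2 T - w"] abs_Re_le_cmod[of "Complex 2 T - w"] by (auto simp: dist_norm)
  then have "Im w > 0" "Re w > -1" using assms(1) by linarith+
  then show "w \<in> nontrivial_zeros" "Im w > 0" using assms(3) by (auto intro!: zeta_zeros_nontrivial)
qed

text \<open>
  The radius \<open>12/5\<close> exceeds \<open>sqrt 5\<close>, so the disc contains all non-trivial zeros within vertical distance 1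
  of \<open>T\<close>; it is smaller than the radius \<open>27/10\<close> of the discs in which the growth of the zeta-function is known.
\<close>
definition zeros_in_disc :: "real \<Rightarrow> complex set" where
  "zeros_in_disc T = {w \<in> ball (Complex 2 T) (12/5). zeta w = 0}"

text \<open>
  The disc of radius \<open>9/5\<close> contains the segment \<open>1/4 \<le> Re s \<le> 3/4\<close> at height \<open>T\<close>, on which the
  logarithmic derivative is compared with its value on the critical line.
\<close>
definition log_deriv_controlled :: "real \<Rightarrow> real \<Rightarrow> bool" where
  "log_deriv_controlled C T \<longleftrightarrow>
     finite (zeros_in_disc T) \<and> real (\<Sum>w\<in>zeros_in_disc T. zmult w) \<le> C * ln T \<and>
     (\<forall>s1 s2. {s1, s2} \<subseteq> ball (Complex 2 T) (9/5) \<and> Im s1 = T \<and> Im s2 = T \<and> zeta s1 \<noteq> 0 \<and> zeta s2 \<noteq> 0 \<and>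
        (\<forall>w\<in>nontrivial_zeros. Im w \<noteq> T) \<longrightarrow>
        norm (deriv zeta s1 / zeta s1 - deriv zeta s2 / zeta s2) \<le>
        norm (s1 - s2) * ((\<Sum>w\<in>zeros_in_disc T. real (zmult w) / (Im w - T)\<^sup>2) + C * ln T))"

text \<open>
  The bound \<open>T ^ 4\<close> on the disc and the lower bound for the zeta-function at the centre \<open>2 + \<i>T\<close> make the logarithm
  of their quotient \<open>O(ln T)\<close>, which is the size of all error terms in Landau's formula.
\<close>
lemma zeta_local_log_deriv:
  obtains C T0 where "C > 0" "T0 \<ge> 10" "\<And>T. T \<ge> T0 \<Longrightarrow> log_deriv_controlled C T"
proof -
  let ?a = "4 * 2 / ((12/5 - 2) * (2 - 9/5)\<^sup>2) :: real"
  let ?b = "(12/5 / ((27/10)\<^sup>2 - 12/5 * (9/5)))\<^sup>2 :: real"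
  obtain c C where c: "0 < c" "c \<le> 1" "\<And>s. Re s \<ge> 3/2 \<Longrightarrow> c \<le> norm (zeta s) \<and> norm (zeta s) \<le> C"
    using zeta_bounds_right by metis
  obtain T1 where T1: "T1 \<ge> 10" "\<And>T s. T \<ge> T1 \<Longrightarrow> s \<in> cball (Complex 2 T) (27 / 10) \<Longrightarrow> norm (zeta s) \<le> T ^ 4"
    using zeta_growth by blast
  define T0 where "T0 = max T1 (max (1 / c) (exp 1))"
  \<comment> \<open>The zero count divides by \<open>ln ((27/10) / (12/5))\<close>, and the logarithm of the bound over the central value is at most \<open>5 * ln T\<close>.\<close>
  define K where "K = 5 / ln (9/8::real)"
  define C1 where "C1 = ?a * 6 + ?b * K"
  define C2 where "C2 = max K C1"
  have K: "K > 0" by (simp add: K_def)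
  have C2: "C2 > 0" "K \<le> C2" "C1 \<le> C2" using K by (auto simp: C2_def)
  have T0: "T0 \<ge> T1" "T0 \<ge> 10" using T1 by (auto simp: T0_def)
  have "log_deriv_controlled C2 T" if T: "T \<ge> T0" for T
  proof -
    define W where "W = {w \<in> ball (Complex 2 T) (12/5). zeta w = 0}"
    have T10: "T \<ge> 10" using T T0 by simp
    have n1: "1 \<notin> cball (Complex 2 T) (27 / 10)" by (rule one_notin_cball[OF T10])
    have finW: "finite W"
      by (rule finite_subset[OF _ finite_zeta_zeros[of "cball (Complex 2 T) (27/10)"]]) (use n1 in \<open>auto simp: W_def\<close>)
    have zc: "c \<le> norm (zeta (Complex 2 T))" using c(3)[of "Complex 2 T"] by simp
    interpret D: disc_zeros zeta "- {1}" "Complex 2 T" "27/10" "T ^ 4" W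
    proof
      show "norm (zeta s) \<le> T ^ 4" if "s \<in> cball (Complex 2 T) (27 / 10)" for s using T1(2)[OF _ that] T T0 by simp
      show "zeta (Complex 2 T) \<noteq> 0" by (rule zeta_nonzero_right) simp
    qed (use n1 finW open_connected_minus_1 holomorphic_zeta in \<open>auto simp: W_def\<close>)
    have Dn: "D.n w = zmult w" for w by (simp add: D.n_def zmult_def)
    have lnT: "ln T \<ge> 1"
    proof -
      have "exp 1 \<le> T" using T by (simp add: T0_def)
      then have "ln (exp 1) \<le> ln T" by (intro ln_mono) auto
      then show ?thesis by simp
    qed
    have logM: "ln (T ^ 4 / norm (zeta (Complex 2 T))) \<le> 5 * ln T"
    proof -
      have "1 / c \<le> T" using T by (simp add: T0_def)
      then have cT: "1 \<le> T * c" using c by (simp add: field_simps)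
      have "T ^ 4 \<le> T ^ 4 * (T * c)" using cT by (simp add: mult_le_cancel_left1)
      also have "\<dots> = T ^ 5 * c" by (simp add: eval_nat_numeral)
      also have "\<dots> \<le> T ^ 5 * norm (zeta (Complex 2 T))" using zc T10 by (intro mult_left_mono) auto
      finally have "T ^ 4 \<le> T ^ 5 * norm (zeta (Complex 2 T))" .
      moreover have zp: "norm (zeta (Complex 2 T)) > 0" using zc c(1) by linarith
      ultimately have "T ^ 4 / norm (zeta (Complex 2 T)) \<le> T ^ 5" by (simp only: divide_le_eq if_True)
      then have "ln (T ^ 4 / norm (zeta (Complex 2 T))) \<le> ln (T ^ 5)"
        using T10 zp by (intro ln_mono divide_pos_pos) auto
      also have "\<dots> = 5 * ln T" using T10 by (simp add: ln_realpow)
      finally show ?thesis .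
    qed
    have count: "real (\<Sum>w\<in>W. zmult w) \<le> K * ln T"
    proof -
      have "real (\<Sum>w\<in>W. zmult w) * ln ((27/10) / (12/5)) \<le> ln (T ^ 4 / norm (zeta (Complex 2 T)))"
        unfolding Dn [symmetric] by (rule D.zero_count) (auto simp: W_def)
      also have "\<dots> \<le> 5 * ln T" by (rule logM)
      finally show ?thesis by (simp add: K_def field_simps)
    qed
    have diff: "norm (deriv zeta s1 / zeta s1 - deriv zeta s2 / zeta s2) \<le>
        norm (s1 - s2) * ((\<Sum>w\<in>W. real (zmult w) / (Im w - T)\<^sup>2) + C1 * ln T)"
      if s: "s1 \<in> ball (Complex 2 T) (9/5)" "s2 \<in> ball (Complex 2 T) (9/5)" "Im s1 = T" "Im s2 = T" "zeta s1 \<noteq> 0" "zeta s2 \<noteq> 0"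
        and ImW: "\<And>w. w \<in> nontrivial_zeros \<Longrightarrow> Im w \<noteq> T" for s1 s2
    proof -
      have "norm (deriv zeta s1 / zeta s1 - deriv zeta s2 / zeta s2) \<le>
         norm (s1 - s2) * ((\<Sum>w\<in>W. real (D.n w) / (Im w - T)\<^sup>2)
         + (?a * (ln (T ^ 4 / norm (zeta (Complex 2 T))) + 1)
         + ?b * real (\<Sum>w\<in>W. D.n w)))"
      proof (rule D.log_deriv_difference)
        show "W = {w \<in> ball (Complex 2 T) (12/5). zeta w = 0}" by (simp add: W_def)
        show "Im w \<noteq> T" if "w \<in> W" for w
          using that zeta_zeros_near_height[OF T10, of w] by (intro ImW) (auto simp: W_def)
      qed (use s in auto)
      also have "\<dots> \<le> norm (s1 - s2) * ((\<Sum>w\<in>W. real (zmult w) / (Im w - T)\<^sup>2) + C1 * ln T)"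
      proof (rule mult_left_mono)
        have "?a * (ln (T ^ 4 / norm (zeta (Complex 2 T))) + 1)
            \<le> ?a * (6 * ln T)"
          using logM lnT by (intro mult_left_mono) (auto simp: power2_eq_square)
        moreover have "?b * real (\<Sum>w\<in>W. D.n w) \<le> ?b * (K * ln T)"
          using count unfolding Dn by (intro mult_left_mono) (auto simp: power2_eq_square)
        moreover have "C1 * ln T = ?a * (6 * ln T) + ?b * (K * ln T)"
          by (simp only: C1_def distrib_right mult.assoc)
        ultimately show "(\<Sum>w\<in>W. real (D.n w) / (Im w - T)\<^sup>2)
         + (?a * (ln (T ^ 4 / norm (zeta (Complex 2 T))) + 1)
         + ?b * real (\<Sum>w\<in>W. D.n w)) \<le> (\<Sum>w\<in>W. real (zmult w) / (Im w - T)\<^sup>2) + C1 * ln T"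
          unfolding Dn by linarith
      qed simp
      finally show ?thesis .
    qed
    have "K * ln T \<le> C2 * ln T" "C1 * ln T \<le> C2 * ln T"
      using lnT C2 by (auto intro!: mult_right_mono)
    then show ?thesis
      unfolding log_deriv_controlled_def zeros_in_disc_def W_def [symmetric]
      using finW count by (auto intro!: order.trans[OF diff] mult_left_mono)
  qed
  then show ?thesis using that[of C2 T0] C2(1) T0(2) by blast
qed

definition zeros_near :: "real \<Rightarrow> complex set" where
  "zeros_near T = {w \<in> nontrivial_zeros. \<bar>Im w - T\<bar> \<le> 1}"

lemma zeros_near_ball:
  assumes "w \<in> zeros_near T"
  shows "w \<in> ball (Complex 2 T) (12/5)" "zeta w = 0"
proof -
  have w: "0 \<le> Re w" "Re w \<le> 1" "\<bar>Im w - T\<bar> \<le> 1" "zeta w = 0"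
    using assms by (auto simp: zeros_near_def nontrivial_zeros_def)
  have "(norm (Complex 2 T - w))\<^sup>2 = (2 - Re w)\<^sup>2 + (Im w - T)\<^sup>2"
    unfolding cmod_power2 by (simp add: power2_eq_square algebra_simps)
  also have "\<dots> \<le> 2\<^sup>2 + 1\<^sup>2"
  proof (rule add_mono)
    show "(2 - Re w)\<^sup>2 \<le> 2\<^sup>2" using w by (intro power_mono) auto
    show "(Im w - T)\<^sup>2 \<le> 1\<^sup>2" using w power_mono[of "\<bar>Im w - T\<bar>" 1 2] by simp
  qed
  also have "\<dots> < (12/5)\<^sup>2" by (simp add: power2_eq_square)
  finally have "norm (Complex 2 T - w) < 12/5"
    by (rule power_less_imp_less_base) simp
  then show "w \<in> ball (Complex 2 T) (12/5)" by (simp add: dist_norm)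
  show "zeta w = 0" by fact
qed

lemma finite_zeros_near:
  assumes "T \<ge> 10"
  shows "finite (zeros_near T)"
proof (rule finite_subset)
  show "zeros_near T \<subseteq> {z \<in> cball (Complex 2 T) (27/10). zeta z = 0}"
    using zeros_near_ball[of _ T] by force
  show "finite {z \<in> cball (Complex 2 T) (27/10). zeta z = 0}"
    by (rule finite_zeta_zeros) (use one_notin_cball[OF assms] in auto)
qed

text \<open>
  Suppose that the windows at heights \<open>T k\<close> contain \<open>o(ln (T k))\<close> zeros.  Divide these zeros out; what remains, \<open>f k\<close>,
  has no zero in the part \<open>\<bar>Im z\<bar> < 1\<close> of the disc around \<open>2 + \<i> T k\<close>, so that it has a holomorphic power
  \<open>G k\<close> with exponent \<open>1 / ln (T k)\<close>.  These powers are bounded by \<open>exp 4\<close>, and by Montel's theorem a subsequence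
  converges to some \<open>H\<close>.  Near the centre the modulus of \<open>f k\<close> is \<open>exp (o(ln (T k)))\<close>, hence \<open>H\<close> has modulus 1
  there and is constant by the maximum principle.  But at \<open>-1/2 + \<i> T k\<close> the zeta-function, and therefore \<open>f k\<close>, is at
  least of order \<open>T k\<close>, which forces the modulus of \<open>H\<close> to exceed 1 at this point.
\<close>
lemma zeta_zeros_near_many:
  obtains c T0 where "c > 0" "T0 \<ge> 10"
    "\<And>T. T \<ge> T0 \<Longrightarrow> c * ln T \<le> real (\<Sum>w\<in>zeros_near T. zmult w)"
proof -
  have "\<exists>c>0. \<exists>T0\<ge>10. \<forall>T\<ge>T0. c * ln T \<le> real (\<Sum>w\<in>zeros_near T. zmult w)"
  proof (rule ccontr)
    assume contra: "\<not> (\<exists>c>0. \<exists>T0\<ge>10. \<forall>T\<ge>T0. c * ln T \<le> real (\<Sum>w\<in>zeros_near T. zmult w))"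
    obtain c C where c: "0 < c" "c \<le> 1" "C \<ge> 1" "\<And>s. Re s \<ge> 3/2 \<Longrightarrow> c \<le> norm (zeta s) \<and> norm (zeta s) \<le> C"
      using zeta_bounds_right by metis
    obtain c' where c': "c' > 0" "\<And>T. T \<ge> 1 \<Longrightarrow> norm (zeta (Complex (-1/2) T)) \<ge> c' * T"
      using zeta_left_lower_bound by blast
    obtain T1 where T1: "T1 \<ge> 10" "\<And>T s. T \<ge> T1 \<Longrightarrow> s \<in> cball (Complex 2 T) (27 / 10) \<Longrightarrow> norm (zeta s) \<le> T ^ 4"
      using zeta_growth by blast
    have "\<exists>T. T \<ge> T1 + real k \<and> real (\<Sum>w\<in>zeros_near T. zmult w) < 1 / real (Suc k) * ln T" for k
    proof (rule ccontr)
      assume "\<not> ?thesis"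
      then have "\<forall>T\<ge>T1 + real k. 1 / real (Suc k) * ln T \<le> real (\<Sum>w\<in>zeros_near T. zmult w)"
        using not_less by blast
      moreover have "T1 + real k \<ge> 10" "1 / real (Suc k) > 0" using T1 by auto
      ultimately show False using contra by blast
    qed
    then obtain T where T: "\<And>k. T k \<ge> T1 + real k"
      and few: "\<And>k. real (\<Sum>w\<in>zeros_near (T k). zmult w) < 1 / real (Suc k) * ln (T k)"
      by metis
    define N where "N = (\<lambda>k. \<Sum>w\<in>zeros_near (T k). zmult w)"
    have T10: "T k \<ge> 10" "T k \<ge> T1" for k using T[of k] T1 by auto
    have lnT: "ln (T k) > 0" for k using T10(1)[of k] by simp
    define R where "R = (27/10 :: real)"
    define cc where "cc = (\<lambda>k. Complex 2 (T k))"
    have D: "disc_zeros zeta (- {1}) (cc k) R (T k ^ 4) (zeros_near (T k))" for k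
    proof
      show "cball (cc k) R \<subseteq> - {1}" using one_notin_cball[OF T10(1)] by (auto simp: cc_def R_def)
      show "zeros_near (T k) \<subseteq> ball (cc k) R" using zeros_near_ball(1)[of _ "T k"] by (force simp: cc_def R_def)
      show "norm (zeta s) \<le> T k ^ 4" if "s \<in> cball (cc k) R" for s
        using T1(2)[OF T10(2)[of k]] that by (simp add: cc_def R_def)
      show "zeta (cc k) \<noteq> 0" by (rule zeta_nonzero_right) (simp add: cc_def)
    qed (use holomorphic_zeta open_connected_minus_1 finite_zeros_near[OF T10(1)] in \<open>auto simp: R_def\<close>)
    define f where "f = (\<lambda>k z. disc_zeros.f zeta (- {1}) (cc k) R (zeros_near (T k)) (cc k + z))"
    define \<Omega> where "\<Omega> = {z. \<bar>Im z\<bar> < 1} \<inter> ball 0 R"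
    have strip: "{z. \<bar>Im z\<bar> < 1} = {z. Im z < 1} \<inter> {z. Im z > -1}" by auto
    have \<Omega>: "open \<Omega>" "convex \<Omega>"
      unfolding \<Omega>_def strip
      by (intro open_Int open_halfspace_Im_lt open_halfspace_Im_gt open_ball
                convex_Int convex_halfspace_Im_lt convex_halfspace_Im_gt convex_ball)+
    have \<Omega>_R: "cc k + z \<in> cball (cc k) R" if "z \<in> \<Omega>" for k z
      using that by (auto simp: \<Omega>_def dist_norm)
    have f_le: "norm (f k z) \<le> T k ^ 4" "norm (zeta (cc k + z)) \<le> norm (f k z)" if "z \<in> \<Omega>" for k z
      unfolding f_def using disc_zeros.f_bounds[OF D \<Omega>_R[OF that]] by auto
    have f_nz: "f k z \<noteq> 0" if z: "z \<in> \<Omega>" for k z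
      unfolding f_def
    proof (rule disc_zeros.f_nonzero[OF D \<Omega>_R[OF z]])
      show "zeta (cc k + z) \<noteq> 0 \<or> cc k + z \<in> zeros_near (T k)"
        using zeta_zeros_near_height(1)[OF T10(1)[of k], of "cc k + z"] \<Omega>_R[OF z, of k] z
        by (auto simp: zeros_near_def \<Omega>_def cc_def R_def)
    qed
    have f_holo: "f k holomorphic_on \<Omega>" for k
    proof -
      have "(disc_zeros.f zeta (- {1}) (cc k) R (zeros_near (T k)) \<circ> (\<lambda>z. cc k + z)) holomorphic_on \<Omega>"
      proof (rule holomorphic_on_compose_gen[OF _ disc_zeros.f_holomorphic[OF D]])
        have "1 \<notin> cball (cc k) R" using one_notin_cball[OF T10(1)[of k]] by (simp add: cc_def R_def)
        then have "cc k + z \<noteq> 1" if "z \<in> \<Omega>" for z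
          using \<Omega>_R[OF that, of k] by metis
        then show "(\<lambda>z. cc k + z) ` \<Omega> \<subseteq> - {1}" by (intro image_subsetI) simp
      qed (intro holomorphic_intros)
      then show ?thesis by (simp add: f_def o_def)
    qed
    have "\<exists>g. g holomorphic_on \<Omega> \<and> (\<forall>z\<in>\<Omega>. f k z = exp (g z))" for k
    proof (rule contractible_imp_holomorphic_log[OF f_holo[of k] convex_imp_contractible[OF \<Omega>(2)] f_nz])
      fix g assume "g holomorphic_on \<Omega>" "\<And>z. z \<in> \<Omega> \<Longrightarrow> f k z = exp (g z)"
      then show ?thesis by (intro exI[of _ g]) simp
    qed
    then obtain g where g: "\<And>k. g k holomorphic_on \<Omega>" "\<And>k z. z \<in> \<Omega> \<Longrightarrow> f k z = exp (g k z)"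
      by metis
    define G where "G = (\<lambda>k z. exp (g k z / of_real (ln (T k))))"
    have norm_G: "norm (G k z) = exp (ln (norm (f k z)) / ln (T k))" if "z \<in> \<Omega>" for k z
      using g(2)[OF that, of k] by (simp add: G_def)
    have G_le: "norm (G k z) \<le> exp 4" if z: "z \<in> \<Omega>" for k z
    proof -
      have "ln (norm (f k z)) \<le> ln (T k ^ 4)"
        using f_le(1)[OF z, of k] f_nz[OF z, of k] by (intro ln_mono) auto
      also have "\<dots> = 4 * ln (T k)" using T10(1)[of k] by (simp add: ln_realpow)
      finally show ?thesis unfolding norm_G[OF z] using lnT[of k] by (simp add: field_simps)
    qed
    have G_holo: "G k holomorphic_on \<Omega>" for k
      unfolding G_def using lnT[of k] by (intro holomorphic_intros g) auto
    obtain H r where H: "H holomorphic_on \<Omega>" "strict_mono (r :: nat \<Rightarrow> nat)"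
       and lim: "\<And>z. z \<in> \<Omega> \<Longrightarrow> (\<lambda>k. G (r k) z) \<longlonglongrightarrow> H z"
    proof (rule Montel[OF \<Omega>(1), of "{h. h holomorphic_on \<Omega> \<and> (\<forall>z\<in>\<Omega>. norm (h z) \<le> exp 4)}" G])
      show "\<exists>B. \<forall>h\<in>{h. h holomorphic_on \<Omega> \<and> (\<forall>z\<in>\<Omega>. norm (h z) \<le> exp 4)}. \<forall>z\<in>K. norm (h z) \<le> B"
        if "compact K" "K \<subseteq> \<Omega>" for K using that by (intro exI[of _ "exp 4"]) auto
    qed (use G_holo G_le in auto)
    have T_lim: "filterlim T at_top sequentially"
    proof (rule filterlim_at_top_mono[OF filterlim_real_sequentially])
      show "\<forall>\<^sub>F k in sequentially. real k \<le> T k"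
      proof (intro always_eventually allI)
        show "real k \<le> T k" for k using T[of k] T1(1) by linarith
      qed
    qed
    have ln_lim: "filterlim (\<lambda>k. ln (T k)) at_top sequentially"
      by (rule filterlim_compose[OF ln_at_top T_lim])
    have small_disc: "ball 0 (1/10) \<subseteq> \<Omega>"
    proof
      fix z :: complex assume "z \<in> ball 0 (1/10)"
      then show "z \<in> \<Omega>" using abs_Im_le_cmod[of z] by (auto simp: \<Omega>_def R_def)
    qed
    have H_right: "norm (H z) = 1" if z: "z \<in> ball 0 (1/10)" for z
    proof -
      have z\<Omega>: "z \<in> \<Omega>" using z small_disc by auto
      have zn: "norm z < 1/10" using z by simp
      have Re_z: "Re (cc k + z) \<ge> 19/10" for k
        using abs_Re_le_cmod[of z] zn by (auto simp: cc_def)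
      have low: "ln c \<le> ln (norm (f k z))" for k
        using f_le(2)[OF z\<Omega>, of k] c(4)[of "cc k + z"] Re_z[of k] c(1) by (intro ln_mono) auto
      have upp: "ln (norm (f k z)) \<le> ln C + ln 4 * real (N k)" for k
      proof -
        interpret D: disc_zeros zeta "- {1}" "cc k" R "T k ^ 4" "zeros_near (T k)" by (rule D)
        have Dn: "D.n w = zmult w" for w by (simp add: D.n_def zmult_def)
        have sA: "cc k + z \<in> - {1}" using \<Omega>_R[OF z\<Omega>, of k] D.cball by blast
        \<comment> \<open>Every zero is at distance at least \<open>9/10\<close> from this small disc, so each Blaschke factor costs only a constant.\<close>
        have le: "norm (blaschke_denom (cc k) R w (cc k + z)) \<le> 4 * norm (cc k + z - w)" if w: "w \<in> zeros_near (T k)" for w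
        proof -
          have "norm (blaschke_denom (cc k) R w (cc k + z)) = norm (of_real (R\<^sup>2) - cnj (w - cc k) * z) / R"
            using D.R by (simp add: blaschke_denom_def norm_divide)
          also have "\<dots> \<le> (R\<^sup>2 + R * (1/10)) / R"
          proof (rule divide_right_mono)
            have "norm (w - cc k) \<le> R" using w D.W by (auto simp: dist_norm norm_minus_commute subset_iff less_imp_le)
            then have "norm (cnj (w - cc k) * z) \<le> R * (1/10)"
              unfolding norm_mult complex_mod_cnj using zn by (intro mult_mono) (auto simp: R_def)
            moreover have "norm (complex_of_real (R\<^sup>2)) = R\<^sup>2" by (simp only: norm_of_real) simp
            ultimately show "norm (of_real (R\<^sup>2) - cnj (w - cc k) * z) \<le> R\<^sup>2 + R * (1/10)"
              using norm_triangle_ineq4[of "complex_of_real (R\<^sup>2)" "cnj (w - cc k) * z"] by linarith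
          qed (simp add: R_def)
          also have "\<dots> \<le> 4 * (9/10)" by (simp add: R_def power2_eq_square)
          also have "4 * (9/10) \<le> 4 * norm (cc k + z - w)"
          proof -
            have "Re w \<le> 1" using w by (auto simp: zeros_near_def nontrivial_zeros_def)
            then have "9/10 \<le> Re (cc k + z - w)" using Re_z[of k] by simp
            also have "\<dots> \<le> norm (cc k + z - w)" by (rule complex_Re_le_cmod)
            finally show ?thesis by simp
          qed
          finally show ?thesis .
        qed
        have "norm (f k z) = norm (D.h (cc k + z)) * (\<Prod>w\<in>zeros_near (T k). norm (blaschke_denom (cc k) R w (cc k + z)) ^ zmult w)"
          by (simp add: f_def D.f_def norm_mult norm_power prod_norm [symmetric] Dn)
        also have "\<dots> \<le> norm (D.h (cc k + z)) * (\<Prod>w\<in>zeros_near (T k). (4 * norm (cc k + z - w)) ^ zmult w)"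
          using le by (intro mult_left_mono prod_mono conjI power_mono) auto
        also have "\<dots> = norm (zeta (cc k + z)) * 4 ^ N k"
          using D.h(3)[OF sA] by (simp add: norm_mult norm_power prod_norm [symmetric] Dn power_mult_distrib prod.distrib power_sum N_def)
        also have "\<dots> \<le> C * 4 ^ N k"
          using c(4)[of "cc k + z"] Re_z[of k] by (intro mult_right_mono) auto
        finally have "ln (norm (f k z)) \<le> ln (C * 4 ^ N k)"
          using f_nz[OF z\<Omega>, of k] by (intro ln_mono) auto
        also have "\<dots> = ln C + ln 4 * real (N k)" using c(3) by (simp add: ln_mult ln_realpow)
        finally show ?thesis .
      qed
      have "(\<lambda>k. ln (norm (f k z)) / ln (T k)) \<longlonglongrightarrow> 0"
      proof (rule tendsto_sandwich)
        show "\<forall>\<^sub>F k in sequentially. ln c / ln (T k) \<le> ln (norm (f k z)) / ln (T k)"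
          by (intro always_eventually allI divide_right_mono low less_imp_le[OF lnT])
        show "\<forall>\<^sub>F k in sequentially. ln (norm (f k z)) / ln (T k) \<le> ln C / ln (T k) + ln 4 * (1 / real (Suc k))"
        proof (rule always_eventually, rule allI)
          fix k
          have "ln (norm (f k z)) / ln (T k) \<le> (ln C + ln 4 * (1 / real (Suc k) * ln (T k))) / ln (T k)"
          proof (rule divide_right_mono)
            have "ln 4 * real (N k) \<le> ln 4 * (1 / real (Suc k) * ln (T k))"
              using few[of k] by (intro mult_left_mono) (auto simp: N_def)
            then show "ln (norm (f k z)) \<le> ln C + ln 4 * (1 / real (Suc k) * ln (T k))" using upp[of k] by linarith
          qed (use lnT[of k] in auto)
          also have "\<dots> = ln C / ln (T k) + ln 4 * (1 / real (Suc k))" using lnT[of k] by (simp add: add_divide_distrib)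
          finally show "ln (norm (f k z)) / ln (T k) \<le> ln C / ln (T k) + ln 4 * (1 / real (Suc k))" .
        qed
        show "(\<lambda>k. ln c / ln (T k)) \<longlonglongrightarrow> 0"
          by (rule tendsto_divide_0[OF tendsto_const filterlim_at_top_imp_at_infinity[OF ln_lim]])
        have "(\<lambda>k. ln C / ln (T k) + ln 4 * (1 / real (Suc k))) \<longlonglongrightarrow> 0 + ln 4 * 0"
          by (intro tendsto_add tendsto_mult tendsto_const tendsto_divide_0[OF tendsto_const filterlim_at_top_imp_at_infinity[OF ln_lim]]
                 LIMSEQ_Suc lim_1_over_n)
        then show "(\<lambda>k. ln C / ln (T k) + ln 4 * (1 / real (Suc k))) \<longlonglongrightarrow> 0" by simp
      qed
      then have "(\<lambda>k. norm (G k z)) \<longlonglongrightarrow> exp 0" unfolding norm_G[OF z\<Omega>] by (rule tendsto_exp)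
      then have "(\<lambda>k. norm (G (r k) z)) \<longlonglongrightarrow> 1"
        using LIMSEQ_subseq_LIMSEQ[OF _ H(2), of "\<lambda>k. norm (G k z)"] by (simp add: o_def)
      moreover have "(\<lambda>k. norm (G (r k) z)) \<longlonglongrightarrow> norm (H z)" by (intro tendsto_norm lim z\<Omega>)
      ultimately show ?thesis using LIMSEQ_unique by blast
    qed
    have "H constant_on \<Omega>"
    proof (rule maximum_modulus_principle[OF H(1) \<Omega>(1) convex_connected[OF \<Omega>(2)] open_ball small_disc])
      show "0 \<in> ball (0::complex) (1/10)" by simp
      show "norm (H z) \<le> norm (H 0)" if "z \<in> ball 0 (1/10)" for z using H_right that by simp
    qed
    \<comment> \<open>The point \<open>-1/2 + \<i> T k\<close> in coordinates relative to the centre \<open>2 + \<i> T k\<close>.\<close>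
    define p where "p = complex_of_real (- 5/2)"
    have p\<Omega>: "p \<in> \<Omega>" "(0::complex) \<in> \<Omega>" by (auto simp: p_def \<Omega>_def R_def)
    have "H p = H 0" using \<open>H constant_on \<Omega>\<close> p\<Omega> unfolding constant_on_def by metis
    then have Hp: "norm (H p) = 1" using H_right[of 0] by simp
    have "eventually (\<lambda>x::real. ln (c' * x) \<ge> 1/2 * ln x) at_top" using c'(1) by real_asymp
    then have "eventually (\<lambda>k. ln (c' * T k) \<ge> 1/2 * ln (T k)) sequentially"
      by (rule eventually_compose_filterlim[OF _ T_lim])
    then have "eventually (\<lambda>k. norm (G k p) \<ge> exp (1/2)) sequentially"
    proof eventually_elim
      case (elim k)
      have cp: "cc k + p = Complex (-1/2) (T k)" by (simp add: cc_def p_def complex_eq_iff)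
      have "c' * T k \<le> norm (f k p)" using f_le(2)[OF p\<Omega>(1), of k] c'(2)[of "T k"] T10(1)[of k] unfolding cp by linarith
      then have "ln (c' * T k) \<le> ln (norm (f k p))" using c'(1) T10(1)[of k] by (intro ln_mono) auto
      with elim have "1/2 * ln (T k) \<le> ln (norm (f k p))" by linarith
      then have "1/2 \<le> ln (norm (f k p)) / ln (T k)" using lnT[of k] by (simp add: field_simps)
      then show ?case unfolding norm_G[OF p\<Omega>(1)] by simp
    qed
    then have "eventually (\<lambda>k. norm (G (r k) p) \<ge> exp (1/2)) sequentially"
      by (rule eventually_subseq[OF H(2)])
    moreover have "(\<lambda>k. norm (G (r k) p)) \<longlonglongrightarrow> norm (H p)" by (intro tendsto_norm lim p\<Omega>)
    ultimately have "norm (H p) \<ge> exp (1/2)"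
      by (intro tendsto_lowerbound[of "\<lambda>k. norm (G (r k) p)" "norm (H p)" sequentially "exp (1/2)"]) auto
    then show False using Hp by simp
  qed
  then show ?thesis using that by blast
qed

section \<open>Enumeration of the zeros by height\<close>

text \<open>
  Repeatedly remove an element with the least key.  An element that is never removed would bound the keys of all
  removed ones, contradicting the finiteness of the sublevel sets.
\<close>
lemma ordered_enumeration_exists:
  fixes k :: "'a \<Rightarrow> real"
  assumes inf: "infinite P" and fin: "\<And>T. finite {p \<in> P. k p \<le> T}"
  shows "\<exists>e :: nat \<Rightarrow> 'a. bij_betw e UNIV P \<and> (\<forall>m n. m \<le> n \<longrightarrow> k (e m) \<le> k (e n))"
proof -
  have ex: "\<exists>p. p \<in> S \<and> (\<forall>q\<in>S. k p \<le> k q)" if S: "S \<subseteq> P" "infinite S" for S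
  proof -
    obtain q0 where q0: "q0 \<in> S" using S by fastforce
    define F where "F = {p \<in> S. k p \<le> k q0}"
    have F: "finite F" "F \<noteq> {}"
      using finite_subset[OF _ fin[of "k q0"], of F] S q0 by (auto simp: F_def)
    obtain p where p: "p \<in> F" "\<And>q. q \<in> F \<Longrightarrow> k p \<le> k q"
      using ex_min_if_finite[of "k ` F"] F by (metis (mono_tags, lifting) arg_min_if_finite(1) arg_min_least)
    have "k p \<le> k q" if "q \<in> S" for q
      using p that by (cases "k q \<le> k q0") (auto simp: F_def)
    then show ?thesis using p by (auto simp: F_def)
  qed
  define pick where "pick S = (SOME p. p \<in> S \<and> (\<forall>q\<in>S. k p \<le> k q))" for S
  have pick: "pick S \<in> S" "\<And>q. q \<in> S \<Longrightarrow> k (pick S) \<le> k q" if "S \<subseteq> P" "infinite S" for S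
    using someI_ex[OF ex[OF that]] by (auto simp: pick_def)
  define S where "S = rec_nat P (\<lambda>_ A. A - {pick A})"
  have S_0: "S 0 = P" and S_Suc: "S (Suc n) = S n - {pick (S n)}" for n by (simp_all add: S_def)
  have S: "S n \<subseteq> P \<and> infinite (S n)" for n
    by (induction n) (auto simp: S_0 S_Suc inf)
  define e where "e n = pick (S n)" for n
  have e_in: "e n \<in> S n" and e_min: "\<And>q. q \<in> S n \<Longrightarrow> k (e n) \<le> k q" for n
    using pick S unfolding e_def by auto
  have dec: "S n \<subseteq> S m" if "m \<le> n" for m n
    using that by (induction n rule: dec_induct) (auto simp: S_Suc)
  have notin: "e m \<notin> S n" if "m < n" for m n
  proof -
    have "S n \<subseteq> S (Suc m)" using that by (intro dec) simp
    then show ?thesis by (auto simp: S_Suc e_def)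
  qed
  have inj: "inj e"
  proof (rule injI)
    fix m n assume "e m = e n"
    then show "m = n" using notin[of m n] notin[of n m] e_in[of m] e_in[of n] by (metis nat_neq_iff)
  qed
  have mono: "k (e m) \<le> k (e n)" if "m \<le> n" for m n
    using e_min[of "e n" m] e_in[of n] dec[OF that] by blast
  have surj: "range e = P"
  proof
    show "range e \<subseteq> P" using e_in S by blast
    show "P \<subseteq> range e"
    proof (rule ccontr)
      assume "\<not> P \<subseteq> range e"
      then obtain p where p: "p \<in> P" "p \<notin> range e" by blast
      have "p \<in> S n" for n
        by (induction n) (use p in \<open>auto simp: S_0 S_Suc e_def\<close>)
      then have "range e \<subseteq> {q \<in> P. k q \<le> k p}" using e_min e_in S by blast
      then have "finite (range e)" using fin finite_subset by blast
      then show False using inj finite_imageD infinite_UNIV_nat by blast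
    qed
  qed
  show ?thesis using inj mono surj by (intro exI[of _ e]) (auto simp: bij_betw_def)
qed

definition upper_zeros :: "complex set" where
  "upper_zeros = {s \<in> nontrivial_zeros. Im s > 0}"

lemma zmult_pos:
  assumes "s \<in> nontrivial_zeros"
  shows "zmult s > 0" "int (zmult s) = zorder zeta s"
proof -
  have "s \<in> - {1}" "zeta s = 0" using assms by (auto simp: nontrivial_zeros_def)
  then have "zorder zeta s > 0"
    using zorder_exist_zero[OF holomorphic_zeta open_connected_minus_1, of s] zeta_nonzero_somewhere by auto
  then show "zmult s > 0" "int (zmult s) = zorder zeta s" by (auto simp: zmult_def)
qed

lemma finite_upper_zeros_le: "finite {s \<in> upper_zeros. Im s \<le> T}"
proof (rule finite_subset)
  define K where "K = cbox (Complex 0 0) (Complex 1 (max T 0))"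
  show "{s \<in> upper_zeros. Im s \<le> T} \<subseteq> {s \<in> K. zeta_entire s = 0}"
  proof
    fix s assume "s \<in> {s \<in> upper_zeros. Im s \<le> T}"
    then have s: "s \<noteq> 1" "zeta s = 0" "0 \<le> Re s" "Re s \<le> 1" "0 < Im s" "Im s \<le> T"
      by (auto simp: upper_zeros_def nontrivial_zeros_def)
    then have "zeta_entire s = 0" using zeta_eq_entire[of s] by auto
    then show "s \<in> {s \<in> K. zeta_entire s = 0}" using s by (auto simp: K_def in_cbox_complex_iff)
  qed
  show "finite {s \<in> K. zeta_entire s = 0}"
  proof (rule finite_zeros_in_compact[OF holomorphic_zeta_entire])
    show "open {s. - 1 < Re s}" by (rule open_halfspace_Re_gt)
    show "connected {s. - 1 < Re s}" by (rule convex_connected[OF convex_halfspace_Re_gt])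
    show "\<exists>z\<in>{s. - 1 < Re s}. zeta_entire z \<noteq> 0" using zeta_entire_1 by (intro bexI[of _ 1]) auto
    show "compact K" by (simp add: K_def)
    show "K \<subseteq> {s. - 1 < Re s}" by (auto simp: K_def in_cbox_complex_iff)
  qed
qed

lemma zeros_near_upper: "T > 1 \<Longrightarrow> zeros_near T \<subseteq> upper_zeros"
  by (auto simp: zeros_near_def upper_zeros_def)

lemma infinite_upper_zeros: "infinite upper_zeros"
proof
  assume fin: "finite upper_zeros"
  obtain c T0 where c: "c > 0" "T0 \<ge> 10" "\<And>T. T \<ge> T0 \<Longrightarrow> c * ln T \<le> real (\<Sum>w\<in>zeros_near T. zmult w)"
    using zeta_zeros_near_many by blast
  define T where "T = max T0 (Max (insert 0 (Im ` upper_zeros)) + 2)"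
  have T: "T \<ge> T0" "T \<ge> 10" using c by (auto simp: T_def)
  have "Im w \<le> T - 2" if "w \<in> upper_zeros" for w
  proof -
    have "Im w \<le> Max (insert 0 (Im ` upper_zeros))" using fin that by (intro Max_ge) auto
    then show ?thesis unfolding T_def by linarith
  qed
  then have "zeros_near T = {}"
    using zeros_near_upper[of T] T by (force simp: zeros_near_def)
  then have "c * ln T \<le> 0" using c(3)[OF T(1)] by simp
  moreover have "ln T > 0" using T by simp
  ultimately show False using c(1) mult_pos_pos[of c "ln T"] by linarith
qed

text \<open>
  The pairs \<open>(s, j)\<close> with \<open>j\<close> below the multiplicity of \<open>s\<close> represent each zero as often as its multiplicity.
\<close>
lemma enumerates_upper_zero: "enumerates_upper_zeros upper_zero"
proof -
  define P where "P = (SIGMA s:upper_zeros. {..<zmult s})"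
  have inf: "infinite P"
  proof
    assume "finite P"
    moreover have "upper_zeros \<subseteq> fst ` P"
    proof
      fix s assume "s \<in> upper_zeros"
      then have "(s, 0) \<in> P" using zmult_pos(1)[of s] by (auto simp: P_def upper_zeros_def)
      then show "s \<in> fst ` P" by force
    qed
    ultimately show False using infinite_upper_zeros finite_surj by blast
  qed
  have fin: "finite {p \<in> P. Im (fst p) \<le> T}" for T
  proof (rule finite_subset)
    show "{p \<in> P. Im (fst p) \<le> T} \<subseteq> (SIGMA s:{s \<in> upper_zeros. Im s \<le> T}. {..<zmult s})"
      by (auto simp: P_def)
    show "finite (SIGMA s:{s \<in> upper_zeros. Im s \<le> T}. {..<zmult s})"
      by (intro finite_SigmaI finite_upper_zeros_le) auto
  qed
  obtain e :: "nat \<Rightarrow> complex \<times> nat" where e: "bij_betw e UNIV P" "\<And>m n. m \<le> n \<Longrightarrow> Im (fst (e m)) \<le> Im (fst (e n))"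
    using ordered_enumeration_exists[of P "\<lambda>p. Im (fst p)"] inf fin by auto
  define \<rho> where "\<rho> n = fst (e (n - 1))" for n
  have "enumerates_upper_zeros \<rho>"
    unfolding enumerates_upper_zeros_def
  proof (intro conjI allI impI ballI)
    fix n :: nat
    have "e (n - 1) \<in> P" using e(1) by (auto simp: bij_betw_def)
    then show "\<rho> n \<in> nontrivial_zeros" "Im (\<rho> n) > 0" by (auto simp: \<rho>_def P_def upper_zeros_def)
  next
    fix m n :: nat assume "m \<le> n"
    then show "Im (\<rho> m) \<le> Im (\<rho> n)" unfolding \<rho>_def by (intro e(2)) auto
  next
    fix s assume s: "s \<in> nontrivial_zeros" "Im s > 0"
    have "{n. n \<ge> 1 \<and> \<rho> n = s} = Suc ` {m. fst (e m) = s}"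
    proof (intro equalityI subsetI)
      fix n assume "n \<in> {n. n \<ge> 1 \<and> \<rho> n = s}"
      then show "n \<in> Suc ` {m. fst (e m) = s}" by (intro image_eqI[of _ _ "n - 1"]) (auto simp: \<rho>_def)
    qed (auto simp: \<rho>_def)
    then have "card {n. n \<ge> 1 \<and> \<rho> n = s} = card {m. fst (e m) = s}" by (simp add: card_image)
    also have "\<dots> = card (e ` {m. fst (e m) = s})"
      using e(1) by (intro card_image [symmetric]) (auto simp: bij_betw_def inj_on_def)
    also have "e ` {m. fst (e m) = s} = {s} \<times> {..<zmult s}"
    proof (intro equalityI subsetI)
      fix p assume "p \<in> e ` {m. fst (e m) = s}"
      then obtain m where m: "p = e m" "fst p = s" by auto
      have "e m \<in> P" using e(1) by (auto simp: bij_betw_def)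
      then show "p \<in> {s} \<times> {..<zmult s}" using m by (cases p) (auto simp: P_def)
    next
      fix p assume p: "p \<in> {s} \<times> {..<zmult s}"
      then have "p \<in> P" using s by (auto simp: P_def upper_zeros_def)
      then obtain m where "p = e m" using e(1) by (auto simp: bij_betw_def)
      then show "p \<in> e ` {m. fst (e m) = s}" using p by auto
    qed
    finally show "int (card {n. n \<ge> 1 \<and> \<rho> n = s}) = zorder zeta s"
      using zmult_pos(2)[OF s(1)] by simp
  qed
  then show ?thesis unfolding upper_zero_def by (rule someI[of enumerates_upper_zeros])
qed

lemma upper_zero_props:
  shows "n \<ge> 1 \<Longrightarrow> upper_zero n \<in> upper_zeros"
    and "1 \<le> m \<Longrightarrow> m \<le> n \<Longrightarrow> upper_ordinate m \<le> upper_ordinate n"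
    and "s \<in> upper_zeros \<Longrightarrow> card {n. n \<ge> 1 \<and> upper_zero n = s} = zmult s"
    and "s \<in> upper_zeros \<Longrightarrow> finite {n. n \<ge> 1 \<and> upper_zero n = s}"
proof -
  show c: "card {n. n \<ge> 1 \<and> upper_zero n = s} = zmult s" if "s \<in> upper_zeros" for s
    using enumerates_upper_zero zmult_pos(2)[of s] that
    unfolding enumerates_upper_zeros_def upper_zeros_def by (metis (mono_tags, lifting) mem_Collect_eq of_nat_eq_iff)
  show "finite {n. n \<ge> 1 \<and> upper_zero n = s}" if "s \<in> upper_zeros" for s
    using c[OF that] zmult_pos(1)[of s] that by (intro card_ge_0_finite) (auto simp: upper_zeros_def)
qed (use enumerates_upper_zero in \<open>auto simp: enumerates_upper_zeros_def upper_zeros_def upper_ordinate_def\<close>)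

text \<open>
  Passes between sums over zeros weighted by multiplicity, as they occur in Landau's formula, and sums over the
  indices of the ordered list of zeros.
\<close>
lemma sum_over_indices:
  fixes \<phi> :: "complex \<Rightarrow> real"
  assumes "finite Z" "Z \<subseteq> upper_zeros"
  shows "finite {n. n \<ge> 1 \<and> upper_zero n \<in> Z}"
    and "(\<Sum>w\<in>Z. real (zmult w) * \<phi> w) = (\<Sum>n\<in>{n. n \<ge> 1 \<and> upper_zero n \<in> Z}. \<phi> (upper_zero n))"
proof -
  define I where "I = {n. n \<ge> 1 \<and> upper_zero n \<in> Z}"
  have I_eq: "I = (\<Union>w\<in>Z. {n. n \<ge> 1 \<and> upper_zero n = w})" by (auto simp: I_def)
  have fin: "finite I" unfolding I_eq using assms upper_zero_props(4) by (intro finite_UN_I) auto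
  have "(\<Sum>n\<in>I. \<phi> (upper_zero n)) = (\<Sum>w\<in>Z. \<Sum>n\<in>{n \<in> I. upper_zero n = w}. \<phi> (upper_zero n))"
    by (rule sum.group [symmetric]) (use fin assms in \<open>auto simp: I_def\<close>)
  also have "\<dots> = (\<Sum>w\<in>Z. real (zmult w) * \<phi> w)"
  proof (rule sum.cong[OF refl])
    fix w assume w: "w \<in> Z"
    have "{n \<in> I. upper_zero n = w} = {n. n \<ge> 1 \<and> upper_zero n = w}" using w by (auto simp: I_def)
    then show "(\<Sum>n\<in>{n \<in> I. upper_zero n = w}. \<phi> (upper_zero n)) = real (zmult w) * \<phi> w"
      using upper_zero_props(3)[of w] w assms by auto
  qed
  finally show "(\<Sum>w\<in>Z. real (zmult w) * \<phi> w) = (\<Sum>n\<in>{n. n \<ge> 1 \<and> upper_zero n \<in> Z}. \<phi> (upper_zero n))"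
    by (simp add: I_def)
  show "finite {n. n \<ge> 1 \<and> upper_zero n \<in> Z}" using fin by (simp add: I_def)
qed

section \<open>Monotone sequences without three close terms\<close>

text \<open>
  Index sets \<open>I\<close> without gaps, on which any two terms whose indices differ by 2 are more than \<open>g\<close> apart.  Such a
  sequence has at most two terms in any interval of length \<open>g\<close>, so it is about as sparse as an arithmetic
  progression of difference \<open>g / 2\<close>.
\<close>
locale spread_sequence =
  fixes \<gamma> :: "nat \<Rightarrow> real" and I :: "nat set" and g t :: real
  assumes fin: "finite I" and g: "g > 0"
    and mono: "\<And>m n. m \<in> I \<Longrightarrow> n \<in> I \<Longrightarrow> m \<le> n \<Longrightarrow> \<gamma> m \<le> \<gamma> n"
    and convex: "\<And>l m n. l \<in> I \<Longrightarrow> n \<in> I \<Longrightarrow> l \<le> m \<Longrightarrow> m \<le> n \<Longrightarrow> m \<in> I"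
    and spread: "\<And>n. n \<in> I \<Longrightarrow> n + 2 \<in> I \<Longrightarrow> \<gamma> (n + 2) - \<gamma> n > g"
begin

lemma card_interval_le_2: "card {n \<in> I. x \<le> \<gamma> n \<and> \<gamma> n \<le> x + g} \<le> 2"
proof (rule ccontr)
  define J where "J = {n \<in> I. x \<le> \<gamma> n \<and> \<gamma> n \<le> x + g}"
  assume "\<not> card {n \<in> I. x \<le> \<gamma> n \<and> \<gamma> n \<le> x + g} \<le> 2"
  then have J: "card J > 2" "finite J" using fin by (auto simp: J_def)
  then have ne: "J \<noteq> {}" by auto
  define a b where "a = Min J" and "b = Max J"
  have ab: "a \<in> J" "b \<in> J" "J \<subseteq> {a..b}" using J ne by (auto simp: a_def b_def)
  have "card J \<le> card {a..b}" using ab(3) by (intro card_mono) auto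
  then have le: "a + 2 \<le> b" using J by simp
  have I: "a \<in> I" "b \<in> I" using ab by (auto simp: J_def)
  have I2: "a + 2 \<in> I" by (rule convex[OF I]) (use le in auto)
  have "\<gamma> (a + 2) \<le> \<gamma> b" by (rule mono[OF I2 I(2) le])
  then show False using spread[OF I(1) I2] ab(1,2) by (auto simp: J_def)
qed

text \<open>
  The shell consists of two intervals of length \<open>g\<close>, one on either side of \<open>t\<close>.
\<close>
lemma card_shell_le_4: "card {n \<in> I. nat \<lfloor>\<bar>\<gamma> n - t\<bar> / g\<rfloor> = b} \<le> 4"
proof -
  define x where "x = real b * g"
  have "{n \<in> I. nat \<lfloor>\<bar>\<gamma> n - t\<bar> / g\<rfloor> = b}
     \<subseteq> {n \<in> I. t + x \<le> \<gamma> n \<and> \<gamma> n \<le> (t + x) + g} \<union> {n \<in> I. (t - x - g) \<le> \<gamma> n \<and> \<gamma> n \<le> (t - x - g) + g}"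
    (is "?S \<subseteq> ?A \<union> ?B")
  proof
    fix n assume n: "n \<in> ?S"
    define q where "q = \<bar>\<gamma> n - t\<bar> / g"
    have q: "q \<ge> 0" "q * g = \<bar>\<gamma> n - t\<bar>" using g by (simp_all add: q_def)
    have bq: "b = nat \<lfloor>q\<rfloor>" using n by (simp add: q_def)
    have "real b \<le> q" "q \<le> real b + 1" unfolding bq using q(1) by linarith+
    then have "real b * g \<le> q * g" "q * g \<le> (real b + 1) * g" using g by (auto intro: mult_right_mono)
    then have "x \<le> \<bar>\<gamma> n - t\<bar>" "\<bar>\<gamma> n - t\<bar> \<le> x + g" unfolding q(2) x_def by (auto simp: algebra_simps)
    then show "n \<in> ?A \<union> ?B" using n by (auto simp: abs_if split: if_splits)
  qed
  then have "card ?S \<le> card (?A \<union> ?B)" using fin by (intro card_mono) auto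
  also have "\<dots> \<le> card ?A + card ?B" by (rule card_Un_le)
  also have "\<dots> \<le> 2 + 2" by (intro add_mono card_interval_le_2)
  finally show ?thesis by simp
qed

lemma card_window_le:
  assumes "\<And>n. n \<in> I \<Longrightarrow> \<bar>\<gamma> n - t\<bar> \<le> 1"
  shows "real (card I) \<le> 4 / g + 4"
proof -
  define b where "b n = nat \<lfloor>\<bar>\<gamma> n - t\<bar> / g\<rfloor>" for n
  define B where "B = nat \<lfloor>1 / g\<rfloor>"
  have b: "b ` I \<subseteq> {..B}"
    using assms g by (auto simp: b_def B_def intro!: nat_mono floor_mono divide_right_mono)
  have "card I = (\<Sum>n\<in>I. 1)" by simp
  also have "\<dots> = (\<Sum>j\<in>{..B}. \<Sum>n\<in>{n \<in> I. b n = j}. 1)"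
    by (rule sum.group [symmetric]) (use fin b in auto)
  also have "\<dots> \<le> (\<Sum>j\<in>{..B}. 4)"
    using card_shell_le_4 by (intro sum_mono) (simp add: b_def)
  also have "\<dots> = 4 * (B + 1)" by simp
  finally have "real (card I) \<le> real (4 * (B + 1))" by (simp only: of_nat_le_iff)
  moreover have "real B \<le> 1 / g" using g by (simp add: B_def)
  ultimately show ?thesis by simp
qed

text \<open>
  The shell number \<open>j\<close> contributes at most 4 terms of size \<open>1 / (j * g)\<^sup>2\<close>, and \<open>\<Sum>j\<ge>1. 1 / j\<^sup>2 \<le> 2\<close>; the shell
  around \<open>t\<close> itself is empty.
\<close>
lemma sum_inverse_squares_le:
  assumes "\<And>n. n \<in> I \<Longrightarrow> \<bar>\<gamma> n - t\<bar> \<ge> g"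
  shows "(\<Sum>n\<in>I. 1 / (\<gamma> n - t)\<^sup>2) \<le> 8 / g\<^sup>2"
proof -
  define b where "b n = nat \<lfloor>\<bar>\<gamma> n - t\<bar> / g\<rfloor>" for n
  define B where "B = Max (insert 1 (b ` I))"
  have le_b: "real (b n) * g \<le> \<bar>\<gamma> n - t\<bar>" "b n \<ge> 1" if n: "n \<in> I" for n
  proof -
    define q where "q = \<bar>\<gamma> n - t\<bar> / g"
    have q: "q \<ge> 1" "q * g = \<bar>\<gamma> n - t\<bar>" using g assms[OF n] by (simp_all add: q_def)
    have bq: "b n = nat \<lfloor>q\<rfloor>" by (simp add: b_def q_def)
    have "real (b n) \<le> q" "real (b n) > 0" unfolding bq using q(1) by linarith+
    then show "real (b n) * g \<le> \<bar>\<gamma> n - t\<bar>" "b n \<ge> 1" unfolding q(2) [symmetric] using g by auto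
  qed
  have b: "b ` I \<subseteq> {1..B}"
  proof
    fix j assume "j \<in> b ` I"
    then show "j \<in> {1..B}" using le_b(2) fin by (auto simp: B_def intro!: Max_ge)
  qed
  have sq: "(\<Sum>j=1..N. 1 / (real j)\<^sup>2) \<le> 2 - 1 / real N" if "N \<ge> 1" for N
    using that
  proof (induction N rule: dec_induct)
    case (step N)
    have "1 / (real (Suc N))\<^sup>2 \<le> 1 / (real N * real (Suc N))"
      using step by (intro divide_left_mono) (auto simp: power2_eq_square)
    also have "\<dots> = 1 / real N - 1 / real (Suc N)" using step by (simp add: field_simps)
    finally show ?case using step.IH by simp
  qed simp
  have "(\<Sum>n\<in>I. 1 / (\<gamma> n - t)\<^sup>2) \<le> (\<Sum>n\<in>I. 1 / (real (b n) * g)\<^sup>2)"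
  proof (rule sum_mono)
    fix n assume n: "n \<in> I"
    have "(real (b n) * g)\<^sup>2 \<le> \<bar>\<gamma> n - t\<bar>\<^sup>2" using le_b[OF n] g by (intro power_mono) auto
    then have le: "(real (b n) * g)\<^sup>2 \<le> (\<gamma> n - t)\<^sup>2" by simp
    have pos: "(real (b n) * g)\<^sup>2 > 0" using le_b[OF n] g by simp
    show "1 / (\<gamma> n - t)\<^sup>2 \<le> 1 / (real (b n) * g)\<^sup>2"
      by (rule divide_left_mono[OF le _ mult_pos_pos[OF less_le_trans[OF pos le] pos]]) simp
  qed
  also have "\<dots> = (\<Sum>j\<in>{1..B}. \<Sum>n\<in>{n \<in> I. b n = j}. 1 / (real (b n) * g)\<^sup>2)"
    by (rule sum.group [symmetric]) (use fin b in auto)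
  also have "\<dots> \<le> (\<Sum>j\<in>{1..B}. 4 / g\<^sup>2 * (1 / (real j)\<^sup>2))"
  proof (rule sum_mono)
    fix j
    have "(\<Sum>n\<in>{n \<in> I. b n = j}. 1 / (real (b n) * g)\<^sup>2) = real (card {n \<in> I. b n = j}) * (1 / (real j * g)\<^sup>2)"
      by simp
    also have "\<dots> \<le> 4 * (1 / (real j * g)\<^sup>2)"
    proof (rule mult_right_mono)
      have "card {n \<in> I. b n = j} \<le> 4" unfolding b_def by (rule card_shell_le_4)
      then show "real (card {n \<in> I. b n = j}) \<le> 4" by linarith
    qed simp
    also have "\<dots> = 4 / g\<^sup>2 * (1 / (real j)\<^sup>2)" by (simp add: power_mult_distrib)
    finally show "(\<Sum>n\<in>{n \<in> I. b n = j}. 1 / (real (b n) * g)\<^sup>2) \<le> 4 / g\<^sup>2 * (1 / (real j)\<^sup>2)" .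
  qed
  also have "\<dots> = 4 / g\<^sup>2 * (\<Sum>j=1..B. 1 / (real j)\<^sup>2)" by (simp add: sum_distrib_left)
  also have "\<dots> \<le> 4 / g\<^sup>2 * 2"
  proof (rule mult_left_mono)
    have "B \<ge> 1" using fin by (simp add: B_def)
    from sq[OF this] show "(\<Sum>j=1..B. 1 / (real j)\<^sup>2) \<le> 2"
      by (rule order.trans) simp
  qed simp
  finally show ?thesis by simp
qed

end

section \<open>Zeros of the derivative and close triples of zeros\<close>

theorem theorem1:
  shows "\<exists>C T0 :: real. C > 0 \<and> T0 > 0 \<and>
    (\<forall>\<beta>' \<gamma>' :: real. deriv zeta (Complex \<beta>' \<gamma>') = 0 \<and> \<gamma>' \<ge> T0 \<longrightarrow>
      (\<exists>n\<ge>1. \<gamma>' - 1 \<le> upper_ordinate n \<and>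
              upper_ordinate n \<le> upper_ordinate (n + 2) \<and>
              upper_ordinate (n + 2) \<le> \<gamma>' + 1 \<and>
              (\<forall>\<gamma>c. closest_ordinate \<gamma>' \<gamma>c \<longrightarrow>
                min (\<bar>\<gamma>c - \<gamma>'\<bar> * ln \<gamma>')
                    (\<bar>upper_ordinate (n + 2) - upper_ordinate n\<bar> * ln (upper_ordinate n))
                  \<le> C * sqrt (\<bar>\<beta>' - 1 / 2\<bar> * ln \<gamma>'))))"
proof -
  obtain c T1 where c: "c > 0" "T1 \<ge> 10" "\<And>T. T \<ge> T1 \<Longrightarrow> c * ln T \<le> real (\<Sum>w\<in>zeros_near T. zmult w)"
    using zeta_zeros_near_many by blast
  obtain K T2 where K: "K > 0" "T2 \<ge> 10" "\<And>T. T \<ge> T2 \<Longrightarrow> log_deriv_controlled K T"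
    using zeta_local_log_deriv by blast
  obtain T3 where T3: "T3 \<ge> 10" "\<And>T. T \<ge> T3 \<Longrightarrow> zeta (Complex (1/2) T) \<noteq> 0 \<Longrightarrow>
     Re (deriv zeta (Complex (1/2) T) / zeta (Complex (1/2) T)) \<le> - (ln T / 4)"
    using Re_zeta_log_deriv_critical_line by blast
  \<comment> \<open>If \<open>\<beta>'\<close> is closer than this to \<open>1/2\<close>, the smooth part of Landau's formula cannot account for the variation of \<open>\<zeta>'/\<zeta>\<close>.\<close>
  define \<delta>0 where "\<delta>0 = min (1/4) (1 / (32 * K))"
  have \<delta>0: "\<delta>0 > 0" "\<delta>0 \<le> 1/4" "2 * K * \<delta>0 \<le> 1/16"
  proof -
    have "2 * K * \<delta>0 \<le> 2 * K * (1 / (32 * K))" using K(1) by (intro mult_left_mono) (auto simp: \<delta>0_def)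
    then show "2 * K * \<delta>0 \<le> 1/16" using K(1) by simp
  qed (use K(1) in \<open>auto simp: \<delta>0_def\<close>)
  \<comment> \<open>The first entry makes \<open>32 / C\<^sup>2 \<le> 1/16\<close>; the second makes the right-hand side at least \<open>16 / c\<close> as soon as \<open>\<bar>\<beta>' - 1/2\<bar> \<ge> \<delta>0\<close>.\<close>
  define C where "C = max 23 (16 / c / sqrt \<delta>0)"
  have C: "C \<ge> 23" "C * sqrt \<delta>0 \<ge> 16 / c"
  proof -
    have "16 / c = (16 / c / sqrt \<delta>0) * sqrt \<delta>0" using \<delta>0(1) by simp
    also have "\<dots> \<le> C * sqrt \<delta>0" using \<delta>0(1) by (intro mult_right_mono) (auto simp: C_def)
    finally show "C * sqrt \<delta>0 \<ge> 16 / c" .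
  qed (simp add: C_def)
  \<comment> \<open>The last entry makes \<open>c * ln T \<ge> 9\<close>, so that a spread-out window could not hold \<open>c * ln T\<close> zeros.\<close>
  define T0 where "T0 = Max {T1, T2, T3, exp (9 / c)}"
  have T0: "T0 \<ge> T1" "T0 \<ge> T2" "T0 \<ge> T3" "T0 \<ge> exp (9 / c)" by (auto simp: T0_def)
  show ?thesis
  proof (rule exI[of _ C], rule exI[of _ T0], intro conjI allI impI)
    show "C > 0" "T0 > 0" using C T0(1) c(2) by auto
    fix \<beta>' T :: real
    assume "deriv zeta (Complex \<beta>' T) = 0 \<and> T \<ge> T0"
    then have crit: "deriv zeta (Complex \<beta>' T) = 0" and T: "T \<ge> T0" by auto
    have T10: "T \<ge> 10" using T T0(1) c(2) by linarith
    define \<gamma> where "\<gamma> = upper_ordinate"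
    define \<epsilon> where "\<epsilon> = C * sqrt (\<bar>\<beta>' - 1 / 2\<bar> * ln T)"
    define I where "I = {n. n \<ge> 1 \<and> upper_zero n \<in> zeros_near T}"
    have Z: "finite (zeros_near T)" "zeros_near T \<subseteq> upper_zeros"
      using finite_zeros_near[OF T10] zeros_near_upper[of T] T10 by auto
    have finI: "finite I" unfolding I_def by (rule sum_over_indices(1)[OF Z])
    have I_iff: "n \<in> I \<longleftrightarrow> n \<ge> 1 \<and> \<bar>\<gamma> n - T\<bar> \<le> 1" for n
      using upper_zero_props(1)[of n] by (auto simp: I_def zeros_near_def upper_zeros_def \<gamma>_def upper_ordinate_def)
    have \<gamma>_mono: "\<gamma> m \<le> \<gamma> n" if "1 \<le> m" "m \<le> n" for m n
      unfolding \<gamma>_def by (rule upper_zero_props(2)[OF that])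
    have I_convex: "m \<in> I" if "l \<in> I" "n \<in> I" "l \<le> m" "m \<le> n" for l m n
      using that \<gamma>_mono[of l m] \<gamma>_mono[of m n] by (auto simp: I_iff)
    have spread: "spread_sequence \<gamma> I g"
      if g: "g > 0" "\<And>n. n \<in> I \<Longrightarrow> n + 2 \<in> I \<Longrightarrow> \<gamma> (n + 2) - \<gamma> n > g" for g
    proof
      show "\<gamma> m \<le> \<gamma> n" if "m \<in> I" "n \<in> I" "m \<le> n" for m n
        using \<gamma>_mono[of m n] that by (simp add: I_iff)
      show "m \<in> I" if "l \<in> I" "n \<in> I" "l \<le> m" "m \<le> n" for l m n
        by (rule I_convex[OF that])
      show "\<gamma> (n + 2) - \<gamma> n > g" if "n \<in> I" "n + 2 \<in> I" for n
        by (rule g(2)[OF that])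
    qed (fact finI g(1))+
    have lnT: "ln T \<ge> 1" "ln T \<ge> 9 / c"
    proof -
      have "exp 1 \<le> T" using exp_le T10 by linarith
      then have "ln (exp 1) \<le> ln T" by (intro ln_mono) auto
      then show "ln T \<ge> 1" by simp
      have "exp (9 / c) \<le> T" using T T0(4) by linarith
      then have "ln (exp (9 / c)) \<le> ln T" by (intro ln_mono) auto
      then show "ln T \<ge> 9 / c" by simp
    qed
    have ln_\<gamma>: "0 < ln (\<gamma> n)" "ln (\<gamma> n) \<le> 2 * ln T" if "n \<in> I" for n
    proof -
      have r: "T - 1 \<le> \<gamma> n" "\<gamma> n \<le> T + 1" using that by (auto simp: I_iff)
      then show "0 < ln (\<gamma> n)" using T10 by simp
      have "10 * T \<le> T * T" using T10 by (intro mult_right_mono) auto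
      then have "T + 1 \<le> T * T" using T10 by linarith
      then have "ln (\<gamma> n) \<le> ln (T * T)" using r T10 by (intro ln_mono) auto
      also have "\<dots> = 2 * ln T" using T10 by (simp add: ln_mult)
      finally show "ln (\<gamma> n) \<le> 2 * ln T" .
    qed
    have cardI: "real (card I) \<ge> c * ln T"
    proof -
      have "real (\<Sum>w\<in>zeros_near T. zmult w) = (\<Sum>w\<in>zeros_near T. real (zmult w) * 1)" by simp
      also have "\<dots> = (\<Sum>n\<in>I. 1)" unfolding I_def by (rule sum_over_indices(2)[OF Z])
      finally show ?thesis using c(3)[of T] T T0(1) by simp
    qed
    \<comment> \<open>The window holds so many zeros that some triple of consecutive ones is as close as the average spacing allows.\<close>
    have "\<exists>n. n \<in> I \<and> n + 2 \<in> I \<and> \<gamma> (n + 2) - \<gamma> n \<le> 8 / (c * ln T)"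
    proof (rule ccontr)
      assume none: "\<not> ?thesis"
      have pos: "c * ln T \<ge> 9" using lnT(2) c(1) by (simp add: field_simps)
      interpret spread_sequence \<gamma> I "8 / (c * ln T)" T
        by (rule spread) (use none pos in \<open>auto simp: not_le\<close>)
      have "real (card I) \<le> 4 / (8 / (c * ln T)) + 4" by (rule card_window_le) (simp add: I_iff)
      also have "\<dots> = c * ln T / 2 + 4" by simp
      finally show False using cardI pos by linarith
    qed
    then obtain n1 where n1: "n1 \<in> I" "n1 + 2 \<in> I" "\<gamma> (n1 + 2) - \<gamma> n1 \<le> 8 / (c * ln T)" by blast
    show "\<exists>n\<ge>1. T - 1 \<le> upper_ordinate n \<and>
              upper_ordinate n \<le> upper_ordinate (n + 2) \<and>
              upper_ordinate (n + 2) \<le> T + 1 \<and>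
              (\<forall>\<gamma>c. closest_ordinate T \<gamma>c \<longrightarrow>
                min (\<bar>\<gamma>c - T\<bar> * ln T)
                    (\<bar>upper_ordinate (n + 2) - upper_ordinate n\<bar> * ln (upper_ordinate n))
                  \<le> C * sqrt (\<bar>\<beta>' - 1 / 2\<bar> * ln T))"
    proof (rule ccontr)
      assume none: "\<not> ?thesis"
      have bad: "\<exists>\<gamma>c. closest_ordinate T \<gamma>c \<and> \<bar>\<gamma>c - T\<bar> * ln T > \<epsilon> \<and> \<bar>\<gamma> (n + 2) - \<gamma> n\<bar> * ln (\<gamma> n) > \<epsilon>"
        if n: "n \<in> I" "n + 2 \<in> I" for n
      proof -
        have "n \<ge> 1" "T - 1 \<le> upper_ordinate n" "upper_ordinate n \<le> upper_ordinate (n + 2)"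
          "upper_ordinate (n + 2) \<le> T + 1"
          using n \<gamma>_mono[of n "n + 2"] by (auto simp: I_iff \<gamma>_def)
        with none obtain \<gamma>c where "closest_ordinate T \<gamma>c"
          "\<not> min (\<bar>\<gamma>c - T\<bar> * ln T) (\<bar>upper_ordinate (n + 2) - upper_ordinate n\<bar> * ln (upper_ordinate n)) \<le> \<epsilon>"
          unfolding \<epsilon>_def by blast
        then show ?thesis unfolding \<gamma>_def min_le_iff_disj de_Morgan_disj not_le by blast
      qed
      have gap: "\<gamma> (n + 2) - \<gamma> n > \<epsilon> / (2 * ln T)" if n: "n \<in> I" "n + 2 \<in> I" for n
      proof -
        have "\<gamma> n \<le> \<gamma> (n + 2)" using n by (intro \<gamma>_mono) (auto simp: I_iff)
        then have "\<epsilon> < (\<gamma> (n + 2) - \<gamma> n) * ln (\<gamma> n)" using bad[OF n] by auto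
        also have "\<dots> \<le> (\<gamma> (n + 2) - \<gamma> n) * (2 * ln T)"
          using ln_\<gamma>[OF n(1)] \<open>\<gamma> n \<le> \<gamma> (n + 2)\<close> by (intro mult_left_mono) auto
        finally show ?thesis using lnT by (simp add: divide_less_eq)
      qed
      \<comment> \<open>Otherwise the close triple found above already satisfies the inequality.\<close>
      have \<delta>_small: "\<bar>\<beta>' - 1/2\<bar> < \<delta>0"
      proof (rule ccontr)
        assume "\<not> ?thesis"
        then have "\<delta>0 \<le> \<bar>\<beta>' - 1/2\<bar> * ln T" using lnT \<delta>0(1) mult_mono[of \<delta>0 "\<bar>\<beta>' - 1/2\<bar>" 1 "ln T"] by simp
        then have "C * sqrt \<delta>0 \<le> \<epsilon>" unfolding \<epsilon>_def using C by (intro mult_left_mono) auto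
        then have "16 / c \<le> \<epsilon>" using C by linarith
        then have "16 / c / (2 * ln T) \<le> \<epsilon> / (2 * ln T)" using lnT by (intro divide_right_mono) auto
        then show False using gap[OF n1(1,2)] n1(3) by simp
      qed
      obtain \<gamma>c where \<gamma>c: "closest_ordinate T \<gamma>c" "\<bar>\<gamma>c - T\<bar> * ln T > \<epsilon>" using bad[OF n1(1,2)] by blast
      have \<epsilon>0: "\<epsilon> \<ge> 0" unfolding \<epsilon>_def using C lnT by auto
      have far: "\<bar>Im w - T\<bar> > \<epsilon> / ln T" if w: "w \<in> nontrivial_zeros" for w
      proof -
        have "\<bar>\<gamma>c - T\<bar> \<le> \<bar>Im w - T\<bar>"
          using \<gamma>c(1) w unfolding closest_ordinate_def is_arg_min_def by (meson image_eqI not_le)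
        moreover have "\<bar>\<gamma>c - T\<bar> > \<epsilon> / ln T" using \<gamma>c(2) lnT by (simp add: divide_less_eq)
        ultimately show ?thesis by linarith
      qed
      have Im_ne: "Im w \<noteq> T" if "w \<in> nontrivial_zeros" for w
      proof
        assume "Im w = T"
        then have "\<epsilon> / ln T < 0" using far[OF that] by simp
        then show False using \<epsilon>0 lnT by (simp add: divide_less_0_iff)
      qed
      have nz: "zeta (Complex x T) \<noteq> 0" if "x > -1" for x
        using zeta_zeros_nontrivial[of "Complex x T"] Im_ne[of "Complex x T"] that T10 by auto
      define s1 s2 where "s1 = Complex (1/2) T" and "s2 = Complex \<beta>' T"
      have nz12: "zeta s1 \<noteq> 0" "zeta s2 \<noteq> 0"
        unfolding s1_def s2_def using \<delta>_small \<delta>0 by (auto intro!: nz)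
      have dist12: "norm (s1 - s2) = \<bar>\<beta>' - 1/2\<bar>"
        by (simp add: s1_def s2_def complex_diff complex_norm abs_minus_commute)
      have ld1: "ln T / 4 \<le> norm (deriv zeta s1 / zeta s1)"
        using T3(2)[of T] T T0(3) nz12 abs_Re_le_cmod[of "deriv zeta s1 / zeta s1"] lnT by (auto simp: s1_def)
      have ld2: "deriv zeta s2 / zeta s2 = 0" using crit by (simp add: s2_def)
      \<comment> \<open>On the critical line \<open>\<zeta>'/\<zeta>\<close> has negative real part wherever \<open>\<zeta>\<close> does not vanish.\<close>
      have \<delta>_pos: "\<bar>\<beta>' - 1/2\<bar> > 0"
      proof (rule ccontr)
        assume "\<not> ?thesis"
        then have "s1 = s2" by (simp add: s1_def s2_def)
        then show False using ld1 ld2 lnT by simp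
      qed
      then have \<epsilon>_pos: "\<epsilon> > 0" unfolding \<epsilon>_def using C lnT by (intro mult_pos_pos) auto
      define W where "W = zeros_in_disc T"
      have "log_deriv_controlled K T" using K(3) T T0(2) by simp
      note controlled = this[unfolded log_deriv_controlled_def, folded W_def]
      then have W: "finite W" "real (\<Sum>w\<in>W. zmult w) \<le> K * ln T" by auto
      have W_nontriv: "w \<in> nontrivial_zeros" if "w \<in> W" for w
        using that zeta_zeros_near_height(1)[OF T10, of w] by (auto simp: W_def zeros_in_disc_def)
      \<comment> \<open>Ordinates in the window have logarithm at most \<open>2 * ln T\<close>, so both bounds on the minimum become distances greater than \<open>\<eta>\<close>.\<close>
      define \<eta> where "\<eta> = \<epsilon> / (2 * ln T)"
      have \<eta>: "\<eta> > 0" using \<epsilon>_pos lnT by (simp add: \<eta>_def)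
      have near_sum: "(\<Sum>w\<in>zeros_near T. real (zmult w) * (1 / (Im w - T)\<^sup>2)) \<le> 8 / \<eta>\<^sup>2"
      proof -
        interpret spread_sequence \<gamma> I \<eta> T
          by (rule spread[OF \<eta>]) (use gap in \<open>auto simp: \<eta>_def\<close>)
        have "(\<Sum>w\<in>zeros_near T. real (zmult w) * (1 / (Im w - T)\<^sup>2)) = (\<Sum>n\<in>I. 1 / (Im (upper_zero n) - T)\<^sup>2)"
          unfolding I_def by (rule sum_over_indices(2)[OF Z])
        also have "\<dots> = (\<Sum>n\<in>I. 1 / (\<gamma> n - T)\<^sup>2)" by (simp add: \<gamma>_def upper_ordinate_def)
        also have "\<dots> \<le> 8 / \<eta>\<^sup>2"
        proof (rule sum_inverse_squares_le)
          fix n assume n: "n \<in> I"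
          have "upper_zero n \<in> nontrivial_zeros" using n by (auto simp: I_def zeros_near_def)
          then have "\<epsilon> / ln T < \<bar>\<gamma> n - T\<bar>" using far by (simp add: \<gamma>_def upper_ordinate_def)
          moreover have "\<eta> \<le> \<epsilon> / ln T" using \<epsilon>_pos lnT by (simp add: \<eta>_def field_simps)
          ultimately show "\<eta> \<le> \<bar>\<gamma> n - T\<bar>" by linarith
        qed
        finally show ?thesis .
      qed
      \<comment> \<open>Zeros of the disc outside the window are at vertical distance greater than 1 from \<open>T\<close> and contribute \<open>O(ln T)\<close>.\<close>
      have W_sum: "(\<Sum>w\<in>W. real (zmult w) / (Im w - T)\<^sup>2) \<le> 8 / \<eta>\<^sup>2 + K * ln T"
      proof -
        have "zeros_near T \<subseteq> W" using zeros_near_ball[of _ T] by (auto simp: W_def zeros_in_disc_def)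
        from sum.subset_diff[OF this W(1), of "\<lambda>w. real (zmult w) / (Im w - T)\<^sup>2"]
        have split: "(\<Sum>w\<in>W. real (zmult w) / (Im w - T)\<^sup>2)
          = (\<Sum>w\<in>W - zeros_near T. real (zmult w) / (Im w - T)\<^sup>2) + (\<Sum>w\<in>zeros_near T. real (zmult w) / (Im w - T)\<^sup>2)" .
        have "(\<Sum>w\<in>W - zeros_near T. real (zmult w) / (Im w - T)\<^sup>2) \<le> (\<Sum>w\<in>W - zeros_near T. real (zmult w))"
        proof (rule sum_mono)
          fix w assume w: "w \<in> W - zeros_near T"
          then have "1 \<le> \<bar>Im w - T\<bar>" using W_nontriv[of w] by (auto simp: zeros_near_def)
          then have "1 \<le> (Im w - T)\<^sup>2" using power_mono[of 1 "\<bar>Im w - T\<bar>" 2] by simp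
          then show "real (zmult w) / (Im w - T)\<^sup>2 \<le> real (zmult w)"
            using divide_left_mono[of 1 "(Im w - T)\<^sup>2" "real (zmult w)"] by (cases "Im w = T") auto
        qed
        also have "\<dots> \<le> (\<Sum>w\<in>W. real (zmult w))" using W(1) by (intro sum_mono2) auto
        also have "\<dots> \<le> K * ln T" using W(2) by simp
        finally show ?thesis using near_sum split by simp
      qed
      have "ln T / 4 \<le> norm (deriv zeta s1 / zeta s1 - deriv zeta s2 / zeta s2)"
        unfolding ld2 using ld1 by simp
      also have "\<dots> \<le> norm (s1 - s2) * ((\<Sum>w\<in>W. real (zmult w) / (Im w - T)\<^sup>2) + K * ln T)"
      proof -
        have "norm (Complex 2 T - s1) = 3/2" by (simp add: s1_def complex_diff complex_norm)
        moreover have "norm (Complex 2 T - s2) = \<bar>2 - \<beta>'\<bar>" by (simp add: s2_def complex_diff complex_norm)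
        moreover have "\<bar>2 - \<beta>'\<bar> < 9/5" using \<delta>_small \<delta>0(2) by linarith
        ultimately have "{s1, s2} \<subseteq> ball (Complex 2 T) (9/5)" by (simp add: dist_norm)
        moreover have "Im s1 = T" "Im s2 = T" by (simp_all add: s1_def s2_def)
        ultimately show ?thesis using controlled nz12 Im_ne by blast
      qed
      also have "\<dots> \<le> \<bar>\<beta>' - 1/2\<bar> * (8 / \<eta>\<^sup>2 + 2 * K * ln T)"
        unfolding dist12 using W_sum by (intro mult_left_mono) auto
      also have "\<dots> = \<bar>\<beta>' - 1/2\<bar> * (8 / \<eta>\<^sup>2) + (2 * K * \<bar>\<beta>' - 1/2\<bar>) * ln T" by (simp add: algebra_simps)
      finally have upper: "ln T / 4 \<le> \<bar>\<beta>' - 1/2\<bar> * (8 / \<eta>\<^sup>2) + (2 * K * \<bar>\<beta>' - 1/2\<bar>) * ln T" .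
      have "\<epsilon>\<^sup>2 = C\<^sup>2 * (\<bar>\<beta>' - 1/2\<bar> * ln T)" unfolding \<epsilon>_def power_mult_distrib using lnT by simp
      then have \<eta>_sq: "\<eta>\<^sup>2 = C\<^sup>2 * (\<bar>\<beta>' - 1/2\<bar> * ln T) / (4 * (ln T)\<^sup>2)"
        by (simp add: \<eta>_def power_divide power_mult_distrib)
      have cancel: "d * (8 / (a * (d * l) / (4 * l\<^sup>2))) = 32 / a * l" if "d > 0" "l > 0" "a > 0" for a d l :: real
        using that by (simp add: field_simps power2_eq_square)
      have near: "\<bar>\<beta>' - 1/2\<bar> * (8 / \<eta>\<^sup>2) = 32 / C\<^sup>2 * ln T"
        unfolding \<eta>_sq by (rule cancel) (use \<delta>_pos lnT C in auto)
      have "23\<^sup>2 \<le> C\<^sup>2" using C by (intro power_mono) auto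
      then have "32 / C\<^sup>2 \<le> 1/16" using C by (simp add: divide_le_eq)
      then have 1: "32 / C\<^sup>2 * ln T \<le> 1/16 * ln T" using lnT by (intro mult_right_mono) auto
      have "2 * K * \<bar>\<beta>' - 1/2\<bar> \<le> 2 * K * \<delta>0" using \<delta>_small K(1) by (intro mult_left_mono) auto
      then have "2 * K * \<bar>\<beta>' - 1/2\<bar> \<le> 1/16" using \<delta>0(3) by linarith
      then have 2: "(2 * K * \<bar>\<beta>' - 1/2\<bar>) * ln T \<le> 1/16 * ln T" using lnT by (intro mult_right_mono) auto
      show False using upper 1 2 lnT unfolding near by linarith
    qed
  qed
qed

end
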